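(* Let $\mathbb{T}$ be a dependent type theory with propositional identity types. Then the classifying category of $\mathbb{T}$, with its class of fibrations, carries the structure of a path category; that is, there is a class of morphisms, called weak equivalences, which together with the class of fibrations of the classifying category satisfies all the axioms of a path category.
   Context: **Type theory.** A dependent type theory is a formal system deriving statements $\mathcal{J}\,[\Gamma]$, where $\Gamma=[x_0\in A_0, x_1\in A_1(x_0),\ldots,x_n\in A_n(x_0,\ldots,x_{n-1})]$ is a (possibly empty) well-formed context of distinct typed variables and $\mathcal{J}$ is a judgement of one of the forms $A\in\mathrm{Type}$, $a\in A$, $A=B\in\mathrm{Type}$, $a=b\in A$ (the last two being definitional equality). All rules are stated relative to an arbitrary shared ambient context, which is left implicit. The basic rules are: the variable axiom $x\in A\,[x\in A]$; weakening (from $\mathcal{J}\,[\Gamma]$ and $A\in\mathrm{Type}$ infer $\mathcal{J}\,[x\in A,\Gamma]$, $x$ fresh); substitution (from $\mathcal{J}\,[x\in A,\Gamma]$ and $a\in A$ infer $\mathcal{J}[a/x]\,[\Gamma[a/x]]$); reflexivity, symmetry and transitivity of definitional equality of types and of terms; and compatibility (from $a\in A$ and $A=B$ infer $a\in B$; from $a=b\in A$ and $A=B$ infer $a=b\in B$). The theory may have further type and term constructors and rules; all type and term constructors satisfy the usual congruence rules with respect to definitional equality. **Propositional identity types.** The type theory has propositional identity types if it has constructors $\mathrm{Id},\mathbf{r},\mathbf{J},\mathbf{H}$ (with congruence rules) and the following rules. Formation: from $a\in A$, $b\in A$ infer $\mathrm{Id}_A(a,b)\in\mathrm{Type}$. Introduction: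 from $a\in A$ infer $\mathbf{r}(a)\in\mathrm{Id}_A(a,a)$. Elimination: from $C(x,y,u)\in\mathrm{Type}\,[x\in A,y\in A,u\in\mathrm{Id}_A(x,y),\Delta(x,y,u)]$, $p\in\mathrm{Id}_A(a,b)$ and $d(x)\in C(x,x,\mathbf{r}(x))\,[x\in A,\Delta(x,x,\mathbf{r}(x))]$ infer $\mathbf{J}(a,b,p,d)\in C(a,b,p)\,[\Delta(a,b,p)]$. Computation: from $C(x,y,u)\in\mathrm{Type}\,[x\in A,y\in A,u\in\mathrm{Id}_A(x,y),\Delta(x,y,u)]$, $a\in A$ and $d(x)\in C(x,x,\mathbf{r}(x))\,[x\in A,\Delta(x,x,\mathbf{r}(x))]$ infer $\mathbf{H}(a,d)\in\mathrm{Id}_{C(a,a,\mathbf{r}(a))}(\mathbf{J}(a,a,\mathbf{r}(a),d),d(a))\,[\Delta(a,a,\mathbf{r}(a))]$. Here $\Delta$ is an arbitrary contextual parameter, and $C$, $d$ may depend on its variables (suppressed in the notation). No definitional computation rule, no $\Pi$-types and no $\Sigma$-types are assumed. **Classifying (syntactic) category.** Its objects are contexts, two contexts of the same length being identified if their corresponding types are derivably definitionally equal. For $\Gamma=[x_0\in A_0,\ldots,x_n\in A_n]$, a morphism $\Delta\to\Gamma$ is an equivalence class of sequences of terms $(t_0,\ldots,t_n)$ with $t_0\in A_0\,[\Delta]$, $t_1\in A_1(t_0)\,[\Delta]$, ..., $t_n\in A_n(t_0,\ldots,t_{n-1})\,[\Delta]$ derivable, two such sequences being identified if corresponding terms are derivably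 definitionally equal. Composition is by substitution. A dependent projection is a morphism $[\Gamma,\Delta]\to\Gamma$ dropping a final segment of a context. The fibrations are the morphisms isomorphic to dependent projections. **Path category.** A path category is a category $\mathcal{C}$ with two classes of maps, weak equivalences and fibrations (maps in both classes are called acyclic fibrations), such that: (1) isomorphisms are fibrations and fibrations are closed under composition; (2) the pullback of a fibration along any other map exists and is again a fibration; (3) $\mathcal{C}$ has a terminal object $1$ and every map $X\to 1$ is a fibration; (4) isomorphisms are weak equivalences; (5) weak equivalences satisfy 2-out-of-6: if $f:A\to B$, $g:B\to C$, $h:C\to D$ are composable and $gf$ and $hg$ are weak equivalences, then so are $f,g,h,hgf$; (6) for every object $B$ there is at least one path object, i.e. a factorisation of the diagonal $B\to B\times B$ as a weak equivalence $r:B\to PB$ followed by a fibration $(s,t):PB\to B\times B$; (7) every acyclic fibration has a section; (8) the pullback of an acyclic fibration along any other map exists and is again an acyclic fibration. *)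

theory Defs
  imports Main
begin

section \<open>Categories and path categories\<close>

record ('o, 'a) cat =
  Obj :: "'o set"
  Arr :: "'a set"
  Dom :: "'a \<Rightarrow> 'o"
  Cod :: "'a \<Rightarrow> 'o"
  Ident :: "'o \<Rightarrow> 'a"
  Comp :: "'a \<Rightarrow> 'a \<Rightarrow> 'a"  \<comment> \<open>\<open>Comp C g f\<close> is \<open>g\<close> after \<open>f\<close>\<close>

definition Hom :: "('o, 'a) cat \<Rightarrow> 'o \<Rightarrow> 'o \<Rightarrow> 'a set" where
  "Hom C X Y = {f \<in> Arr C. Dom C f = X \<and> Cod C f = Y}"

locale category =
  fixes C :: "('o, 'a) cat"
  assumes dom_in_Obj: "f \<in> Arr C \<Longrightarrow> Dom C f \<in> Obj C"
    and cod_in_Obj: "f \<in> Arr C \<Longrightarrow> Cod C f \<in> Obj C"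
    and ident_in_Hom: "X \<in> Obj C \<Longrightarrow> Ident C X \<in> Hom C X X"
    and comp_in_Hom: "\<lbrakk>f \<in> Hom C X Y; g \<in> Hom C Y Z\<rbrakk> \<Longrightarrow> Comp C g f \<in> Hom C X Z"
    and comp_ident: "f \<in> Hom C X Y \<Longrightarrow> Comp C f (Ident C X) = f"
    and ident_comp: "f \<in> Hom C X Y \<Longrightarrow> Comp C (Ident C Y) f = f"
    and comp_assoc: "\<lbrakk>f \<in> Hom C W X; g \<in> Hom C X Y; h \<in> Hom C Y Z\<rbrakk>
      \<Longrightarrow> Comp C h (Comp C g f) = Comp C (Comp C h g) f"

definition is_iso :: "('o, 'a) cat \<Rightarrow> 'a \<Rightarrow> bool" where
  "is_iso C f \<longleftrightarrow> f \<in> Arr C \<and> (\<exists>g \<in> Hom C (Cod C f) (Dom C f).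
     Comp C g f = Ident C (Dom C f) \<and> Comp C f g = Ident C (Cod C f))"

definition is_terminal :: "('o, 'a) cat \<Rightarrow> 'o \<Rightarrow> bool" where
  "is_terminal C T \<longleftrightarrow> T \<in> Obj C \<and> (\<forall>X \<in> Obj C. \<exists>!f. f \<in> Hom C X T)"

definition is_product :: "('o, 'a) cat \<Rightarrow> 'o \<Rightarrow> 'o \<Rightarrow> 'o \<Rightarrow> 'a \<Rightarrow> 'a \<Rightarrow> bool" where
  "is_product C X Y P p q \<longleftrightarrow> p \<in> Hom C P X \<and> q \<in> Hom C P Y \<and>
     (\<forall>Z. \<forall>u \<in> Hom C Z X. \<forall>v \<in> Hom C Z Y.
        \<exists>!w. w \<in> Hom C Z P \<and> Comp C p w = u \<and> Comp C q w = v)"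

text \<open>In \<open>is_pullback C f g p q\<close> the square is \<open>f p = g q\<close>; thus \<open>q\<close> is the pullback of \<open>f\<close>
  along \<open>g\<close>.\<close>

definition is_pullback :: "('o, 'a) cat \<Rightarrow> 'a \<Rightarrow> 'a \<Rightarrow> 'a \<Rightarrow> 'a \<Rightarrow> bool" where
  "is_pullback C f g p q \<longleftrightarrow>
     f \<in> Arr C \<and> g \<in> Arr C \<and> Cod C f = Cod C g \<and>
     p \<in> Hom C (Dom C p) (Dom C f) \<and> q \<in> Hom C (Dom C p) (Dom C g) \<and>
     Comp C f p = Comp C g q \<and>
     (\<forall>Z. \<forall>u \<in> Hom C Z (Dom C f). \<forall>v \<in> Hom C Z (Dom C g). Comp C f u = Comp C g v \<longrightarrow>
        (\<exists>!w. w \<in> Hom C Z (Dom C p) \<and> Comp C p w = u \<and> Comp C q w = v))"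

text \<open>\<open>P\<close>, with \<open>r : B \<rightarrow> P\<close> in \<open>W\<close> and \<open>st : P \<rightarrow> B \<times> B\<close> in \<open>F\<close>, factors the diagonal of \<open>B\<close>.\<close>

definition is_path_object ::
  "('o, 'a) cat \<Rightarrow> 'a set \<Rightarrow> 'a set \<Rightarrow> 'o \<Rightarrow> 'o \<Rightarrow> 'a \<Rightarrow> 'a \<Rightarrow> bool" where
  "is_path_object C W F B P r st \<longleftrightarrow>
     (\<exists>BB p1 p2 diag. is_product C B B BB p1 p2 \<and>
        diag \<in> Hom C B BB \<and> Comp C p1 diag = Ident C B \<and> Comp C p2 diag = Ident C B \<and>
        r \<in> Hom C B P \<and> r \<in> W \<and> st \<in> Hom C P BB \<and> st \<in> F \<and> Comp C st r = diag)"

locale path_category = category C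
  for C :: "('o, 'a) cat" +
  fixes W :: "'a set" and F :: "'a set"
  assumes weq_arr: "W \<subseteq> Arr C"
    and fib_arr: "F \<subseteq> Arr C"
    and iso_fib: "is_iso C f \<Longrightarrow> f \<in> F"
    and fib_comp: "\<lbrakk>f \<in> F; g \<in> F; Cod C f = Dom C g\<rbrakk> \<Longrightarrow> Comp C g f \<in> F"
    and fib_pullback_exists:
      "\<lbrakk>f \<in> F; g \<in> Arr C; Cod C g = Cod C f\<rbrakk> \<Longrightarrow> \<exists>p q. is_pullback C f g p q"
    and fib_pullback: "\<lbrakk>f \<in> F; is_pullback C f g p q\<rbrakk> \<Longrightarrow> q \<in> F"
    and terminal: "\<exists>T. is_terminal C T \<and> (\<forall>X \<in> Obj C. Hom C X T \<subseteq> F)"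
    and iso_weq: "is_iso C f \<Longrightarrow> f \<in> W"
    and two_out_of_six:
      "\<lbrakk>f \<in> Hom C A B; g \<in> Hom C B D; h \<in> Hom C D E; Comp C g f \<in> W; Comp C h g \<in> W\<rbrakk>
       \<Longrightarrow> f \<in> W \<and> g \<in> W \<and> h \<in> W \<and> Comp C h (Comp C g f) \<in> W"
    and path_object: "B \<in> Obj C \<Longrightarrow> \<exists>P r st. is_path_object C W F B P r st"
    and acyclic_fib_section:
      "f \<in> W \<inter> F \<Longrightarrow> \<exists>s \<in> Hom C (Cod C f) (Dom C f). Comp C f s = Ident C (Cod C f)"
    and acyclic_fib_pullback_exists:
      "\<lbrakk>f \<in> W \<inter> F; g \<in> Arr C; Cod C g = Cod C f\<rbrakk> \<Longrightarrow> \<exists>p q. is_pullback C f g p q"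
    and acyclic_fib_pullback: "\<lbrakk>f \<in> W \<inter> F; is_pullback C f g p q\<rbrakk> \<Longrightarrow> q \<in> W \<inter> F"


section \<open>Raw syntax\<close>

text \<open>
  De Bruijn expressions over constructors \<open>'c\<close>; types and terms share one syntactic category and
  are told apart by the judgements.  \<open>Bind e\<close> is an abstraction: a constructor that binds \<open>k\<close>
  variables in an argument takes \<open>(Bind ^^ k) e\<close> as that argument.
\<close>

datatype 'c expr = Var nat | Con 'c "'c expr list" | Bind "'c expr"

primrec rename :: "(nat \<Rightarrow> nat) \<Rightarrow> 'c expr \<Rightarrow> 'c expr" where
  "rename \<rho> (Var i) = Var (\<rho> i)"
| "rename \<rho> (Con c es) = Con c (map (rename \<rho>) es)"
| "rename \<rho> (Bind e) = Bind (rename (case_nat 0 (Suc \<circ> \<rho>)) e)"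

definition up :: "(nat \<Rightarrow> 'c expr) \<Rightarrow> nat \<Rightarrow> 'c expr" where
  "up \<sigma> = case_nat (Var 0) (rename Suc \<circ> \<sigma>)"

primrec subst :: "(nat \<Rightarrow> 'c expr) \<Rightarrow> 'c expr \<Rightarrow> 'c expr" where
  "subst \<sigma> (Var i) = \<sigma> i"
| "subst \<sigma> (Con c es) = Con c (map (subst \<sigma>) es)"
| "subst \<sigma> (Bind e) = Bind (subst (up \<sigma>) e)"

primrec scoped :: "nat \<Rightarrow> 'c expr \<Rightarrow> bool" where
  "scoped n (Var i) \<longleftrightarrow> i < n"
| "scoped n (Con c es) \<longleftrightarrow> list_all (scoped n) es"
| "scoped n (Bind e) \<longleftrightarrow> scoped (Suc n) e"

text \<open>
  Contexts, and sequences of terms, are lists whose head is the innermost (last) entry, so that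
  \<open>Var i\<close> refers to entry \<open>i\<close>; the context \<open>[\<Gamma>, \<Delta>]\<close> is \<open>\<Delta> @ \<Gamma>\<close>.

  \<open>sub k ts\<close> replaces the innermost \<open>length ts\<close> variables by \<open>ts\<close> and sends the remaining ones into
  a context with \<open>k\<close> new innermost variables.  Hence \<open>sub k []\<close> is weakening by \<open>k\<close> variables and
  \<open>sub 0 ts\<close> is simultaneous substitution.
\<close>

type_synonym 'c ctx = "'c expr list"

definition sub :: "nat \<Rightarrow> 'c expr list \<Rightarrow> nat \<Rightarrow> 'c expr" where
  "sub k ts i = (if i < length ts then ts ! i else Var (i - length ts + k))"

abbreviation weaken :: "nat \<Rightarrow> 'c expr \<Rightarrow> 'c expr" where
  "weaken k \<equiv> subst (sub k [])"

text \<open>Substitution underneath the variables of a further context \<open>\<Delta>\<close> of length \<open>n\<close>: \<open>inst n \<sigma> e\<close>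
  for an expression \<open>e\<close> over \<open>\<Delta>\<close>, and \<open>inst_ctx \<sigma> \<Delta>\<close> for \<open>\<Delta>\<close> itself.\<close>

definition inst :: "nat \<Rightarrow> (nat \<Rightarrow> 'c expr) \<Rightarrow> 'c expr \<Rightarrow> 'c expr" where
  "inst n \<sigma> = subst ((up ^^ n) \<sigma>)"

primrec inst_ctx :: "(nat \<Rightarrow> 'c expr) \<Rightarrow> 'c ctx \<Rightarrow> 'c ctx" where
  "inst_ctx \<sigma> [] = []"
| "inst_ctx \<sigma> (A # \<Delta>) = inst (length \<Delta>) \<sigma> A # inst_ctx \<sigma> \<Delta>"

text \<open>\<open>IsType A\<close>, \<open>HasType a A\<close>, \<open>EqType A B\<close> and \<open>EqTerm a b A\<close> stand for
  \<open>A \<in> Type\<close>, \<open>a \<in> A\<close>, \<open>A = B \<in> Type\<close> and \<open>a = b \<in> A\<close>.\<close>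

datatype 'e judgement = IsType 'e | HasType 'e 'e | EqType 'e 'e | EqTerm 'e 'e 'e


section \<open>Dependent type theories\<close>

definition wf_ctx :: "('c ctx \<Rightarrow> 'c expr judgement \<Rightarrow> bool) \<Rightarrow> 'c ctx \<Rightarrow> bool" where
  "wf_ctx der \<Gamma> \<longleftrightarrow> (\<forall>i < length \<Gamma>. der (drop (Suc i) \<Gamma>) (IsType (\<Gamma> ! i)))"

text \<open>
  A type theory is given by its derivable statements: any derivability relation that is closed
  under the basic rules, whatever further constructors and rules it may have.  The ambient
  context, implicit in informal presentations, is \<open>\<Xi>\<close>.

  As the rules of the further constructors are not specified, their congruence rules are expressed
  by what they amount to for all expressions built from them: substituting definitionally equal
  terms yields definitionally equal results (\<open>cong_type\<close>, \<open>cong_term\<close>; Martin-Loef's substitution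
  rules for equality).
\<close>

locale type_theory =
  fixes der :: "'c ctx \<Rightarrow> 'c expr judgement \<Rightarrow> bool"  (infix "\<turnstile>" 50)
  assumes context_wf: "\<Gamma> \<turnstile> J \<Longrightarrow> wf_ctx (\<turnstile>) \<Gamma>"
    and context_scoped: "\<lbrakk>\<Gamma> \<turnstile> J; e \<in> set_judgement J\<rbrakk> \<Longrightarrow> scoped (length \<Gamma>) e"
    and variable: "\<Xi> \<turnstile> IsType A \<Longrightarrow> A # \<Xi> \<turnstile> HasType (Var 0) (weaken 1 A)"
    and weakening: "\<lbrakk>\<Gamma> @ \<Xi> \<turnstile> J; \<Xi> \<turnstile> IsType A\<rbrakk>
      \<Longrightarrow> inst_ctx (sub 1 []) \<Gamma> @ A # \<Xi> \<turnstile> map_judgement (inst (length \<Gamma>) (sub 1 [])) J"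
    and substitution: "\<lbrakk>\<Gamma> @ A # \<Xi> \<turnstile> J; \<Xi> \<turnstile> HasType a A\<rbrakk>
      \<Longrightarrow> inst_ctx (sub 0 [a]) \<Gamma> @ \<Xi> \<turnstile> map_judgement (inst (length \<Gamma>) (sub 0 [a])) J"
    and type_refl: "\<Xi> \<turnstile> IsType A \<Longrightarrow> \<Xi> \<turnstile> EqType A A"
    and type_sym: "\<Xi> \<turnstile> EqType A B \<Longrightarrow> \<Xi> \<turnstile> EqType B A"
    and type_trans: "\<lbrakk>\<Xi> \<turnstile> EqType A B; \<Xi> \<turnstile> EqType B D\<rbrakk> \<Longrightarrow> \<Xi> \<turnstile> EqType A D"
    and term_refl: "\<Xi> \<turnstile> HasType a A \<Longrightarrow> \<Xi> \<turnstile> EqTerm a a A"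
    and term_sym: "\<Xi> \<turnstile> EqTerm a b A \<Longrightarrow> \<Xi> \<turnstile> EqTerm b a A"
    and term_trans: "\<lbrakk>\<Xi> \<turnstile> EqTerm a b A; \<Xi> \<turnstile> EqTerm b c A\<rbrakk> \<Longrightarrow> \<Xi> \<turnstile> EqTerm a c A"
    and term_conv: "\<lbrakk>\<Xi> \<turnstile> HasType a A; \<Xi> \<turnstile> EqType A B\<rbrakk> \<Longrightarrow> \<Xi> \<turnstile> HasType a B"
    and term_eq_conv: "\<lbrakk>\<Xi> \<turnstile> EqTerm a b A; \<Xi> \<turnstile> EqType A B\<rbrakk> \<Longrightarrow> \<Xi> \<turnstile> EqTerm a b B"
    and cong_type:
      "\<lbrakk>\<Gamma> @ A # \<Xi> \<turnstile> IsType B; \<Xi> \<turnstile> HasType a A; \<Xi> \<turnstile> HasType a' A; \<Xi> \<turnstile> EqTerm a a' A\<rbrakk>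
       \<Longrightarrow> inst_ctx (sub 0 [a]) \<Gamma> @ \<Xi> \<turnstile>
          EqType (inst (length \<Gamma>) (sub 0 [a]) B) (inst (length \<Gamma>) (sub 0 [a']) B)"
    and cong_term:
      "\<lbrakk>\<Gamma> @ A # \<Xi> \<turnstile> HasType b B; \<Xi> \<turnstile> HasType a A; \<Xi> \<turnstile> HasType a' A; \<Xi> \<turnstile> EqTerm a a' A\<rbrakk>
       \<Longrightarrow> inst_ctx (sub 0 [a]) \<Gamma> @ \<Xi> \<turnstile>
          EqTerm (inst (length \<Gamma>) (sub 0 [a]) b) (inst (length \<Gamma>) (sub 0 [a']) b)
            (inst (length \<Gamma>) (sub 0 [a]) B)"


section \<open>Propositional identity types\<close>

text \<open>
  The four constructors are named by the symbols \<open>\<I>\<close>, \<open>\<r>\<close>, \<open>\<J>\<close>, \<open>\<H>\<close>.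

  The premise \<open>d\<close> of elimination lives in the context \<open>[x \<in> A, \<Delta>(x,x,r(x))]\<close>, whereas
  \<open>J(a,b,p,d)\<close> lives in \<open>\<Delta>(a,b,p)\<close>.  So \<open>J\<close> binds in \<open>d\<close> not only \<open>x\<close> but also the variables of
  \<open>\<Delta>\<close>, and takes the variables of \<open>\<Delta>(a,b,p)\<close> as further arguments, which are suppressed in the
  informal notation; likewise for \<open>H\<close>.  (Leaving the variables of \<open>\<Delta>\<close> free in \<open>d\<close> would confuse
  terms at \<open>\<Delta>(x,x,r(x))\<close> with terms at \<open>\<Delta>(a,b,p)\<close> upon substitution.)  Below, \<open>n\<close> is the length
  of \<open>\<Delta>\<close>, and \<open>as\<close> are the arguments other than \<open>d\<close>.
\<close>

definition elim_tm :: "'c \<Rightarrow> nat \<Rightarrow> 'c expr list \<Rightarrow> 'c expr \<Rightarrow> 'c expr" where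
  "elim_tm c n as d = Con c (map (weaken n) (as @ [(Bind ^^ Suc n) d]) @ map Var (rev [0..<n]))"

text \<open>The context \<open>[x \<in> A, y \<in> A, u \<in> Id\<^sub>A(x,y)]\<close>, and the substitutions \<open>(a, b, p)\<close> and
  \<open>(x, x, r(x))\<close> into it, the latter over the ambient context extended by \<open>x \<in> A\<close>.\<close>

definition id_ctx :: "'c \<Rightarrow> 'c expr \<Rightarrow> 'c ctx" where
  "id_ctx \<I> A = [Con \<I> [weaken 2 A, Var 1, Var 0], weaken 1 A, A]"

abbreviation at_path :: "'c expr \<Rightarrow> 'c expr \<Rightarrow> 'c expr \<Rightarrow> nat \<Rightarrow> 'c expr" where
  "at_path a b p \<equiv> sub 0 [p, b, a]"

abbreviation at_refl :: "'c \<Rightarrow> nat \<Rightarrow> 'c expr" where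
  "at_refl \<r> \<equiv> sub 1 [Con \<r> [Var 0], Var 0, Var 0]"

locale propositional_identity_types = type_theory der
  for der :: "'c ctx \<Rightarrow> 'c expr judgement \<Rightarrow> bool"  (infix "\<turnstile>" 50) +
  fixes \<I> \<r> \<J> \<H> :: 'c
  assumes Id_form: "\<lbrakk>\<Xi> \<turnstile> HasType a A; \<Xi> \<turnstile> HasType b A\<rbrakk> \<Longrightarrow> \<Xi> \<turnstile> IsType (Con \<I> [A, a, b])"
    and Id_intro: "\<Xi> \<turnstile> HasType a A \<Longrightarrow> \<Xi> \<turnstile> HasType (Con \<r> [a]) (Con \<I> [A, a, a])"
    and Id_elim:
      "\<lbrakk>\<Delta> @ id_ctx \<I> A @ \<Xi> \<turnstile> IsType C;
        \<Xi> \<turnstile> HasType p (Con \<I> [A, a, b]);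
        inst_ctx (at_refl \<r>) \<Delta> @ A # \<Xi> \<turnstile> HasType d (inst (length \<Delta>) (at_refl \<r>) C)\<rbrakk>
       \<Longrightarrow> inst_ctx (at_path a b p) \<Delta> @ \<Xi> \<turnstile>
          HasType (elim_tm \<J> (length \<Delta>) [a, b, p] d) (inst (length \<Delta>) (at_path a b p) C)"
    and Id_comp:
      "\<lbrakk>\<Delta> @ id_ctx \<I> A @ \<Xi> \<turnstile> IsType C;
        \<Xi> \<turnstile> HasType a A;
        inst_ctx (at_refl \<r>) \<Delta> @ A # \<Xi> \<turnstile> HasType d (inst (length \<Delta>) (at_refl \<r>) C)\<rbrakk>
       \<Longrightarrow> inst_ctx (at_path a a (Con \<r> [a])) \<Delta> @ \<Xi> \<turnstile>
          HasType (elim_tm \<H> (length \<Delta>) [a] d)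
            (Con \<I> [inst (length \<Delta>) (at_path a a (Con \<r> [a])) C,
                   elim_tm \<J> (length \<Delta>) [a, a, Con \<r> [a]] d,
                   inst (length \<Delta>) (sub 0 [a]) d])"
    and Id_form_cong:
      "\<lbrakk>\<Xi> \<turnstile> EqType A A'; \<Xi> \<turnstile> EqTerm a a' A; \<Xi> \<turnstile> EqTerm b b' A\<rbrakk>
       \<Longrightarrow> \<Xi> \<turnstile> EqType (Con \<I> [A, a, b]) (Con \<I> [A', a', b'])"
    and Id_intro_cong:
      "\<Xi> \<turnstile> EqTerm a a' A \<Longrightarrow> \<Xi> \<turnstile> EqTerm (Con \<r> [a]) (Con \<r> [a']) (Con \<I> [A, a, a])"
    and Id_elim_cong:
      "\<lbrakk>\<Delta> @ id_ctx \<I> A @ \<Xi> \<turnstile> IsType C;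
        \<Xi> \<turnstile> EqTerm a a' A; \<Xi> \<turnstile> EqTerm b b' A; \<Xi> \<turnstile> EqTerm p p' (Con \<I> [A, a, b]);
        inst_ctx (at_refl \<r>) \<Delta> @ A # \<Xi> \<turnstile> EqTerm d d' (inst (length \<Delta>) (at_refl \<r>) C)\<rbrakk>
       \<Longrightarrow> inst_ctx (at_path a b p) \<Delta> @ \<Xi> \<turnstile>
          EqTerm (elim_tm \<J> (length \<Delta>) [a, b, p] d) (elim_tm \<J> (length \<Delta>) [a', b', p'] d')
            (inst (length \<Delta>) (at_path a b p) C)"
    and Id_comp_cong:
      "\<lbrakk>\<Delta> @ id_ctx \<I> A @ \<Xi> \<turnstile> IsType C;
        \<Xi> \<turnstile> EqTerm a a' A;
        inst_ctx (at_refl \<r>) \<Delta> @ A # \<Xi> \<turnstile> EqTerm d d' (inst (length \<Delta>) (at_refl \<r>) C)\<rbrakk>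
       \<Longrightarrow> inst_ctx (at_path a a (Con \<r> [a])) \<Delta> @ \<Xi> \<turnstile>
          EqTerm (elim_tm \<H> (length \<Delta>) [a] d) (elim_tm \<H> (length \<Delta>) [a'] d')
            (Con \<I> [inst (length \<Delta>) (at_path a a (Con \<r> [a])) C,
                   elim_tm \<J> (length \<Delta>) [a, a, Con \<r> [a]] d,
                   inst (length \<Delta>) (sub 0 [a]) d])"


section \<open>The classifying category\<close>

context
  fixes der :: "'c ctx \<Rightarrow> 'c expr judgement \<Rightarrow> bool"  (infix "\<turnstile>" 50)
begin

definition ctx_rel :: "'c ctx rel" where
  "ctx_rel = {(\<Gamma>, \<Gamma>'). wf_ctx (\<turnstile>) \<Gamma> \<and> wf_ctx (\<turnstile>) \<Gamma>' \<and> length \<Gamma> = length \<Gamma>' \<and>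
     (\<forall>i < length \<Gamma>. drop (Suc i) \<Gamma> \<turnstile> EqType (\<Gamma> ! i) (\<Gamma>' ! i))}"

text \<open>The type of entry \<open>i\<close> of a sequence \<open>t\<close> is \<open>\<Gamma> ! i\<close> with the earlier entries
  \<open>drop (Suc i) t\<close> substituted.\<close>

definition ctx_mor :: "'c ctx \<Rightarrow> 'c ctx \<Rightarrow> 'c expr list \<Rightarrow> bool" where
  "ctx_mor \<Delta> \<Gamma> t \<longleftrightarrow> wf_ctx (\<turnstile>) \<Delta> \<and> wf_ctx (\<turnstile>) \<Gamma> \<and> length t = length \<Gamma> \<and>
     (\<forall>i < length \<Gamma>. \<Delta> \<turnstile> HasType (t ! i) (subst (sub 0 (drop (Suc i) t)) (\<Gamma> ! i)))"

text \<open>A morphism is an equivalence class of triples (source, target, sequence of terms), the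
  source and target being themselves only determined up to \<open>ctx_rel\<close>.\<close>

definition mor_rel :: "('c ctx \<times> 'c ctx \<times> 'c expr list) rel" where
  "mor_rel = {((\<Delta>, \<Gamma>, t), (\<Delta>', \<Gamma>', t')).
     ctx_mor \<Delta> \<Gamma> t \<and> ctx_mor \<Delta>' \<Gamma>' t' \<and> (\<Delta>, \<Delta>') \<in> ctx_rel \<and> (\<Gamma>, \<Gamma>') \<in> ctx_rel \<and>
     (\<forall>i < length \<Gamma>. \<Delta> \<turnstile> EqTerm (t ! i) (t' ! i) (subst (sub 0 (drop (Suc i) t)) (\<Gamma> ! i)))}"

definition mor_class ::
  "'c ctx \<Rightarrow> 'c ctx \<Rightarrow> 'c expr list \<Rightarrow> ('c ctx \<times> 'c ctx \<times> 'c expr list) set" where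
  "mor_class \<Delta> \<Gamma> t = mor_rel `` {(\<Delta>, \<Gamma>, t)}"

definition classifying_category ::
  "('c ctx set, ('c ctx \<times> 'c ctx \<times> 'c expr list) set) cat" where
  "classifying_category = \<lparr>
     Obj = {\<Gamma>. wf_ctx (\<turnstile>) \<Gamma>} // ctx_rel,
     Arr = {(\<Delta>, \<Gamma>, t). ctx_mor \<Delta> \<Gamma> t} // mor_rel,
     Dom = (\<lambda>f. {\<Delta>. \<exists>\<Gamma> t. (\<Delta>, \<Gamma>, t) \<in> f}),
     Cod = (\<lambda>f. {\<Gamma>. \<exists>\<Delta> t. (\<Delta>, \<Gamma>, t) \<in> f}),
     Ident = (\<lambda>X. \<Union>\<Gamma> \<in> X. mor_class \<Gamma> \<Gamma> (map Var [0..<length \<Gamma>])),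
     Comp = (\<lambda>g f. \<Union>{mor_class \<Delta> \<Theta> (map (subst (sub 0 t)) u) | \<Delta> \<Gamma> \<Theta> t u.
                        (\<Delta>, \<Gamma>, t) \<in> f \<and> (\<Gamma>, \<Theta>, u) \<in> g})\<rparr>"

definition dependent_projection :: "('c ctx \<times> 'c ctx \<times> 'c expr list) set \<Rightarrow> bool" where
  "dependent_projection f \<longleftrightarrow> (\<exists>\<Gamma> \<Delta>. wf_ctx (\<turnstile>) (\<Delta> @ \<Gamma>) \<and>
     f = mor_class (\<Delta> @ \<Gamma>) \<Gamma> (map Var [length \<Delta>..<length \<Delta> + length \<Gamma>]))"

definition fibrations :: "('c ctx \<times> 'c ctx \<times> 'c expr list) set set" where
  "fibrations = {f \<in> Arr classifying_category. \<exists>p i j. dependent_projection p \<and>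
     is_iso classifying_category i \<and> is_iso classifying_category j \<and>
     i \<in> Hom classifying_category (Dom classifying_category f) (Dom classifying_category p) \<and>
     j \<in> Hom classifying_category (Cod classifying_category f) (Cod classifying_category p) \<and>
     Comp classifying_category p i = Comp classifying_category j f}"

end

end

theory Submission
  imports Defs
begin

text \<open>
The identity type over a display (a one-type projection) gives it a path structure whose
  elimination rule says that pullbacks of reflexivity along fibrations lift weakly against displays:
  the lower triangle commutes, the upper one up to a path.  For a composite of displays the lower
  triangle is obtained by lifting against the base display first and transporting the remaining
  problem back along the resulting path.  Composing paths then yields based path induction, where
  the base point of the path is an arbitrary map; in contrast to the unbased form, this is inherited
  by composites, so that path objects of arbitrary fibrations are built by induction on their length.

  Homotopy of maps into \<open>B\<close> is Leibniz equality: two maps are identified if they satisfy the same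
  fibrations, with parameters.  This is an equivalence relation and a congruence for trivial reasons,
  and homotopy equivalences satisfy 2-out-of-6.  A fibration \<open>f\<close> with \<open>f g\<close> homotopic to the identity
  has a section because \<open>f\<close> is itself one of the fibrations tested; if \<open>s\<close> is a section of \<open>f\<close> with \<open>s f\<close> homotopic to the
  identity, then testing the fibration of fibrewise paths from \<open>s f e\<close> to \<open>e\<close> shows that \<open>f\<close> is
  fibrewise contractible, which is stable under pullback.
\<close>

section \<open>Categories with displayed maps and identity structures\<close>

text \<open>Two obstacles shape the argument. Without a definitional computation rule a lift along
  reflexivity restricts to the given datum only up to a path, so solutions of lifting problems
  cannot be pasted strictly. Without \<Sigma>-types an object is a context of several types, and
  only single types carry identity types; a path object of a context has to be assembled along a
  tower of displays. The induction over the tower carries three statements at once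
  (\<open>path_fibration\<close>): a path structure, based path induction, and lifting with a path
  in the upper triangle. The last one supplies the transport map, with its behaviour at reflexivity,
  from which the next stage is built. Without \<Pi>-types, dependence on parameters is expressed by
  a parameter fibration, by pulling back along an arbitrary map, or by an extra factor
  \<open>X\<close>. Leibniz equality suits this setting because it asks only whether lifts over a
  map exist, which is the kind of conclusion that \<open>lifts\<close> delivers. Syntax enters only
  to verify the axioms of \<open>id_display_category\<close> and to identify \<open>fib\<close> with
  the fibrations of the classifying category.\<close>

context category
begin

abbreviation comp (infixr "\<cdot>" 70) where "g \<cdot> f \<equiv> Comp C g f"

lemma in_Hom [simp]: "f \<in> Hom C X Y \<longleftrightarrow> f \<in> Arr C \<and> Dom C f = X \<and> Cod C f = Y"
  by (simp add: Hom_def)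

lemma comp_type [simp]:
  assumes "f \<in> Arr C" "g \<in> Arr C" "Cod C f = Dom C g"
  shows "g \<cdot> f \<in> Arr C" "Dom C (g \<cdot> f) = Dom C f" "Cod C (g \<cdot> f) = Cod C g"
  using comp_in_Hom[of f "Dom C f" "Dom C g" g "Cod C g"] assms by auto

lemma ident_type [simp]:
  assumes "X \<in> Obj C"
  shows "Ident C X \<in> Arr C" "Dom C (Ident C X) = X" "Cod C (Ident C X) = X"
  using ident_in_Hom[OF assms] by auto

lemma Dom_Cod_Obj [simp]: "f \<in> Arr C \<Longrightarrow> Dom C f \<in> Obj C" "f \<in> Arr C \<Longrightarrow> Cod C f \<in> Obj C"
  by (simp_all add: dom_in_Obj cod_in_Obj)

lemma comp_Ident [simp]: "\<lbrakk>f \<in> Arr C; Dom C f = X\<rbrakk> \<Longrightarrow> f \<cdot> Ident C X = f"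
  using comp_ident[of f X] by auto

lemma Ident_comp [simp]: "\<lbrakk>f \<in> Arr C; Cod C f = X\<rbrakk> \<Longrightarrow> Ident C X \<cdot> f = f"
  using ident_comp[of f _ X] by auto

lemma assoc [simp]:
  "\<lbrakk>f \<in> Arr C; g \<in> Arr C; h \<in> Arr C; Cod C f = Dom C g; Cod C g = Dom C h\<rbrakk>
    \<Longrightarrow> (h \<cdot> g) \<cdot> f = h \<cdot> g \<cdot> f"
  using comp_assoc[of f "Dom C f" "Dom C g" g "Dom C h" h "Cod C h"] by auto

text \<open>Simplification brackets composites to the right, so an equation for
  \<open>g \<cdot> f\<close> does not match inside a longer composite; this is the same equation
  with a tail \<open>x\<close>.\<close>

lemma reassoc:
  assumes "g \<cdot> f = k" "x \<in> Arr C" "f \<in> Arr C" "g \<in> Arr C" "Cod C x = Dom C f" "Cod C f = Dom C g"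
  shows "g \<cdot> f \<cdot> x = k \<cdot> x"
  using assms assoc[of x f g] by simp

lemma isoE:
  assumes "is_iso C f"
  obtains g where "f \<in> Arr C" "g \<in> Arr C" "Dom C g = Cod C f" "Cod C g = Dom C f"
    "g \<cdot> f = Ident C (Dom C f)" "f \<cdot> g = Ident C (Cod C f)" "is_iso C g"
proof -
  obtain g where "f \<in> Arr C" "g \<in> Arr C" "Dom C g = Cod C f" "Cod C g = Dom C f"
    "g \<cdot> f = Ident C (Dom C f)" "f \<cdot> g = Ident C (Cod C f)"
    using assms unfolding is_iso_def by auto
  then show thesis using that[of g] unfolding is_iso_def by (metis in_Hom)
qed

lemma isoI:
  assumes "f \<in> Arr C" "g \<in> Arr C" "Dom C g = Cod C f" "Cod C g = Dom C f"
    "g \<cdot> f = Ident C (Dom C f)" "f \<cdot> g = Ident C (Cod C f)"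
  shows "is_iso C f"
  using assms unfolding is_iso_def by auto

lemma iso_ident: "X \<in> Obj C \<Longrightarrow> is_iso C (Ident C X)"
  by (rule isoI[of _ "Ident C X"]) auto

lemma iso_comp:
  assumes "is_iso C f" "is_iso C g" "Cod C f = Dom C g"
  shows "is_iso C (g \<cdot> f)"
proof -
  obtain f' g' where "f \<in> Arr C" "f' \<in> Arr C" "Dom C f' = Cod C f" "Cod C f' = Dom C f"
    and ff: "f' \<cdot> f = Ident C (Dom C f)" "f \<cdot> f' = Ident C (Cod C f)"
    and "g \<in> Arr C" "g' \<in> Arr C" "Dom C g' = Cod C g" "Cod C g' = Dom C g"
    and gg: "g' \<cdot> g = Ident C (Dom C g)" "g \<cdot> g' = Ident C (Cod C g)"
    using assms(1,2) by (meson isoE)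
  then show ?thesis
    using assms(3) reassoc[OF ff(1)] reassoc[OF ff(2)] reassoc[OF gg(1)] reassoc[OF gg(2)]
    by (intro isoI[of _ "f' \<cdot> g'"]) auto
qed

section \<open>Pullback squares: universal property, pasting and comparison\<close>

lemma pullbackD:
  assumes "is_pullback C f g p q"
  shows "f \<in> Arr C" "g \<in> Arr C" "p \<in> Arr C" "q \<in> Arr C" "Cod C g = Cod C f"
    "Cod C p = Dom C f" "Cod C q = Dom C g" "Dom C q = Dom C p" "f \<cdot> p = g \<cdot> q"
  using assms unfolding is_pullback_def by auto

lemma pullback_lift:
  assumes "is_pullback C f g p q" "u \<in> Hom C S (Dom C f)" "v \<in> Hom C S (Dom C g)" "f \<cdot> u = g \<cdot> v"
  obtains w where "w \<in> Hom C S (Dom C p)" "p \<cdot> w = u" "q \<cdot> w = v"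
  using assms unfolding is_pullback_def by metis

lemma pullback_eq:
  assumes pb: "is_pullback C f g p q" and w: "w \<in> Hom C S (Dom C p)" "w' \<in> Hom C S (Dom C p)"
    and e: "p \<cdot> w = p \<cdot> w'" "q \<cdot> w = q \<cdot> w'"
  shows "w = w'"
proof -
  note [simp] = pullbackD(1-4,6-8)[OF pb]
  have "f \<cdot> p \<cdot> w' = g \<cdot> q \<cdot> w'"
    using reassoc[OF pullbackD(9)[OF pb], of w'] w by (simp add: pullbackD(5)[OF pb])
  moreover have "p \<cdot> w' \<in> Hom C S (Dom C f)" "q \<cdot> w' \<in> Hom C S (Dom C g)" using w by auto
  ultimately have "\<exists>!v. v \<in> Hom C S (Dom C p) \<and> p \<cdot> v = p \<cdot> w' \<and> q \<cdot> v = q \<cdot> w'"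
    using pb unfolding is_pullback_def by blast
  then show ?thesis using w e by blast
qed

lemma pullbackI:
  assumes "f \<in> Arr C" "g \<in> Arr C" "Cod C f = Cod C g" "p \<in> Hom C V (Dom C f)" "q \<in> Hom C V (Dom C g)"
    "f \<cdot> p = g \<cdot> q"
    and lift: "\<And>S u v. \<lbrakk>u \<in> Hom C S (Dom C f); v \<in> Hom C S (Dom C g); f \<cdot> u = g \<cdot> v\<rbrakk>
      \<Longrightarrow> \<exists>w \<in> Hom C S V. p \<cdot> w = u \<and> q \<cdot> w = v"
    and uniq: "\<And>S w w'. \<lbrakk>w \<in> Hom C S V; w' \<in> Hom C S V; p \<cdot> w = p \<cdot> w'; q \<cdot> w = q \<cdot> w'\<rbrakk> \<Longrightarrow> w = w'"
  shows "is_pullback C f g p q"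
proof -
  have "\<exists>!w. w \<in> Hom C S (Dom C p) \<and> p \<cdot> w = u \<and> q \<cdot> w = v"
    if uv: "u \<in> Hom C S (Dom C f)" "v \<in> Hom C S (Dom C g)" "f \<cdot> u = g \<cdot> v" for S u v
  proof -
    have V: "Dom C p = V" using assms(4) by simp
    obtain w where w: "w \<in> Hom C S V" "p \<cdot> w = u" "q \<cdot> w = v" using lift[OF uv] by blast
    show ?thesis unfolding V
    proof (rule ex1I[of _ w])
      show "x = w" if "x \<in> Hom C S V \<and> p \<cdot> x = u \<and> q \<cdot> x = v" for x
        by (rule uniq[of x S w]) (use that w in auto)
    qed (use w in auto)
  qed
  then have "\<forall>S. \<forall>u \<in> Hom C S (Dom C f). \<forall>v \<in> Hom C S (Dom C g). f \<cdot> u = g \<cdot> v \<longrightarrow>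
      (\<exists>!w. w \<in> Hom C S (Dom C p) \<and> p \<cdot> w = u \<and> q \<cdot> w = v)" by blast
  moreover have "p \<in> Hom C (Dom C p) (Dom C f)" "q \<in> Hom C (Dom C p) (Dom C g)"
    using assms(4,5) by auto
  ultimately show ?thesis using assms(1-3,6) unfolding is_pullback_def by blast
qed

lemma pullback_sym: "is_pullback C f g p q \<Longrightarrow> is_pullback C g f q p"
proof (rule pullbackI[where V = "Dom C p"])
  assume P: "is_pullback C f g p q"
  note [simp] = pullbackD(1-4,6-8)[OF P]
  fix S
  show "\<exists>w\<in>Hom C S (Dom C p). q \<cdot> w = u \<and> p \<cdot> w = v"
    if "u \<in> Hom C S (Dom C g)" "v \<in> Hom C S (Dom C f)" "g \<cdot> u = f \<cdot> v" for u v
    by (rule pullback_lift[OF P that(2,1) that(3)[symmetric]]) auto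
  show "w = w'" if "w \<in> Hom C S (Dom C p)" "w' \<in> Hom C S (Dom C p)" "q \<cdot> w = q \<cdot> w'" "p \<cdot> w = p \<cdot> w'" for w w'
    using pullback_eq[OF P that(1,2) that(4,3)] .
qed (use pullbackD in auto)

lemma pullback_paste:
  assumes P: "is_pullback C f g p q" and Q: "is_pullback C f' p p' q'"
  shows "is_pullback C (f \<cdot> f') g p' (q \<cdot> q')"
proof (rule pullbackI[where V = "Dom C p'"])
  note [simp] = pullbackD(1-4,6-8)[OF P] pullbackD(1-4,6-8)[OF Q]
  have [simp]: "Cod C f' = Dom C f" "Cod C g = Cod C f" using pullbackD(5)[OF Q] pullbackD(5)[OF P] by auto
  show "(f \<cdot> f') \<cdot> p' = g \<cdot> q \<cdot> q'"
    using reassoc[OF pullbackD(9)[OF P], of q'] pullbackD(9)[OF Q] by simp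
  fix S
  {
    fix u v assume u: "u \<in> Hom C S (Dom C (f \<cdot> f'))" and v: "v \<in> Hom C S (Dom C g)"
      and e: "(f \<cdot> f') \<cdot> u = g \<cdot> v"
    obtain w where w: "w \<in> Hom C S (Dom C p)" "p \<cdot> w = f' \<cdot> u" "q \<cdot> w = v"
      using pullback_lift[OF P, of "f' \<cdot> u" S v] u v e by auto
    obtain w' where w': "w' \<in> Hom C S (Dom C p')" "p' \<cdot> w' = u" "q' \<cdot> w' = w"
      using pullback_lift[OF Q, of u S w] u w by auto
    show "\<exists>w\<in>Hom C S (Dom C p'). p' \<cdot> w = u \<and> (q \<cdot> q') \<cdot> w = v" using w w' by (intro bexI[of _ w']) auto
  }
  fix w w' assume w: "w \<in> Hom C S (Dom C p')" "w' \<in> Hom C S (Dom C p')"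
    and e: "p' \<cdot> w = p' \<cdot> w'" "(q \<cdot> q') \<cdot> w = (q \<cdot> q') \<cdot> w'"
  have r: "p \<cdot> q' \<cdot> x = f' \<cdot> p' \<cdot> x" if "x \<in> Hom C S (Dom C p')" for x
    using reassoc[OF pullbackD(9)[OF Q, symmetric], of x] that by simp
  have "q' \<cdot> w = q' \<cdot> w'"
    using w e r[of w] r[of w'] by - (rule pullback_eq[OF P, of _ S]; auto)
  then show "w = w'" using w e by - (rule pullback_eq[OF Q, of _ S]; auto)
qed (use pullbackD[OF P] pullbackD[OF Q] in auto)

lemma pullback_compare:
  assumes P: "is_pullback C f g p q" and Q: "is_pullback C f g p' q'"
  obtains \<phi> where "is_iso C \<phi>" "\<phi> \<in> Hom C (Dom C p) (Dom C p')" "p' \<cdot> \<phi> = p" "q' \<cdot> \<phi> = q"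
proof -
  note [simp] = pullbackD(1-4,6-8)[OF P] pullbackD(1-4,6-8)[OF Q]
  obtain a where a: "a \<in> Hom C (Dom C p) (Dom C p')" "p' \<cdot> a = p" "q' \<cdot> a = q"
    using pullback_lift[OF Q, of p "Dom C p" q] pullbackD(9)[OF P] by auto
  obtain b where b: "b \<in> Hom C (Dom C p') (Dom C p)" "p \<cdot> b = p'" "q \<cdot> b = q'"
    using pullback_lift[OF P, of p' "Dom C p'" q'] pullbackD(9)[OF Q] by auto
  have "b \<cdot> a = Ident C (Dom C p)"
    using a b reassoc[OF b(2), of a] reassoc[OF b(3), of a] by - (rule pullback_eq[OF P, of _ "Dom C p"]; auto)
  moreover have "a \<cdot> b = Ident C (Dom C p')"
    using a b reassoc[OF a(2), of b] reassoc[OF a(3), of b] by - (rule pullback_eq[OF Q, of _ "Dom C p'"]; auto)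
  ultimately show thesis using a b that[OF isoI[of a b]] by auto
qed

lemma pullback_of_iso:
  assumes "is_iso C f" "g \<in> Arr C" "Cod C g = Cod C f"
  shows "\<exists>p. is_pullback C f g p (Ident C (Dom C g))"
proof -
  obtain h where h: "f \<in> Arr C" "h \<in> Arr C" "Dom C h = Cod C f" "Cod C h = Dom C f"
    "h \<cdot> f = Ident C (Dom C f)" "f \<cdot> h = Ident C (Cod C f)" using assms(1) by (meson isoE)
  have "is_pullback C f g (h \<cdot> g) (Ident C (Dom C g))"
  proof (rule pullbackI[where V = "Dom C g"])
    fix S u v assume "u \<in> Hom C S (Dom C f)" "v \<in> Hom C S (Dom C g)" "f \<cdot> u = g \<cdot> v"
    then show "\<exists>w\<in>Hom C S (Dom C g). (h \<cdot> g) \<cdot> w = u \<and> Ident C (Dom C g) \<cdot> w = v"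
      using h assms reassoc[OF h(5), of u] by (intro bexI[of _ v]) auto
  qed (use h assms reassoc[OF h(6), of g] in auto)
  then show ?thesis by blast
qed

end

section \<open>Fibrations generated by displays, and the axioms of an identity structure\<close>

locale id_category = category C for C :: "('o, 'a) cat" +
  fixes ID :: "'a \<Rightarrow> 'a \<Rightarrow> 'a \<Rightarrow> 'a \<Rightarrow> 'a \<Rightarrow> bool"
begin

definition display :: "'a set" where "display = {q. \<exists>p1 p2 st r. ID q p1 p2 st r}"

inductive_set fib :: "'a set" where
  iso: "is_iso C f \<Longrightarrow> f \<in> fib"
| step: "\<lbrakk>q \<in> display; q \<in> Arr C; f \<in> fib; f \<in> Arr C; Cod C f = Dom C q\<rbrakk> \<Longrightarrow> q \<cdot> f \<in> fib"

text \<open>Only the lower triangle is required to commute.\<close>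

definition lifts :: "'a \<Rightarrow> bool" where
  "lifts i \<longleftrightarrow> i \<in> Arr C \<and> (\<forall>z \<in> fib. \<forall>m d. m \<in> Hom C (Cod C i) (Cod C z) \<longrightarrow> d \<in> Hom C (Dom C i) (Dom C z) \<longrightarrow>
     z \<cdot> d = m \<cdot> i \<longrightarrow> (\<exists>j \<in> Hom C (Cod C i) (Dom C z). z \<cdot> j = m))"

end

text \<open>
  \<open>ID q p1 p2 st r\<close> says that the display \<open>q : E \<rightarrow> B\<close> has kernel pair \<open>(p1, p2)\<close>, identity type
  \<open>st : P \<rightarrow> E \<times>\<^sub>B E\<close> and reflexivity \<open>r : E \<rightarrow> P\<close>.  It is a relation, since a display in the
  classifying category has no preferred representative.  In \<open>ID_elim\<close> the fibration \<open>y\<close> over \<open>P\<close> is the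
  contextual parameter \<open>\<Delta>\<close>, and the path \<open>h\<close> is the propositional computation rule.
\<close>

locale id_display_category = id_category C ID for C :: "('o, 'a) cat" and ID +
  assumes ID_pullback: "ID q p1 p2 st r \<Longrightarrow> is_pullback C q q p1 p2"
    and ID_st: "ID q p1 p2 st r \<Longrightarrow> st \<in> display \<and> st \<in> Arr C \<and> Cod C st = Dom C p1"
    and ID_refl: "ID q p1 p2 st r \<Longrightarrow> r \<in> Hom C (Dom C q) (Dom C st) \<and>
       p1 \<cdot> st \<cdot> r = Ident C (Dom C q) \<and> p2 \<cdot> st \<cdot> r = Ident C (Dom C q)"
    and ID_stable: "\<lbrakk>ID q p1 p2 st r; g \<in> Arr C; Cod C g = Cod C q\<rbrakk> \<Longrightarrow>
       \<exists>q' p1' p2' st' r' e \<pi>. ID q' p1' p2' st' r' \<and> is_pullback C q g e q' \<and>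
         is_pullback C (q \<cdot> p1 \<cdot> st) g \<pi> (q' \<cdot> p1' \<cdot> st') \<and>
         p1 \<cdot> st \<cdot> \<pi> = e \<cdot> p1' \<cdot> st' \<and> p2 \<cdot> st \<cdot> \<pi> = e \<cdot> p2' \<cdot> st' \<and> \<pi> \<cdot> r' = r \<cdot> e"
    and ID_elim: "\<lbrakk>ID q p1 p2 st r; y \<in> fib; is_pullback C y r k x; ID z p1' p2' st' r';
       m \<in> Hom C (Dom C y) (Cod C z); d \<in> Hom C (Dom C k) (Dom C z); z \<cdot> d = m \<cdot> k\<rbrakk> \<Longrightarrow>
       \<exists>j h. j \<in> Hom C (Dom C y) (Dom C z) \<and> z \<cdot> j = m \<and> h \<in> Hom C (Dom C k) (Dom C st') \<and>
         p1' \<cdot> st' \<cdot> h = j \<cdot> k \<and> p2' \<cdot> st' \<cdot> h = d"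
    and terminal_ex: "\<exists>T. is_terminal C T \<and> (\<forall>X \<in> Obj C. Hom C X T \<subseteq> fib)"
begin

lemma display_Arr: "q \<in> display \<Longrightarrow> q \<in> Arr C"
  unfolding display_def using ID_pullback pullbackD(1) by blast

lemma fib_Arr: "f \<in> fib \<Longrightarrow> f \<in> Arr C"
  by (induction rule: fib.induct) (auto elim: isoE)

lemma display_fib: "q \<in> display \<Longrightarrow> q \<in> fib"
  using fib.step[of q "Ident C (Dom C q)"] iso_ident[of "Dom C q"] display_Arr[of q] by (simp add: fib.iso)

lemma display_pullback:
  assumes "q \<in> display" "g \<in> Arr C" "Cod C g = Cod C q"
  shows "\<exists>e q'. is_pullback C q g e q' \<and> q' \<in> display"
  using assms ID_stable unfolding display_def by blast

text \<open>The isomorphism \<open>\<phi>\<close> is pushed through the display nearest to the base: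
  pulling \<open>q\<close> back along the inverse of \<open>\<phi>\<close> gives
  \<open>\<phi> \<cdot> q = q' \<cdot> \<theta>\<close> with \<open>q'\<close> a display and
  \<open>\<theta>\<close> an isomorphism, to which the induction hypothesis for the rest of the
  tower applies.\<close>

lemma iso_comp_fib: "\<lbrakk>f \<in> fib; is_iso C \<phi>; Cod C f = Dom C \<phi>\<rbrakk> \<Longrightarrow> \<phi> \<cdot> f \<in> fib"
proof (induction arbitrary: \<phi> rule: fib.induct)
  case (iso f) then show ?case by (simp add: fib.iso iso_comp)
next
  case (step q f)
  obtain \<psi> where \<psi>: "\<phi> \<in> Arr C" "\<psi> \<in> Arr C" "Dom C \<psi> = Cod C \<phi>" "Cod C \<psi> = Dom C \<phi>"
    "\<psi> \<cdot> \<phi> = Ident C (Dom C \<phi>)" "\<phi> \<cdot> \<psi> = Ident C (Cod C \<phi>)" "is_iso C \<psi>" using step.prems(1) by (meson isoE)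
  have c: "Cod C q = Dom C \<phi>" using step by simp
  obtain e q' where q': "is_pullback C q \<psi> e q'" "q' \<in> display"
    using display_pullback[OF step.hyps(1), of \<psi>] c \<psi> by auto
  obtain p where p: "is_pullback C \<psi> q p (Ident C (Dom C q))"
    using pullback_of_iso[OF \<psi>(7), of q] c \<psi> step by auto
  note [simp] = pullbackD(1-4,6-8)[OF q'(1)] pullbackD(1-4,6-8)[OF p]
  obtain \<theta> where \<theta>: "is_iso C \<theta>" "\<theta> \<in> Hom C (Dom C p) (Dom C q')" "q' \<cdot> \<theta> = p" "e \<cdot> \<theta> = Ident C (Dom C q)"
    using pullback_compare[OF p pullback_sym[OF q'(1)]] by metis
  have D: "Dom C p = Dom C q" using pullbackD(8)[OF p] step ident_type(2)[of "Dom C q"] by (metis Dom_Cod_Obj(1))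
  have "p = \<phi> \<cdot> q" using pullbackD(9)[OF p] \<psi> step c D reassoc[OF \<psi>(6), of p] by simp
  then have *: "\<phi> \<cdot> q = q' \<cdot> \<theta>" using \<theta> by simp
  have "\<phi> \<cdot> q \<cdot> f = q' \<cdot> \<theta> \<cdot> f"
    using reassoc[OF *, of f] \<psi>(1-4) \<theta>(1,2) step c D display_Arr[OF q'(2)] by simp
  moreover have "\<theta> \<cdot> f \<in> fib" using step.IH[OF \<theta>(1)] \<theta> D step by simp
  ultimately show ?case using fib.step[OF q'(2)] \<theta> D step by simp
qed

lemma fib_comp: "\<lbrakk>g \<in> fib; f \<in> fib; Cod C f = Dom C g\<rbrakk> \<Longrightarrow> g \<cdot> f \<in> fib"
proof (induction rule: fib.induct)
  case (iso f) then show ?case using iso_comp_fib by simp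
next
  case (step q g) then show ?case using fib.step[of q "g \<cdot> f"] fib_Arr[of f] by simp
qed

lemma fib_pullback_ex:
  "\<lbrakk>f \<in> fib; g \<in> Arr C; Cod C g = Cod C f\<rbrakk> \<Longrightarrow> \<exists>p q. is_pullback C f g p q \<and> q \<in> fib"
proof (induction arbitrary: g rule: fib.induct)
  case (iso f) then show ?case using pullback_of_iso[of f g] iso_ident[of "Dom C g"] fib.iso by (meson Dom_Cod_Obj)
next
  case (step q f)
  obtain e q' where q': "is_pullback C q g e q'" "q' \<in> display"
    using display_pullback[OF step.hyps(1), of g] step by auto
  obtain p f' where f': "is_pullback C f e p f'" "f' \<in> fib"
    using step.IH[of e] step pullbackD[OF q'(1)] by force
  show ?case using pullback_paste[OF q'(1) f'(1)] fib_comp[OF display_fib[OF q'(2)] f'(2)] pullbackD[OF q'(1)] pullbackD[OF f'(1)] by auto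
qed

lemma fib_pullback: "\<lbrakk>f \<in> fib; is_pullback C f g p q\<rbrakk> \<Longrightarrow> q \<in> fib"
proof -
  assume f: "f \<in> fib" and p: "is_pullback C f g p q"
  obtain p' q' where q': "is_pullback C f g p' q'" "q' \<in> fib" using fib_pullback_ex[OF f, of g] pullbackD[OF p] by auto
  obtain \<phi> where "is_iso C \<phi>" "\<phi> \<in> Hom C (Dom C p) (Dom C p')" "q' \<cdot> \<phi> = q"
    using pullback_compare[OF p q'(1)] by metis
  then show ?thesis using fib_comp[OF q'(2) fib.iso[of \<phi>]] pullbackD[OF q'(1)] by auto
qed

lemma fib_pullbackE:
  assumes "f \<in> fib" "g \<in> Arr C" "Cod C g = Cod C f"
  obtains p q where "is_pullback C f g p q" "q \<in> fib"
  using fib_pullback_ex[OF assms] by blast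

section \<open>Path structures on fibrations\<close>

definition id_str :: "'a \<Rightarrow> 'a \<Rightarrow> 'a \<Rightarrow> 'a \<Rightarrow> bool" where
  "id_str q s t r \<longleftrightarrow> (\<exists>p1 p2 st. ID q p1 p2 st r \<and> s = p1 \<cdot> st \<and> t = p2 \<cdot> st)"

text \<open>The shape of a fibrewise path object: nothing is said about elimination, and of
  \<open>r\<close> only the endpoints are prescribed.\<close>

definition path_str :: "'a \<Rightarrow> 'a \<Rightarrow> 'a \<Rightarrow> 'a \<Rightarrow> bool" where
  "path_str f s t r \<longleftrightarrow> f \<in> fib \<and> r \<in> Hom C (Dom C f) (Dom C s) \<and>
     s \<cdot> r = Ident C (Dom C f) \<and> t \<cdot> r = Ident C (Dom C f) \<and>
     (\<exists>p1 p2 st. is_pullback C f f p1 p2 \<and> st \<in> fib \<and> Cod C st = Dom C p1 \<and> s = p1 \<cdot> st \<and> t = p2 \<cdot> st)"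

lemma display_id_str: "q \<in> display \<longleftrightarrow> (\<exists>s t r. id_str q s t r)"
  unfolding display_def id_str_def by blast

lemma id_str_display: "id_str q s t r \<Longrightarrow> q \<in> display"
  using display_id_str by blast

lemma id_str_path_str: "id_str q s t r \<Longrightarrow> path_str q s t r"
proof -
  assume "id_str q s t r"
  then obtain p1 p2 st where I: "ID q p1 p2 st r" "s = p1 \<cdot> st" "t = p2 \<cdot> st" unfolding id_str_def by blast
  note P = ID_pullback[OF I(1)] and S = ID_st[OF I(1)] and R = ID_refl[OF I(1)]
  show ?thesis unfolding path_str_def
    using P S R I display_fib[of q] display_fib[of st] pullbackD[OF P] id_str_display[OF \<open>id_str q s t r\<close>]
    by (intro conjI exI[of _ p1] exI[of _ p2] exI[of _ st]) auto
qed

lemma path_strD: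
  assumes "path_str f s t r"
  shows "f \<in> fib" "f \<in> Arr C" "s \<in> Arr C" "Cod C s = Dom C f" "t \<in> Arr C" "Dom C t = Dom C s" "Cod C t = Dom C f"
    "r \<in> Arr C" "Dom C r = Dom C f" "Cod C r = Dom C s"
    "f \<cdot> t = f \<cdot> s" "s \<cdot> r = Ident C (Dom C f)" "t \<cdot> r = Ident C (Dom C f)" "s \<in> fib" "t \<in> fib"
proof -
  obtain p1 p2 st where P: "is_pullback C f f p1 p2" and st: "st \<in> fib" "Cod C st = Dom C p1"
    and s: "s = p1 \<cdot> st" and t: "t = p2 \<cdot> st"
    and r: "r \<in> Hom C (Dom C f) (Dom C s)" "s \<cdot> r = Ident C (Dom C f)" "t \<cdot> r = Ident C (Dom C f)" and f: "f \<in> fib"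
    using assms unfolding path_str_def by blast
  note [simp] = pullbackD(1-8)[OF P] fib_Arr[OF st(1)] st(2)
  show "f \<in> fib" "f \<in> Arr C" "s \<in> Arr C" "Cod C s = Dom C f" "t \<in> Arr C" "Dom C t = Dom C s" "Cod C t = Dom C f"
    "r \<in> Arr C" "Dom C r = Dom C f" "Cod C r = Dom C s"
    "s \<cdot> r = Ident C (Dom C f)" "t \<cdot> r = Ident C (Dom C f)"
    using f r by (auto simp: s t)
  show "f \<cdot> t = f \<cdot> s" using reassoc[OF pullbackD(9)[OF P], of st] by (simp add: s t)
  show "s \<in> fib" "t \<in> fib"
    unfolding s t using fib_comp[OF fib_pullback[OF f pullback_sym[OF P]] st(1)] fib_comp[OF fib_pullback[OF f P] st(1)] by auto
qed

text \<open>The pullback \<open>c\<close> of \<open>st\<close> along \<open>(a, b)\<close> is the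
  fibration over \<open>S\<close> of paths from \<open>a\<close> to \<open>b\<close>. It turns the
  existence of such a path into a lifting problem, hence into something that elimination can
  establish.\<close>

lemma path_str_fibration:
  assumes "path_str f s t r" "a \<in> Hom C S (Dom C f)" "b \<in> Hom C S (Dom C f)" "f \<cdot> a = f \<cdot> b"
  obtains u c where "c \<in> fib" "u \<in> Hom C (Dom C c) (Dom C s)" "Cod C c = S" "s \<cdot> u = a \<cdot> c" "t \<cdot> u = b \<cdot> c"
    "\<And>X v h. \<lbrakk>v \<in> Hom C X S; h \<in> Hom C X (Dom C s); s \<cdot> h = a \<cdot> v; t \<cdot> h = b \<cdot> v\<rbrakk>
       \<Longrightarrow> \<exists>w \<in> Hom C X (Dom C c). u \<cdot> w = h \<and> c \<cdot> w = v"
proof -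
  note [simp] = path_strD(2-10)[OF assms(1)]
  obtain p1 p2 st where P: "is_pullback C f f p1 p2" and st: "st \<in> fib" "Cod C st = Dom C p1"
    and s: "s = p1 \<cdot> st" and t: "t = p2 \<cdot> st" using assms(1) unfolding path_str_def by blast
  note [simp] = pullbackD(1-8)[OF P] fib_Arr[OF st(1)] st(2)
  obtain n where n: "n \<in> Hom C S (Dom C p1)" "p1 \<cdot> n = a" "p2 \<cdot> n = b"
    using pullback_lift[OF P assms(2,3,4)] .
  obtain u c where uc: "is_pullback C st n u c" "c \<in> fib"
    using fib_pullbackE[OF st(1), of n] n by auto
  note [simp] = pullbackD(1-4,6-8)[OF uc(1)]
  have sq: "st \<cdot> u = n \<cdot> c" using pullbackD(9)[OF uc(1)] .
  have D: "Dom C s = Dom C st" by (simp add: s)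
  show thesis
  proof (rule that[OF uc(2), of u])
    show "s \<cdot> u = a \<cdot> c" "t \<cdot> u = b \<cdot> c"
      using sq n reassoc[OF n(2), of c] reassoc[OF n(3), of c] by (auto simp: s t)
    fix X v h assume v: "v \<in> Hom C X S" and h: "h \<in> Hom C X (Dom C s)" and e: "s \<cdot> h = a \<cdot> v" "t \<cdot> h = b \<cdot> v"
    have "st \<cdot> h = n \<cdot> v"
      using e n v h reassoc[OF n(2), of v] reassoc[OF n(3), of v]
      by - (rule pullback_eq[OF P, of _ X]; auto simp: s t)
    then obtain w where "w \<in> Hom C X (Dom C u)" "u \<cdot> w = h" "c \<cdot> w = v"
      using pullback_lift[OF uc(1), of h X v] h v n D by auto
    then show "\<exists>w \<in> Hom C X (Dom C c). u \<cdot> w = h \<and> c \<cdot> w = v" by auto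
  qed (use D n in auto)
qed

lemma id_str_elim:
  assumes "id_str q s t r" "y \<in> fib" "is_pullback C y r k x" "id_str z s' t' r'"
    "m \<in> Hom C (Dom C y) (Cod C z)" "d \<in> Hom C (Dom C k) (Dom C z)" "z \<cdot> d = m \<cdot> k"
  obtains j h where "j \<in> Hom C (Dom C y) (Dom C z)" "z \<cdot> j = m" "h \<in> Hom C (Dom C k) (Dom C s')"
    "s' \<cdot> h = j \<cdot> k" "t' \<cdot> h = d"
proof -
  obtain p1 p2 st where I: "ID q p1 p2 st r" using assms(1) unfolding id_str_def by blast
  obtain p1' p2' st' where I': "ID z p1' p2' st' r'" "s' = p1' \<cdot> st'" "t' = p2' \<cdot> st'"
    using assms(4) unfolding id_str_def by blast
  note [simp] = pullbackD(1-8)[OF ID_pullback[OF I'(1)]]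
  have [simp]: "st' \<in> Arr C" "Cod C st' = Dom C p1'" using ID_st[OF I'(1)] by auto
  show thesis
    using ID_elim[OF I assms(2,3) I'(1) assms(5-7)] that by (auto simp: I'(2,3))
qed

text \<open>Since \<open>st\<close> is again a display, paths with equal endpoints have paths
  between them; \<open>s2\<close> and \<open>t2\<close> are the ends of these two-dimensional
  paths.\<close>

lemma id_str_st:
  assumes "id_str q s t r"
  obtains p1 p2 st s2 t2 r2 where "is_pullback C q q p1 p2" "st \<in> Arr C" "Cod C st = Dom C p1"
    "p1 \<cdot> st = s" "p2 \<cdot> st = t" "id_str st s2 t2 r2"
proof -
  obtain p1 p2 st where I: "ID q p1 p2 st r" "s = p1 \<cdot> st" "t = p2 \<cdot> st"
    using assms unfolding id_str_def by blast
  obtain s2 t2 r2 where "id_str st s2 t2 r2" using ID_st[OF I(1)] display_id_str by blast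
  then show thesis using that[OF ID_pullback[OF I(1)]] ID_st[OF I(1)] I(2,3) by blast
qed

lemma id_str_stable:
  assumes "id_str q s t r" "g \<in> Arr C" "Cod C g = Cod C q"
  obtains q' s' t' r' e \<pi> where "id_str q' s' t' r'" "is_pullback C q g e q'"
    "is_pullback C (q \<cdot> s) g \<pi> (q' \<cdot> s')" "s \<cdot> \<pi> = e \<cdot> s'" "t \<cdot> \<pi> = e \<cdot> t'" "\<pi> \<cdot> r' = r \<cdot> e"
proof -
  obtain p1 p2 st where I: "ID q p1 p2 st r" and [simp]: "s = p1 \<cdot> st" "t = p2 \<cdot> st"
    using assms(1) unfolding id_str_def by blast
  obtain q' p1' p2' st' r' e \<pi> where H: "ID q' p1' p2' st' r'" "is_pullback C q g e q'"
    "is_pullback C (q \<cdot> p1 \<cdot> st) g \<pi> (q' \<cdot> p1' \<cdot> st')"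
    "p1 \<cdot> st \<cdot> \<pi> = e \<cdot> p1' \<cdot> st'" "p2 \<cdot> st \<cdot> \<pi> = e \<cdot> p2' \<cdot> st'" "\<pi> \<cdot> r' = r \<cdot> e"
    using ID_stable[OF I assms(2,3)] by blast
  note pullbackD(1-8)[OF ID_pullback[OF I]] ID_st[OF I] pullbackD(3)[OF H(3)] pullbackD(6)[OF H(3)]
  then have "(p1 \<cdot> st) \<cdot> \<pi> = e \<cdot> p1' \<cdot> st'" "(p2 \<cdot> st) \<cdot> \<pi> = e \<cdot> p2' \<cdot> st'"
    using H(4,5) by simp_all
  moreover have "id_str q' (p1' \<cdot> st') (p2' \<cdot> st') r'" using H(1) unfolding id_str_def by blast
  ultimately show thesis using that[of q' "p1' \<cdot> st'" "p2' \<cdot> st'" r'] H by simp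
qed

section \<open>Weak lifting along reflexivity, and transport\<close>

lemma liftsD:
  assumes "lifts i" "z \<in> fib" "m \<in> Hom C (Cod C i) (Cod C z)" "d \<in> Hom C (Dom C i) (Dom C z)" "z \<cdot> d = m \<cdot> i"
  obtains j where "j \<in> Hom C (Cod C i) (Dom C z)" "z \<cdot> j = m"
  using assms unfolding lifts_def by metis

lemma liftsI:
  assumes "i \<in> Arr C" "\<And>z m d. \<lbrakk>z \<in> fib; m \<in> Hom C (Cod C i) (Cod C z); d \<in> Hom C (Dom C i) (Dom C z);
    z \<cdot> d = m \<cdot> i\<rbrakk> \<Longrightarrow> \<exists>j \<in> Hom C (Cod C i) (Dom C z). z \<cdot> j = m"
  shows "lifts i"
  using assms unfolding lifts_def by blast

text \<open>The whole lifting problem is generalised because the step uses the hypothesis for the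
  shorter fibration \<open>f\<close> twice: for the reflexivity of the stripped display
  \<open>z1\<close>, which yields transport in \<open>f\<close>, and for the original
  \<open>q\<close>.\<close>

lemma refl_pullback_lifts_against:
  "z \<in> fib \<Longrightarrow> id_str q s t r \<Longrightarrow> y \<in> fib \<Longrightarrow> is_pullback C y r k x \<Longrightarrow>
    m \<in> Hom C (Dom C y) (Cod C z) \<Longrightarrow> d \<in> Hom C (Dom C k) (Dom C z) \<Longrightarrow> z \<cdot> d = m \<cdot> k \<Longrightarrow>
    \<exists>j \<in> Hom C (Dom C y) (Dom C z). z \<cdot> j = m"
proof (induction arbitrary: q s t r y k x m d rule: fib.induct)
  case (iso z)
  then obtain g where "z \<in> Arr C" "g \<in> Arr C" "Dom C g = Cod C z" "Cod C g = Dom C z"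
    and g: "z \<cdot> g = Ident C (Cod C z)" by (meson isoE)
  then show ?case using reassoc[OF g, of m] iso by (intro bexI[of _ "g \<cdot> m"]) auto
next
  case (step z1 f)
  note [simp] = step.hyps(2,4,5)
  note [simp] = pullbackD(1-4,6-8)[OF step.prems(3)]
  obtain s1 t1 r1 where I1: "id_str z1 s1 t1 r1" using step.hyps(1) display_id_str by blast
  note P1 = path_strD[OF id_str_path_str[OF I1]] and [simp] = path_strD(2-10)[OF id_str_path_str[OF I1]]
  have "z1 \<cdot> f \<cdot> d = m \<cdot> k" using step.prems by simp
  then obtain j1 h where j1: "j1 \<in> Hom C (Dom C y) (Dom C z1)" "z1 \<cdot> j1 = m"
    and h: "h \<in> Hom C (Dom C k) (Dom C s1)" "s1 \<cdot> h = j1 \<cdot> k" "t1 \<cdot> h = f \<cdot> d"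
    using id_str_elim[OF step.prems(1-3) I1, of m "f \<cdot> d"] step.prems by auto
  \<comment> \<open>Points of \<open>f\<close> over the target of a path of \<open>z1\<close>. They
    must be moved to its source, because \<open>d\<close> lies over the target of \<open>h\<close>
    while the remaining problem lies over its source \<open>j1 \<cdot> k\<close>.\<close>
  obtain a b where ab: "is_pullback C f t1 a b" "b \<in> fib" using fib_pullbackE[OF step.hyps(3), of t1] by auto
  note [simp] = pullbackD(1-4,6-8)[OF ab(1)]
  obtain k' x' where k': "is_pullback C b r1 k' x'" using fib_pullback_ex[OF ab(2), of r1] by auto
  note [simp] = pullbackD(1-4,6-8)[OF k']
  note e = pullbackD(9)[OF ab(1)] pullbackD(9)[OF k'] P1(12,13)
  \<comment> \<open>At reflexivity source and target agree, so there \<open>a\<close> itself solves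
    the transport problem.\<close>
  obtain j2 where j2: "j2 \<in> Hom C (Dom C b) (Dom C f)" "f \<cdot> j2 = s1 \<cdot> b"
    using step.IH[OF I1 ab(2) k', of "s1 \<cdot> b" "a \<cdot> k'"] by (auto simp: e e[THEN reassoc])
  obtain w where w: "w \<in> Hom C (Dom C k) (Dom C a)" "a \<cdot> w = d" "b \<cdot> w = h"
    using pullback_lift[OF ab(1), of d "Dom C k" h] h step.prems by auto
  have "f \<cdot> j2 \<cdot> w = j1 \<cdot> k" using w j2 h reassoc[OF j2(2), of w] by auto
  then obtain j3 where "j3 \<in> Hom C (Dom C y) (Dom C f)" "f \<cdot> j3 = j1"
    using step.IH[OF step.prems(1-3), of j1 "j2 \<cdot> w"] j1 j2 w by auto
  then show ?case using j1 by (intro bexI[of _ j3]) auto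
qed

lemma refl_pullback_lifts:
  assumes "id_str q s t r" "y \<in> fib" "is_pullback C y r k x"
  shows "lifts k"
  using refl_pullback_lifts_against[OF _ assms] pullbackD[OF assms(3)] by (intro liftsI) auto

lemma refl_lifts:
  assumes "id_str q s t r" shows "lifts r"
proof -
  note [simp] = path_strD(2-10)[OF id_str_path_str[OF assms]]
  have "is_iso C (Ident C (Dom C s))" by (simp add: iso_ident)
  moreover have "is_pullback C (Ident C (Dom C s)) r r (Ident C (Dom C q))"
    by (rule pullbackI[where V = "Dom C q"]) auto
  ultimately show ?thesis using refl_pullback_lifts[OF assms fib.iso] by blast
qed

text \<open>The predicate \<open>z\<close> is pulled back to the paths along one endpoint
  \<open>\<alpha>\<close> and lifted along the other, \<open>\<beta>\<close>; at reflexivity the two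
  agree. Keeping the endpoints variable gives both directions of transport at once.\<close>

lemma transport_display:
  assumes I: "id_str q s t r" and ab: "(\<alpha> = s \<and> \<beta> = t) \<or> (\<alpha> = t \<and> \<beta> = s)" and z: "z \<in> fib"
    and m: "m \<in> Hom C (Dom C q) (Cod C z)" and h: "h \<in> Hom C S (Dom C s)"
    and d: "d \<in> Hom C S (Dom C z)" "z \<cdot> d = m \<cdot> \<alpha> \<cdot> h"
  shows "\<exists>d' \<in> Hom C S (Dom C z). z \<cdot> d' = m \<cdot> \<beta> \<cdot> h"
proof -
  note P = path_strD[OF id_str_path_str[OF I]] and [simp] = path_strD(2-10)[OF id_str_path_str[OF I]] fib_Arr[OF z]
  have [simp]: "\<alpha> \<in> Arr C" "Dom C \<alpha> = Dom C s" "Cod C \<alpha> = Dom C q" "\<beta> \<in> Arr C" "Dom C \<beta> = Dom C s" "Cod C \<beta> = Dom C q"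
    and r: "\<alpha> \<cdot> r = Ident C (Dom C q)" "\<beta> \<cdot> r = Ident C (Dom C q)" using ab P by auto
  obtain a b where A: "is_pullback C z (m \<cdot> \<alpha>) a b" "b \<in> fib" using fib_pullbackE[OF z, of "m \<cdot> \<alpha>"] m by auto
  note [simp] = pullbackD(1-4,6-8)[OF A(1)] m[unfolded in_Hom] h[unfolded in_Hom] d(1)[unfolded in_Hom]
  obtain k x where k: "is_pullback C b r k x" using fib_pullback_ex[OF A(2), of r] by auto
  note [simp] = pullbackD(1-4,6-8)[OF k]
  have ea: "z \<cdot> a = m \<cdot> \<alpha> \<cdot> b" using pullbackD(9)[OF A(1)] by simp
  note e = ea pullbackD(9)[OF k] r
  obtain j where j: "j \<in> Hom C (Dom C b) (Dom C z)" "z \<cdot> j = m \<cdot> \<beta> \<cdot> b"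
    using liftsD[OF refl_pullback_lifts[OF I A(2) k] z, of "m \<cdot> \<beta> \<cdot> b" "a \<cdot> k"] by (auto simp: e e[THEN reassoc])
  obtain w where w: "w \<in> Hom C S (Dom C a)" "a \<cdot> w = d" "b \<cdot> w = h"
    using pullback_lift[OF A(1), of d S h] d(2) by auto
  show ?thesis using w j reassoc[OF j(2), of w] by (intro bexI[of _ "j \<cdot> w"]) auto
qed

text \<open>\<open>V\<close> is the pullback of \<open>q\<close> along an arbitrary map, so that \<open>m\<close> may involve parameters.\<close>

lemma transport:
  assumes I: "id_str q s t r" and ab: "(\<alpha> = s \<and> \<beta> = t) \<or> (\<alpha> = t \<and> \<beta> = s)"
    and V: "is_pullback C q g u e"
    and v0: "v0 \<in> Hom C X (Dom C u)" and v1: "v1 \<in> Hom C X (Dom C u)" and ev: "e \<cdot> v0 = e \<cdot> v1"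
    and h: "h \<in> Hom C X (Dom C s)" "\<alpha> \<cdot> h = u \<cdot> v0" "\<beta> \<cdot> h = u \<cdot> v1"
    and z: "z \<in> fib" and m: "m \<in> Hom C (Dom C u) (Cod C z)"
    and d: "d \<in> Hom C X (Dom C z)" "z \<cdot> d = m \<cdot> v0"
  shows "\<exists>d' \<in> Hom C X (Dom C z). z \<cdot> d' = m \<cdot> v1"
proof -
  note P = path_strD[OF id_str_path_str[OF I]] and [simp] = path_strD(2-10)[OF id_str_path_str[OF I]] fib_Arr[OF z]
  note [simp] = pullbackD(1-4,6-8)[OF V]
  note [simp] = v0[unfolded in_Hom] v1[unfolded in_Hom] h(1)[unfolded in_Hom] m[unfolded in_Hom] d(1)[unfolded in_Hom]
  \<comment> \<open>By stability a path of \<open>q\<close> over a point of the form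
    \<open>g \<cdot> e \<cdot> v0\<close> is a path of the pulled back display; there the parameters
    are part of the base and the previous lemma applies.\<close>
  obtain q' s' t' r' e' \<pi> where I': "id_str q' s' t' r'" and Q: "is_pullback C q g e' q'"
    and P': "is_pullback C (q \<cdot> s) g \<pi> (q' \<cdot> s')" and c: "s \<cdot> \<pi> = e' \<cdot> s'" "t \<cdot> \<pi> = e' \<cdot> t'"
    using id_str_stable[OF I pullbackD(2)[OF V] pullbackD(5)[OF V]] by metis
  note P2 = path_strD[OF id_str_path_str[OF I']] and [simp] = path_strD(2-10)[OF id_str_path_str[OF I']]
  note [simp] = pullbackD(3,4,6,7)[OF Q] pullbackD(3,6)[OF P']
  have [simp]: "Dom C s' = Dom C \<pi>" "Dom C e' = Dom C q'" using pullbackD(8)[OF P'] pullbackD(8)[OF Q] by auto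
  obtain \<phi> where \<phi>: "\<phi> \<in> Hom C (Dom C q') (Dom C u)" "u \<cdot> \<phi> = e'" "e \<cdot> \<phi> = q'"
    using pullback_lift[OF V, of e' "Dom C q'" q'] pullbackD(9)[OF Q] by auto
  define \<alpha>' \<beta>' where "\<alpha>' = (if \<alpha> = s \<and> \<beta> = t then s' else t')" and "\<beta>' = (if \<alpha> = s \<and> \<beta> = t then t' else s')"
  have ab': "(\<alpha>' = s' \<and> \<beta>' = t') \<or> (\<alpha>' = t' \<and> \<beta>' = s')"
    and [simp]: "\<alpha> \<in> Arr C" "Dom C \<alpha> = Dom C s" "Cod C \<alpha> = Dom C q" "\<beta> \<in> Arr C" "Dom C \<beta> = Dom C s" "Cod C \<beta> = Dom C q"
      "\<alpha>' \<in> Arr C" "Dom C \<alpha>' = Dom C \<pi>" "Cod C \<alpha>' = Dom C q'" "\<beta>' \<in> Arr C" "Dom C \<beta>' = Dom C \<pi>" "Cod C \<beta>' = Dom C q'"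
    and c': "\<alpha> \<cdot> \<pi> = e' \<cdot> \<alpha>'" "\<beta> \<cdot> \<pi> = e' \<cdot> \<beta>'" "q \<cdot> \<alpha> = q \<cdot> s" "q' \<cdot> \<alpha>' = q' \<cdot> s'" "q' \<cdot> \<beta>' = q' \<cdot> s'"
    using ab c P(11) P2(11) by (auto simp: \<alpha>'_def \<beta>'_def)
  have sq: "q \<cdot> u = g \<cdot> e" using pullbackD(9)[OF V] .
  have "q \<cdot> s \<cdot> h = q \<cdot> \<alpha> \<cdot> h" using reassoc[OF c'(3), of h] by simp
  also have "\<dots> = g \<cdot> e \<cdot> v0" using h(2) reassoc[OF sq, of v0] pullbackD(5)[OF V] by simp
  finally have "(q \<cdot> s) \<cdot> h = g \<cdot> e \<cdot> v0" by simp
  then obtain \<theta> where \<theta>: "\<theta> \<in> Hom C X (Dom C \<pi>)" "\<pi> \<cdot> \<theta> = h" "q' \<cdot> s' \<cdot> \<theta> = e \<cdot> v0"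
    using pullback_lift[OF P', of h X "e \<cdot> v0"] by auto
  note [simp] = \<theta>(1)[unfolded in_Hom] \<phi>(1)[unfolded in_Hom]
  have "\<phi> \<cdot> \<alpha>' \<cdot> \<theta> = v0"
    using reassoc[OF \<phi>(2), of "\<alpha>' \<cdot> \<theta>"] reassoc[OF \<phi>(3), of "\<alpha>' \<cdot> \<theta>"] reassoc[OF c'(1), of \<theta>] \<theta>(2,3) h(2)
      reassoc[OF c'(4), of \<theta>]
    by - (rule pullback_eq[OF V, of _ X]; simp)
  moreover have "\<phi> \<cdot> \<beta>' \<cdot> \<theta> = v1"
    using reassoc[OF \<phi>(2), of "\<beta>' \<cdot> \<theta>"] reassoc[OF \<phi>(3), of "\<beta>' \<cdot> \<theta>"] reassoc[OF c'(2), of \<theta>] \<theta>(2,3) h(3)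
      reassoc[OF c'(5), of \<theta>] ev
    by - (rule pullback_eq[OF V, of _ X]; simp)
  ultimately show ?thesis
    using transport_display[OF I' ab' z, of "m \<cdot> \<phi>" \<theta> X d] d(2) by auto
qed

section \<open>Based path induction for displays\<close>

text \<open>
  \<open>u\<close> ranges over the paths starting at the source of \<open>h\<close>, and \<open>\<sigma>\<close> picks out \<open>h\<close> itself.  For \<open>h\<close>
  reflexivity this is based path induction; allowing every \<open>h\<close> says that the space of such paths is
  contractible.
\<close>

definition based_elim :: "'a \<Rightarrow> bool" where
  "based_elim s \<longleftrightarrow> (\<forall>h u \<pi> \<sigma>. h \<in> Arr C \<and> Cod C h = Dom C s \<and> is_pullback C s (s \<cdot> h) u \<pi> \<and>
     \<sigma> \<in> Hom C (Dom C h) (Dom C u) \<and> u \<cdot> \<sigma> = h \<and> \<pi> \<cdot> \<sigma> = Ident C (Dom C h) \<longrightarrow> lifts \<sigma>)"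

text \<open>\<open>T\<close> composes \<open>v\<close> with \<open>w\<close>, by elimination on \<open>w\<close>.\<close>

lemma path_composition:
  assumes I: "id_str q s t r" and B: "is_pullback C q q p1 p2" and st: "st \<in> Arr C" "Cod C st = Dom C p1"
    "p1 \<cdot> st = s" "p2 \<cdot> st = t" and I2: "id_str st s2 t2 r2" and Q: "is_pullback C s t w v"
  obtains T where "T \<in> Hom C (Dom C w) (Dom C s)" "s \<cdot> T = s \<cdot> v" "t \<cdot> T = t \<cdot> w"
    "\<And>X c. \<lbrakk>c \<in> Hom C X (Dom C w); w \<cdot> c = r \<cdot> t \<cdot> v \<cdot> c\<rbrakk>
      \<Longrightarrow> \<exists>\<theta> \<in> Hom C X (Dom C s2). s2 \<cdot> \<theta> = T \<cdot> c \<and> t2 \<cdot> \<theta> = v \<cdot> c"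
proof -
  note P = path_strD[OF id_str_path_str[OF I]] and [simp] = path_strD(2-10)[OF id_str_path_str[OF I]]
  note P2 = path_strD[OF id_str_path_str[OF I2]] and [simp] = path_strD(2-10)[OF id_str_path_str[OF I2]]
  note [simp] = pullbackD(2-4,6-8)[OF B] pullbackD(3,4,6-8)[OF Q] st(1,2)
  have [simp]: "Dom C st = Dom C s" using st by auto
  have w: "w \<in> fib" using fib_pullback[OF P(15) pullback_sym[OF Q]] .
  obtain k x where k: "is_pullback C w r k x" using fib_pullback_ex[OF w, of r] by auto
  note [simp] = pullbackD(3,4,6-8)[OF k]
  have sq: "s \<cdot> w = t \<cdot> v" using pullbackD(9)[OF Q] .
  note e = sq P(11-13) pullbackD(9)[OF k]
  note E = e e[THEN reassoc]
  have "q \<cdot> s \<cdot> v = q \<cdot> t \<cdot> w" by (simp add: E)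
  \<comment> \<open>The endpoints prescribed for the composite: the source of \<open>v\<close> and
    the target of \<open>w\<close>.\<close>
  then obtain m where m: "m \<in> Hom C (Dom C w) (Dom C p1)" "p1 \<cdot> m = s \<cdot> v" "p2 \<cdot> m = t \<cdot> w"
    using pullback_lift[OF B, of "s \<cdot> v" "Dom C w" "t \<cdot> w"] by auto
  note [simp] = m(1)[unfolded in_Hom]
  have "t \<cdot> v \<cdot> k = s \<cdot> w \<cdot> k" using reassoc[OF sq, of k] by simp
  also have "\<dots> = x" using pullbackD(9)[OF k] P(12)[THEN reassoc, of x] by simp
  finally have tvk: "t \<cdot> v \<cdot> k = x" .
  have "st \<cdot> v \<cdot> k = m \<cdot> k"
    using reassoc[OF st(3), of "v \<cdot> k"] reassoc[OF st(4), of "v \<cdot> k"] reassoc[OF m(2), of k] reassoc[OF m(3), of k]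
    by - (rule pullback_eq[OF B, of _ "Dom C k"]; simp add: E tvk)
  \<comment> \<open>Where \<open>w\<close> is reflexivity, \<open>v\<close> serves as the composite.
    Lifting against \<open>st\<close> keeps the endpoints strict, and \<open>h\<close> is the path
    that replaces the equation with \<open>v\<close>.\<close>
  then obtain T h where T: "T \<in> Hom C (Dom C w) (Dom C s)" "st \<cdot> T = m"
    and h: "h \<in> Hom C (Dom C k) (Dom C s2)" "s2 \<cdot> h = T \<cdot> k" "t2 \<cdot> h = v \<cdot> k"
    using id_str_elim[OF I w k I2, of m "v \<cdot> k"] by auto
  note [simp] = T(1)[unfolded in_Hom] h(1)[unfolded in_Hom]
  show thesis
  proof (rule that[OF T(1)])
    show "s \<cdot> T = s \<cdot> v" "t \<cdot> T = t \<cdot> w"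
      using reassoc[OF st(3), of T] reassoc[OF st(4), of T] T(2) m(2,3) by auto
    fix X c assume c: "c \<in> Hom C X (Dom C w)" "w \<cdot> c = r \<cdot> t \<cdot> v \<cdot> c"
    note [simp] = c(1)[unfolded in_Hom]
    obtain c' where c': "c' \<in> Hom C X (Dom C k)" "k \<cdot> c' = c"
      using pullback_lift[OF k, of c X "t \<cdot> v \<cdot> c"] c by auto
    then show "\<exists>\<theta> \<in> Hom C X (Dom C s2). s2 \<cdot> \<theta> = T \<cdot> c \<and> t2 \<cdot> \<theta> = v \<cdot> c"
      using h(2,3) reassoc[OF h(2), of c'] reassoc[OF h(3), of c'] by (intro bexI[of _ "h \<cdot> c'"]) auto
  qed
qed

text \<open>For paths \<open>h\<close> and \<open>u\<close> with the same source, a path \<open>g = w \<cdot> c\<close> whose composite with \<open>h\<close> is homotopic to \<open>u\<close>.\<close>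

lemma path_division:
  assumes I: "id_str q s t r" and B: "is_pullback C q q p1 p2" and st: "st \<in> Arr C" "Cod C st = Dom C p1"
    "p1 \<cdot> st = s" "p2 \<cdot> st = t" and I2: "id_str st s2 t2 r2" and Q: "is_pullback C s t w v"
    and T: "T \<in> Hom C (Dom C w) (Dom C s)" "s \<cdot> T = s \<cdot> v" "t \<cdot> T = t \<cdot> w"
    and transport: "\<And>X c. \<lbrakk>c \<in> Hom C X (Dom C w); w \<cdot> c = r \<cdot> t \<cdot> v \<cdot> c\<rbrakk>
      \<Longrightarrow> \<exists>\<theta> \<in> Hom C X (Dom C s2). s2 \<cdot> \<theta> = T \<cdot> c \<and> t2 \<cdot> \<theta> = v \<cdot> c"
    and Q2: "is_pullback C s s u h"
  obtains c \<theta> where "c \<in> Hom C (Dom C h) (Dom C w)" "v \<cdot> c = h" "t \<cdot> w \<cdot> c = t \<cdot> u"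
    "\<theta> \<in> Hom C (Dom C h) (Dom C s2)" "s2 \<cdot> \<theta> = T \<cdot> c" "t2 \<cdot> \<theta> = u"
proof -
  note P = path_strD[OF id_str_path_str[OF I]] and [simp] = path_strD(2-10)[OF id_str_path_str[OF I]]
  note P2 = path_strD[OF id_str_path_str[OF I2]] and [simp] = path_strD(2-10)[OF id_str_path_str[OF I2]]
  note [simp] = pullbackD(2-4,6-8)[OF B] pullbackD(3,4,6-8)[OF Q] pullbackD(3,4,6-8)[OF Q2] st(1,2) T(1)[unfolded in_Hom]
  have [simp]: "Dom C st = Dom C s" using st by auto
  have sq: "s \<cdot> w = t \<cdot> v" and sq2: "s \<cdot> u = s \<cdot> h" using pullbackD(9)[OF Q] pullbackD(9)[OF Q2] by auto
  have st_eq: "st \<cdot> a = st \<cdot> b" if "a \<in> Hom C X (Dom C s)" "b \<in> Hom C X (Dom C s)" "s \<cdot> a = s \<cdot> b" "t \<cdot> a = t \<cdot> b" for X a b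
    using that reassoc[OF st(3), of a] reassoc[OF st(4), of a] reassoc[OF st(3), of b] reassoc[OF st(4), of b]
    by - (rule pullback_eq[OF B, of _ X]; simp)
  note R = P(12,13)[THEN reassoc]
  obtain c1 where c1: "c1 \<in> Hom C (Dom C s) (Dom C w)" "w \<cdot> c1 = Ident C (Dom C s)" "v \<cdot> c1 = r \<cdot> s"
    using pullback_lift[OF Q, of "Ident C (Dom C s)" "Dom C s" "r \<cdot> s"] by (auto simp: R)
  note [simp] = c1(1)[unfolded in_Hom]
  note eT = T(2,3) c1(2,3)
  note ET = eT eT[THEN reassoc]
  \<comment> \<open>The left unit law: reflexivity followed by a path is homotopic to that path. By
    elimination on the path it suffices to have this at reflexivity, where the path supplied with
    \<open>T\<close> gives it.\<close>
  have unit: "\<exists>\<theta> \<in> Hom C (Dom C s) (Dom C s2). s2 \<cdot> \<theta> = T \<cdot> c1 \<and> t2 \<cdot> \<theta> = Ident C (Dom C s)"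
  proof -
    have e: "st \<cdot> T \<cdot> c1 = st \<cdot> Ident C (Dom C s)"
      by (rule st_eq[of _ "Dom C s"]) (simp_all add: ET R)
    obtain uL cL where L: "cL \<in> fib" "uL \<in> Hom C (Dom C cL) (Dom C s2)" "Cod C cL = Dom C s"
      "s2 \<cdot> uL = (T \<cdot> c1) \<cdot> cL" "t2 \<cdot> uL = Ident C (Dom C s) \<cdot> cL"
      and Lu: "\<And>X v h. \<lbrakk>v \<in> Hom C X (Dom C s); h \<in> Hom C X (Dom C s2); s2 \<cdot> h = (T \<cdot> c1) \<cdot> v; t2 \<cdot> h = Ident C (Dom C s) \<cdot> v\<rbrakk>
        \<Longrightarrow> \<exists>w \<in> Hom C X (Dom C cL). uL \<cdot> w = h \<and> cL \<cdot> w = v"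
    proof (rule path_str_fibration[OF id_str_path_str[OF I2] _ _ e, of "Dom C s"], goal_cases)
      case (3 u c) show ?case by (rule that(1)) (fact 3)+
    qed auto
    obtain \<theta> where "\<theta> \<in> Hom C (Dom C q) (Dom C s2)" "s2 \<cdot> \<theta> = T \<cdot> c1 \<cdot> r" "t2 \<cdot> \<theta> = v \<cdot> c1 \<cdot> r"
      using transport[of "c1 \<cdot> r" "Dom C q"] by (auto simp: ET R P)
    then obtain d where d: "d \<in> Hom C (Dom C q) (Dom C cL)" "cL \<cdot> d = r"
      using Lu[of r "Dom C q" \<theta>] by (auto simp: ET R P)
    obtain j where j: "j \<in> Hom C (Dom C s) (Dom C cL)" "cL \<cdot> j = Ident C (Dom C s)"
      using liftsD[OF refl_lifts[OF I] L(1), of "Ident C (Dom C s)" d] d L(3) by auto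
    show ?thesis
      using L j fib_Arr[OF L(1)] reassoc[OF L(4), of j] reassoc[OF L(5), of j] by (intro bexI[of _ "uL \<cdot> j"]) auto
  qed
  have hf: "h \<in> fib" using fib_pullback[OF P(14) Q2] .
  \<comment> \<open>\<open>b3\<close> is the fibration of candidates for the quotient: paths from
    the target of \<open>h\<close> to the target of \<open>u\<close>.\<close>
  obtain g3 b3 where L3: "b3 \<in> fib" "g3 \<in> Hom C (Dom C b3) (Dom C s)" "Cod C b3 = Dom C h"
      "s \<cdot> g3 = (t \<cdot> h) \<cdot> b3" "t \<cdot> g3 = (t \<cdot> u) \<cdot> b3"
    and Lu3: "\<And>X v' h'. \<lbrakk>v' \<in> Hom C X (Dom C h); h' \<in> Hom C X (Dom C s); s \<cdot> h' = (t \<cdot> h) \<cdot> v'; t \<cdot> h' = (t \<cdot> u) \<cdot> v'\<rbrakk>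
        \<Longrightarrow> \<exists>w \<in> Hom C X (Dom C b3). g3 \<cdot> w = h' \<and> b3 \<cdot> w = v'"
  proof (rule path_str_fibration[OF id_str_path_str[OF I], of "t \<cdot> h" "Dom C h" "t \<cdot> u"], goal_cases)
    case 3 show ?case using reassoc[OF P(11), of h] reassoc[OF P(11), of u] sq2 by simp
  next
    case (4 u c) show ?case by (rule that(1)) (fact 4)+
  qed auto
  note [simp] = fib_Arr[OF L3(1)] L3(2)[unfolded in_Hom] L3(3)
  obtain c3 where c3: "c3 \<in> Hom C (Dom C b3) (Dom C w)" "w \<cdot> c3 = g3" "v \<cdot> c3 = h \<cdot> b3"
    using pullback_lift[OF Q, of g3 "Dom C b3" "h \<cdot> b3"] L3(4) by auto
  note [simp] = c3(1)[unfolded in_Hom]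
  have e4: "st \<cdot> T \<cdot> c3 = st \<cdot> u \<cdot> b3"
    using reassoc[OF T(2), of c3] reassoc[OF T(3), of c3] c3 L3(5) reassoc[OF sq2, of b3]
    by - (rule st_eq[of _ "Dom C b3"]; simp)
  \<comment> \<open>\<open>b4\<close> adds a path from the composite of \<open>h\<close> and the
    candidate to \<open>u\<close>. A section of \<open>b3 \<cdot> b4\<close> is wanted; elimination
    on \<open>h\<close> reduces this to reflexivity, where the candidate \<open>u\<close> and the
    unit law serve.\<close>
  obtain g4 b4 where L4: "b4 \<in> fib" "g4 \<in> Hom C (Dom C b4) (Dom C s2)" "Cod C b4 = Dom C b3"
      "s2 \<cdot> g4 = (T \<cdot> c3) \<cdot> b4" "t2 \<cdot> g4 = (u \<cdot> b3) \<cdot> b4"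
    and Lu4: "\<And>X v' h'. \<lbrakk>v' \<in> Hom C X (Dom C b3); h' \<in> Hom C X (Dom C s2); s2 \<cdot> h' = (T \<cdot> c3) \<cdot> v'; t2 \<cdot> h' = (u \<cdot> b3) \<cdot> v'\<rbrakk>
        \<Longrightarrow> \<exists>w \<in> Hom C X (Dom C b4). g4 \<cdot> w = h' \<and> b4 \<cdot> w = v'"
  proof (rule path_str_fibration[OF id_str_path_str[OF I2] _ _ e4, of "Dom C b3"], goal_cases)
    case (3 u c) show ?case by (rule that(1)) (fact 3)+
  qed auto
  note [simp] = fib_Arr[OF L4(1)] L4(2)[unfolded in_Hom] L4(3)
  obtain k x where k: "is_pullback C h r k x" using fib_pullback_ex[OF hf, of r] by auto
  note [simp] = pullbackD(3,4,6-8)[OF k]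
  have hk: "h \<cdot> k = r \<cdot> x" using pullbackD(9)[OF k] .
  have suk: "s \<cdot> u \<cdot> k = x" using reassoc[OF sq2, of k] hk R(1)[of x] by simp
  obtain l3 where l3: "l3 \<in> Hom C (Dom C k) (Dom C b3)" "g3 \<cdot> l3 = u \<cdot> k" "b3 \<cdot> l3 = k"
  proof -
    have "k \<in> Hom C (Dom C k) (Dom C h)" "u \<cdot> k \<in> Hom C (Dom C k) (Dom C s)" by auto
    moreover have "s \<cdot> u \<cdot> k = (t \<cdot> h) \<cdot> k" "t \<cdot> u \<cdot> k = (t \<cdot> u) \<cdot> k" using suk hk R(2)[of x] by auto
    ultimately show thesis using Lu3 that by blast
  qed
  note [simp] = l3(1)[unfolded in_Hom]
  have "c3 \<cdot> l3 = c1 \<cdot> u \<cdot> k"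
    using reassoc[OF c3(2), of l3] reassoc[OF c3(3), of l3] reassoc[OF c1(2), of "u \<cdot> k"] reassoc[OF c1(3), of "u \<cdot> k"] l3(2,3) hk suk
    by - (rule pullback_eq[OF Q, of _ "Dom C k"]; simp)
  moreover obtain \<theta>0 where \<theta>0: "\<theta>0 \<in> Hom C (Dom C s) (Dom C s2)" "s2 \<cdot> \<theta>0 = T \<cdot> c1" "t2 \<cdot> \<theta>0 = Ident C (Dom C s)"
    using unit by blast
  ultimately obtain d where d: "d \<in> Hom C (Dom C k) (Dom C b4)" "b4 \<cdot> d = l3"
  proof -
    assume e: "c3 \<cdot> l3 = c1 \<cdot> u \<cdot> k"
    note [simp] = \<theta>0(1)[unfolded in_Hom]
    have "l3 \<in> Hom C (Dom C k) (Dom C b3)" "\<theta>0 \<cdot> u \<cdot> k \<in> Hom C (Dom C k) (Dom C s2)" by auto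
    moreover have "s2 \<cdot> \<theta>0 \<cdot> u \<cdot> k = (T \<cdot> c3) \<cdot> l3" "t2 \<cdot> \<theta>0 \<cdot> u \<cdot> k = (u \<cdot> b3) \<cdot> l3"
      using reassoc[OF \<theta>0(2), of "u \<cdot> k"] reassoc[OF \<theta>0(3), of "u \<cdot> k"] l3(3) e by auto
    ultimately show thesis using Lu4 that by blast
  qed
  have "b3 \<cdot> b4 \<in> fib" using fib_comp[OF L3(1) L4(1)] by simp
  then obtain J where J: "J \<in> Hom C (Dom C h) (Dom C b4)" "b3 \<cdot> b4 \<cdot> J = Ident C (Dom C h)"
    using liftsD[OF refl_pullback_lifts[OF I hf k], of "b3 \<cdot> b4" "Ident C (Dom C h)" d] d l3(3) by auto
  note [simp] = J(1)[unfolded in_Hom]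
  show thesis
  proof (rule that[of "c3 \<cdot> b4 \<cdot> J" "g4 \<cdot> J"])
    show "v \<cdot> c3 \<cdot> b4 \<cdot> J = h" using reassoc[OF c3(3), of "b4 \<cdot> J"] J(2) by simp
    show "t \<cdot> w \<cdot> c3 \<cdot> b4 \<cdot> J = t \<cdot> u" using reassoc[OF c3(2), of "b4 \<cdot> J"] reassoc[OF L3(5), of "b4 \<cdot> J"] J(2) by simp
    show "s2 \<cdot> g4 \<cdot> J = T \<cdot> c3 \<cdot> b4 \<cdot> J" "t2 \<cdot> g4 \<cdot> J = u"
      using reassoc[OF L4(4), of J] reassoc[OF L4(5), of J] J(2) by auto
  qed auto
qed

text \<open>
  The unbased rule moves an element over \<open>v\<close> along \<open>w\<close> to one over the composite of \<open>v\<close> and \<open>w\<close>, with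
  \<open>v\<close> part of the contextual parameter.  Apply this to \<open>v = h0\<close> and to the \<open>w\<close> whose composite with \<open>h0\<close> is
  homotopic to the given \<open>u\<close>.
\<close>

lemma id_str_based_elim_section:
  assumes I: "id_str q s t r" and h0: "h0 \<in> Hom C (Cod C q) (Dom C s)" "q \<cdot> s \<cdot> h0 = Ident C (Cod C q)"
    and V: "is_pullback C s (s \<cdot> h0) u \<pi>" and \<sigma>: "\<sigma> \<in> Hom C (Cod C q) (Dom C u)" "u \<cdot> \<sigma> = h0" "\<pi> \<cdot> \<sigma> = Ident C (Cod C q)"
  shows "lifts \<sigma>"
proof (rule liftsI)
  note P = path_strD[OF id_str_path_str[OF I]] and [simp] = path_strD(2-10)[OF id_str_path_str[OF I]]
  note [simp] = h0(1)[unfolded in_Hom] \<sigma>(1)[unfolded in_Hom]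
  note [simp] = pullbackD(3,4,6,8)[OF V]
  have [simp]: "Cod C \<pi> = Cod C q" using pullbackD(7)[OF V] by simp
  show "\<sigma> \<in> Arr C" by simp
  obtain p1 p2 st s2 t2 r2 where B: "is_pullback C q q p1 p2" and st: "st \<in> Arr C" "Cod C st = Dom C p1"
    "p1 \<cdot> st = s" "p2 \<cdot> st = t" and I2: "id_str st s2 t2 r2" using id_str_st[OF I] .
  note P2 = path_strD[OF id_str_path_str[OF I2]] and [simp] = path_strD(2-10)[OF id_str_path_str[OF I2]]
  note [simp] = pullbackD(2-4,6-8)[OF B] st(1,2)
  have [simp]: "Dom C st = Dom C s" using st by auto
  obtain w v where Q: "is_pullback C s t w v" using fib_pullback_ex[OF P(14), of t] by auto
  obtain T where T: "T \<in> Hom C (Dom C w) (Dom C s)" "s \<cdot> T = s \<cdot> v" "t \<cdot> T = t \<cdot> w"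
    and Tr': "\<And>X c. \<lbrakk>c \<in> Hom C X (Dom C w); w \<cdot> c = r \<cdot> t \<cdot> v \<cdot> c\<rbrakk>
      \<Longrightarrow> \<exists>\<theta> \<in> Hom C X (Dom C s2). s2 \<cdot> \<theta> = T \<cdot> c \<and> t2 \<cdot> \<theta> = v \<cdot> c"
    using path_composition[OF I B st I2 Q] by blast
  obtain u2 h2 where Q2: "is_pullback C s s u2 h2" using fib_pullback_ex[OF P(14), of s] by auto
  obtain c2 \<Theta> where c2: "c2 \<in> Hom C (Dom C h2) (Dom C w)" "v \<cdot> c2 = h2" "t \<cdot> w \<cdot> c2 = t \<cdot> u2"
    "\<Theta> \<in> Hom C (Dom C h2) (Dom C s2)" "s2 \<cdot> \<Theta> = T \<cdot> c2" "t2 \<cdot> \<Theta> = u2"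
    using path_division[OF I B st I2 Q T Tr' Q2] by blast
  note [simp] = pullbackD(3,4,6-8)[OF Q] pullbackD(3,4,6-8)[OF Q2] T(1)[unfolded in_Hom] c2(1,4)[unfolded in_Hom]
  have su: "s \<cdot> u = s \<cdot> h0 \<cdot> \<pi>" using pullbackD(9)[OF V] by simp
  have qsh: "q \<cdot> s \<cdot> h0 \<cdot> x = x" if "x \<in> Arr C" "Cod C x = Cod C q" for x
    using that reassoc[of "q" "s \<cdot> h0", OF h0(2), of x] by simp
  have \<pi>: "q \<cdot> s \<cdot> u = \<pi>" "q \<cdot> t \<cdot> u = \<pi>" using su qsh[of \<pi>] reassoc[OF P(11), of u] by auto
  fix z m d assume z: "z \<in> fib" and m: "m \<in> Hom C (Cod C \<sigma>) (Cod C z)" and d: "d \<in> Hom C (Dom C \<sigma>) (Dom C z)"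
    and zd: "z \<cdot> d = m \<cdot> \<sigma>"
  note [simp] = fib_Arr[OF z] m[unfolded in_Hom] d[unfolded in_Hom]
  obtain \<zeta> b where Zm: "is_pullback C z m \<zeta> b" "b \<in> fib" using fib_pullbackE[OF z, of m] by auto
  note [simp] = pullbackD(3,4,6-8)[OF Zm(1)]
  have [simp]: "Cod C b = Dom C u" using pullbackD(7)[OF Zm(1)] m by auto
  have "q \<cdot> (s \<cdot> h0 \<cdot> q) = q \<cdot> Ident C (Dom C q)" using qsh[of q] by simp
  then obtain n where n: "n \<in> Hom C (Dom C q) (Dom C p1)" "p1 \<cdot> n = s \<cdot> h0 \<cdot> q" "p2 \<cdot> n = Ident C (Dom C q)"
    using pullback_lift[OF B, of "s \<cdot> h0 \<cdot> q" "Dom C q" "Ident C (Dom C q)"] by auto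
  note [simp] = n(1)[unfolded in_Hom]
  \<comment> \<open>The paths starting at the chosen points form the pullback of \<open>st\<close>
    along \<open>n = (s h0 q, 1)\<close>. Hence their target map is a fibration, and a path between
    two of them transports predicates on \<open>Dom C u\<close>.\<close>
  have V2: "is_pullback C st n u (t \<cdot> u)"
  proof (rule pullbackI[where V = "Dom C u"])
    show "st \<cdot> u = n \<cdot> t \<cdot> u"
      using reassoc[OF st(3), of u] reassoc[OF st(4), of u] reassoc[OF n(2), of "t \<cdot> u"] reassoc[OF n(3), of "t \<cdot> u"] su \<pi>
      by - (rule pullback_eq[OF B, of _ "Dom C u"]; simp)
    fix S
    {
      fix a b assume a: "a \<in> Hom C S (Dom C st)" and b: "b \<in> Hom C S (Dom C n)" and e: "st \<cdot> a = n \<cdot> b"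
      note [simp] = a[unfolded in_Hom] b[unfolded in_Hom]
      have e1: "s \<cdot> a = s \<cdot> h0 \<cdot> q \<cdot> b" using arg_cong[OF e, of "comp p1"] reassoc[OF st(3), of a] reassoc[OF n(2), of b] by simp
      have e2: "t \<cdot> a = b" using arg_cong[OF e, of "comp p2"] reassoc[OF st(4), of a] reassoc[OF n(3), of b] by simp
      obtain y where "y \<in> Hom C S (Dom C u)" "u \<cdot> y = a" "\<pi> \<cdot> y = q \<cdot> b"
        using pullback_lift[OF V, of a S "q \<cdot> b"] e1 by auto
      then show "\<exists>y\<in>Hom C S (Dom C u). u \<cdot> y = a \<and> (t \<cdot> u) \<cdot> y = b" using e2 by (intro bexI[of _ y]) auto
    }
    fix y y' assume y: "y \<in> Hom C S (Dom C u)" "y' \<in> Hom C S (Dom C u)" "u \<cdot> y = u \<cdot> y'"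
    show "y = y'"
      using y reassoc[OF \<pi>(1), of y] reassoc[OF \<pi>(1), of y'] by - (rule pullback_eq[OF V, of _ S]; simp)
  qed auto
  have tu: "t \<cdot> u \<in> fib"
    using fib_pullback[OF display_fib[OF id_str_display[OF I2]] V2] .
  have e1f: "(t \<cdot> u) \<cdot> b \<in> fib" using fib_comp[OF tu Zm(2)] by simp
  \<comment> \<open>Triples of a path in \<open>Dom C u\<close>, an element of \<open>z\<close> over
    it, and a further path \<open>wy\<close> from its target. The path \<open>wy\<close> is the one
    eliminated; the other two components are the contextual parameter.\<close>
  obtain c wy where Y: "is_pullback C ((t \<cdot> u) \<cdot> b) s c wy" "wy \<in> fib" using fib_pullbackE[OF e1f, of s] by auto
  note [simp] = pullbackD(3,4,7,8)[OF Y(1)]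
  have [simp]: "Cod C c = Dom C b" using pullbackD(6)[OF Y(1)] by simp
  have Ye: "s \<cdot> wy = t \<cdot> u \<cdot> b \<cdot> c" using pullbackD(9)[OF Y(1)] by simp
  obtain \<kappa> where \<kappa>: "\<kappa> \<in> Hom C (Dom C c) (Dom C w)" "w \<cdot> \<kappa> = wy" "v \<cdot> \<kappa> = u \<cdot> b \<cdot> c"
    using pullback_lift[OF Q, of wy "Dom C c" "u \<cdot> b \<cdot> c"] Ye by auto
  note [simp] = \<kappa>(1)[unfolded in_Hom]
  have "s \<cdot> T \<cdot> \<kappa> = (s \<cdot> h0) \<cdot> \<pi> \<cdot> b \<cdot> c"
    using reassoc[OF T(2), of \<kappa>] \<kappa>(3) reassoc[OF su, of "b \<cdot> c"] by simp
  \<comment> \<open>\<open>\<tau>\<close> is the composite, again seen as a path with the chosen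
    starting point.\<close>
  then obtain \<tau> where \<tau>: "\<tau> \<in> Hom C (Dom C c) (Dom C u)" "u \<cdot> \<tau> = T \<cdot> \<kappa>" "\<pi> \<cdot> \<tau> = \<pi> \<cdot> b \<cdot> c"
    using pullback_lift[OF V, of "T \<cdot> \<kappa>" "Dom C c" "\<pi> \<cdot> b \<cdot> c"] by auto
  note [simp] = \<tau>(1)[unfolded in_Hom]
  obtain k x where k: "is_pullback C wy r k x" using fib_pullback_ex[OF Y(2), of r] by auto
  note [simp] = pullbackD(3,4,6-8)[OF k]
  have wyk: "wy \<cdot> k = r \<cdot> x" using pullbackD(9)[OF k] .
  have x: "t \<cdot> u \<cdot> b \<cdot> c \<cdot> k = x"
    using Ye[THEN reassoc, of k] wyk reassoc[OF P(12), of x] by simp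
  have vk: "v \<cdot> \<kappa> \<cdot> k = u \<cdot> b \<cdot> c \<cdot> k" and wk: "w \<cdot> \<kappa> \<cdot> k = r \<cdot> x"
    using reassoc[OF \<kappa>(3), of k] reassoc[OF \<kappa>(2), of k] wyk by auto
  obtain \<theta> where \<theta>: "\<theta> \<in> Hom C (Dom C k) (Dom C s2)" "s2 \<cdot> \<theta> = T \<cdot> \<kappa> \<cdot> k" "t2 \<cdot> \<theta> = u \<cdot> b \<cdot> c \<cdot> k"
    using Tr'[of "\<kappa> \<cdot> k" "Dom C k"] by (auto simp: vk wk x)
  have u\<tau>: "u \<cdot> \<tau> \<cdot> y = T \<cdot> \<kappa> \<cdot> y" if "y \<in> Arr C" "Cod C y = Dom C c" for y
    using reassoc[OF \<tau>(2), of y] that by simp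
  \<comment> \<open>Where \<open>wy\<close> is reflexivity the composite is homotopic to the first
    path, so the element is transported backwards along \<open>\<theta>\<close>.\<close>
  have "\<exists>d1\<in>Hom C (Dom C k) (Dom C z). z \<cdot> d1 = m \<cdot> \<tau> \<cdot> k"
  proof (rule transport[OF I2 _ V2, where \<alpha> = t2 and \<beta> = s2 and ?v0.0 = "b \<cdot> c \<cdot> k" and h = \<theta> and d = "\<zeta> \<cdot> c \<cdot> k"])
    show "(t \<cdot> u) \<cdot> b \<cdot> c \<cdot> k = (t \<cdot> u) \<cdot> \<tau> \<cdot> k"
      using u\<tau>[of k] reassoc[OF T(3), of "\<kappa> \<cdot> k"] wk x reassoc[OF P(13), of x] by simp
    show "z \<cdot> \<zeta> \<cdot> c \<cdot> k = m \<cdot> b \<cdot> c \<cdot> k" using reassoc[OF pullbackD(9)[OF Zm(1)], of "c \<cdot> k"] by simp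
  qed (use \<theta> z u\<tau>[of k] in auto)
  then obtain d1 where "d1 \<in> Hom C (Dom C k) (Dom C z)" "z \<cdot> d1 = m \<cdot> \<tau> \<cdot> k" by blast
  then obtain j where j: "j \<in> Hom C (Dom C c) (Dom C z)" "z \<cdot> j = m \<cdot> \<tau>"
    using liftsD[OF refl_pullback_lifts[OF I Y(2) k] z, of "m \<cdot> \<tau>" d1] by auto
  note [simp] = j(1)[unfolded in_Hom]
  obtain l where l: "l \<in> Hom C (Dom C u) (Dom C h2)" "u2 \<cdot> l = u" "h2 \<cdot> l = h0 \<cdot> \<pi>"
    using pullback_lift[OF Q2, of u "Dom C u" "h0 \<cdot> \<pi>"] su by auto
  note [simp] = l(1)[unfolded in_Hom]
  have cl: "v \<cdot> c2 \<cdot> l = h0 \<cdot> \<pi>" "t \<cdot> w \<cdot> c2 \<cdot> l = t \<cdot> u"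
    using reassoc[OF c2(2), of l] arg_cong[OF c2(3), of "\<lambda>y. y \<cdot> l"] l(2,3) by auto
  \<comment> \<open>The instance wanted: the first path is \<open>h0\<close> with the given element
    \<open>d\<close>, the second is the quotient of the variable path \<open>u\<close> by
    \<open>h0\<close>.\<close>
  obtain z0 where z0: "z0 \<in> Hom C (Dom C u) (Dom C b)" "\<zeta> \<cdot> z0 = d \<cdot> \<pi>" "b \<cdot> z0 = \<sigma> \<cdot> \<pi>"
    using pullback_lift[OF Zm(1), of "d \<cdot> \<pi>" "Dom C u" "\<sigma> \<cdot> \<pi>"] reassoc[OF zd, of \<pi>] by auto
  note [simp] = z0(1)[unfolded in_Hom]
  have ubz: "u \<cdot> b \<cdot> z0 = h0 \<cdot> \<pi>" using z0(3) reassoc[OF \<sigma>(2), of \<pi>] by simp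
  have "((t \<cdot> u) \<cdot> b) \<cdot> z0 = s \<cdot> w \<cdot> c2 \<cdot> l"
    using ubz reassoc[OF pullbackD(9)[OF Q], of "c2 \<cdot> l"] cl by simp
  then obtain y0 where y0: "y0 \<in> Hom C (Dom C u) (Dom C c)" "c \<cdot> y0 = z0" "wy \<cdot> y0 = w \<cdot> c2 \<cdot> l"
    using pullback_lift[OF Y(1), of z0 "Dom C u" "w \<cdot> c2 \<cdot> l"] by auto
  note [simp] = y0(1)[unfolded in_Hom]
  have \<kappa>y: "\<kappa> \<cdot> y0 = c2 \<cdot> l"
    using reassoc[OF \<kappa>(2), of y0] reassoc[OF \<kappa>(3), of y0] y0(2,3) ubz cl
    by - (rule pullback_eq[OF Q, of _ "Dom C u"]; simp)
  \<comment> \<open>The composite of \<open>h0\<close> with the quotient is only homotopic to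
    \<open>u\<close>; a last transport along \<open>\<Theta>\<close> repairs this.\<close>
  have "\<exists>d1\<in>Hom C (Dom C u) (Dom C z). z \<cdot> d1 = m \<cdot> Ident C (Dom C u)"
  proof (rule transport[OF I2 _ V2, where \<alpha> = s2 and \<beta> = t2 and ?v0.0 = "\<tau> \<cdot> y0" and h = "\<Theta> \<cdot> l" and d = "j \<cdot> y0"])
    show "(t \<cdot> u) \<cdot> \<tau> \<cdot> y0 = (t \<cdot> u) \<cdot> Ident C (Dom C u)"
      using u\<tau>[of y0] \<kappa>y reassoc[OF T(3), of "c2 \<cdot> l"] cl by simp
    show "s2 \<cdot> \<Theta> \<cdot> l = u \<cdot> \<tau> \<cdot> y0" using u\<tau>[of y0] \<kappa>y reassoc[OF c2(5), of l] by simp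
    show "t2 \<cdot> \<Theta> \<cdot> l = u \<cdot> Ident C (Dom C u)" using reassoc[OF c2(6), of l] l by simp
    show "z \<cdot> j \<cdot> y0 = m \<cdot> \<tau> \<cdot> y0" using reassoc[OF j(2), of y0] by simp
  qed (use z in auto)
  then show "\<exists>j\<in>Hom C (Cod C \<sigma>) (Dom C z). z \<cdot> j = m" by auto
qed

text \<open>After a change of base along \<open>q \<cdot> s \<cdot> h\<close> the domain of
  \<open>h\<close> is the base and \<open>h\<close> becomes a section \<open>h'\<close>, which is
  the case already treated. The object of paths starting at the source of \<open>h\<close> does not
  change: the same \<open>\<pi>\<close> and \<open>\<sigma>\<close> serve.\<close>

lemma id_str_based_elim:
  assumes I: "id_str q s t r"
  shows "based_elim s"
  unfolding based_elim_def
proof (intro allI impI, elim conjE)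
  fix h u \<pi> \<sigma>
  assume h: "h \<in> Arr C" "Cod C h = Dom C s" and V: "is_pullback C s (s \<cdot> h) u \<pi>"
    and \<sigma>: "\<sigma> \<in> Hom C (Dom C h) (Dom C u)" "u \<cdot> \<sigma> = h" "\<pi> \<cdot> \<sigma> = Ident C (Dom C h)"
  note P = path_strD[OF id_str_path_str[OF I]] and [simp] = path_strD(2-10)[OF id_str_path_str[OF I]] h
  note [simp] = \<sigma>(1)[unfolded in_Hom] pullbackD(3,4,6,8)[OF V]
  have [simp]: "Cod C \<pi> = Dom C h" using pullbackD(7)[OF V] by simp
  define g where "g = q \<cdot> s \<cdot> h"
  have [simp]: "g \<in> Arr C" "Dom C g = Dom C h" "Cod C g = Cod C q" by (auto simp: g_def)
  obtain q' s' t' r' e' p where I': "id_str q' s' t' r'" and Q: "is_pullback C q g e' q'"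
    and P': "is_pullback C (q \<cdot> s) g p (q' \<cdot> s')" and c: "s \<cdot> p = e' \<cdot> s'"
    using id_str_stable[OF I \<open>g \<in> Arr C\<close> \<open>Cod C g = Cod C q\<close>] by metis
  note P2 = path_strD[OF id_str_path_str[OF I']] and [simp] = path_strD(2-10)[OF id_str_path_str[OF I']]
  note [simp] = pullbackD(3,4,6,7)[OF Q] pullbackD(3,6)[OF P']
  have [simp]: "Dom C s' = Dom C p" "Dom C e' = Dom C q'" using pullbackD(8)[OF P'] pullbackD(8)[OF Q] by auto
  have su: "s \<cdot> u = s \<cdot> h \<cdot> \<pi>" using pullbackD(9)[OF V] by simp
  obtain h' where h': "h' \<in> Hom C (Dom C h) (Dom C p)" "p \<cdot> h' = h" "q' \<cdot> s' \<cdot> h' = Ident C (Dom C h)"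
    using pullback_lift[OF P', of h "Dom C h" "Ident C (Dom C h)"] by (auto simp: g_def)
  note [simp] = h'(1)[unfolded in_Hom]
  have "(q \<cdot> s) \<cdot> u = g \<cdot> \<pi>" using su by (simp add: g_def)
  then obtain u' where u': "u' \<in> Hom C (Dom C u) (Dom C p)" "p \<cdot> u' = u" "q' \<cdot> s' \<cdot> u' = \<pi>"
    using pullback_lift[OF P', of u "Dom C u" \<pi>] by auto
  note [simp] = u'(1)[unfolded in_Hom]
  have qsh: "q' \<cdot> s' \<cdot> h' \<cdot> x = x" if "x \<in> Arr C" "Cod C x = Dom C h" for x
    using that reassoc[of "q'" "s' \<cdot> h'", OF h'(3), of x] by simp
  have qsu: "q' \<cdot> s' \<cdot> u' \<cdot> x = \<pi> \<cdot> x" if "x \<in> Arr C" "Cod C x = Dom C u" for x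
    using that reassoc[of "q'" "s' \<cdot> u'", OF u'(3), of x] by simp
  have ph: "e' \<cdot> s' \<cdot> h' = s \<cdot> h" "e' \<cdot> s' \<cdot> u' = s \<cdot> u"
    using reassoc[OF c, of h'] reassoc[OF c, of u'] h'(2) u'(2) by auto
  have V': "is_pullback C s' (s' \<cdot> h') u' \<pi>"
  proof (rule pullbackI[where V = "Dom C u"])
    show "s' \<cdot> u' = (s' \<cdot> h') \<cdot> \<pi>"
      using ph(1)[THEN arg_cong, of "\<lambda>y. y \<cdot> \<pi>"] ph(2) su u'(3) qsh[of \<pi>]
      by - (rule pullback_eq[OF Q, of _ "Dom C u"]; simp)
    fix S
    {
      fix a b assume a: "a \<in> Hom C S (Dom C s')" and b: "b \<in> Hom C S (Dom C (s' \<cdot> h'))" and e: "s' \<cdot> a = (s' \<cdot> h') \<cdot> b"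
      note [simp] = a[unfolded in_Hom] b[unfolded in_Hom]
      have [simp]: "Cod C b = Dom C h" using b by simp
      have "s \<cdot> p \<cdot> a = (s \<cdot> h) \<cdot> b"
        using reassoc[OF c, of a] e ph(1)[THEN arg_cong, of "\<lambda>y. y \<cdot> b"] by simp
      then obtain y where y: "y \<in> Hom C S (Dom C u)" "u \<cdot> y = p \<cdot> a" "\<pi> \<cdot> y = b"
        using pullback_lift[OF V, of "p \<cdot> a" S b] by auto
      have "u' \<cdot> y = a"
        using y reassoc[OF u'(2), of y] qsu[of y] e qsh[of b] by - (rule pullback_eq[OF P', of _ S]; simp)
      then show "\<exists>y\<in>Hom C S (Dom C u). u' \<cdot> y = a \<and> \<pi> \<cdot> y = b" using y by auto
    }
    fix y y' assume y: "y \<in> Hom C S (Dom C u)" "y' \<in> Hom C S (Dom C u)" "u' \<cdot> y = u' \<cdot> y'" "\<pi> \<cdot> y = \<pi> \<cdot> y'"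
    then show "y = y'"
      using reassoc[OF u'(2), of y] reassoc[OF u'(2), of y'] by - (rule pullback_eq[OF V, of _ S]; simp)
  qed auto
  have "u' \<cdot> \<sigma> = h'"
    using reassoc[OF u'(2), of \<sigma>] h'(2,3) \<sigma>(2,3) qsu[of \<sigma>] by - (rule pullback_eq[OF P', of _ "Dom C h"]; simp)
  then show "lifts \<sigma>"
    using h' \<sigma> by (intro id_str_based_elim_section[OF I' _ _ V']) auto
qed

section \<open>Path objects for all fibrations\<close>

text \<open>Elimination together with its computation path, for a target \<open>f\<close> that may
  be a composite: the lower triangle is strict, and \<open>h\<close> is the path in the upper one.
  For displays this is \<open>id_str_elim\<close>.\<close>

definition weak_elim :: "'a \<Rightarrow> 'a \<Rightarrow> 'a \<Rightarrow> bool" where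
  "weak_elim f s t \<longleftrightarrow> (\<forall>q s0 t0 r0 y k x m d. id_str q s0 t0 r0 \<longrightarrow> y \<in> fib \<longrightarrow> is_pullback C y r0 k x \<longrightarrow>
     m \<in> Hom C (Dom C y) (Cod C f) \<longrightarrow> d \<in> Hom C (Dom C k) (Dom C f) \<longrightarrow> f \<cdot> d = m \<cdot> k \<longrightarrow>
     (\<exists>j \<in> Hom C (Dom C y) (Dom C f). f \<cdot> j = m \<and> (\<exists>h \<in> Hom C (Dom C k) (Dom C s). s \<cdot> h = j \<cdot> k \<and> t \<cdot> h = d)))"

text \<open>The induction hypothesis for towers. From \<open>weak_elim\<close> comes the transport
  map out of which composite paths are formed; \<open>based_elim\<close> allows paths with arbitrary
  starting points to be moved.\<close>

definition path_fibration :: "'a \<Rightarrow> bool" where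
  "path_fibration f \<longleftrightarrow> (\<exists>s t r. path_str f s t r \<and> based_elim s \<and> weak_elim f s t)"

lemma weak_elimD:
  assumes "weak_elim f s t" "id_str q s0 t0 r0" "y \<in> fib" "is_pullback C y r0 k x"
    "m \<in> Hom C (Dom C y) (Cod C f)" "d \<in> Hom C (Dom C k) (Dom C f)" "f \<cdot> d = m \<cdot> k"
  obtains j h where "j \<in> Hom C (Dom C y) (Dom C f)" "f \<cdot> j = m" "h \<in> Hom C (Dom C k) (Dom C s)"
    "s \<cdot> h = j \<cdot> k" "t \<cdot> h = d"
  using assms unfolding weak_elim_def by metis

lemma based_elimD:
  assumes "based_elim s" "s \<in> fib" "h \<in> Hom C X (Dom C s)"
  obtains u \<pi> \<sigma> where "is_pullback C s (s \<cdot> h) u \<pi>" "\<sigma> \<in> Hom C X (Dom C u)" "u \<cdot> \<sigma> = h" "\<pi> \<cdot> \<sigma> = Ident C X" "lifts \<sigma>"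
proof -
  note [simp] = fib_Arr[OF assms(2)] assms(3)[unfolded in_Hom]
  have [simp]: "X \<in> Obj C" using assms(3) Dom_Cod_Obj(1)[of h] by simp
  obtain u \<pi> where V: "is_pullback C s (s \<cdot> h) u \<pi>" using fib_pullback_ex[OF assms(2), of "s \<cdot> h"] by auto
  obtain \<sigma> where \<sigma>: "\<sigma> \<in> Hom C X (Dom C u)" "u \<cdot> \<sigma> = h" "\<pi> \<cdot> \<sigma> = Ident C X"
    using pullback_lift[OF V, of h X "Ident C X"] by auto
  have "lifts \<sigma>" using assms(1)[unfolded based_elim_def, rule_format, of h u \<pi> \<sigma>] \<sigma> V by simp
  then show thesis by (rule that[OF V \<sigma>])
qed

text \<open>The fibres are trivial, so the identity serves as source, target and reflexivity; every
  section \<open>\<sigma>\<close> occurring in \<open>based_elim\<close> is then an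
  isomorphism.\<close>

lemma path_fibration_iso:
  assumes "is_iso C f" shows "path_fibration f"
proof -
  obtain g where [simp]: "f \<in> Arr C" "g \<in> Arr C" "Dom C g = Cod C f" "Cod C g = Dom C f"
    and g: "g \<cdot> f = Ident C (Dom C f)" "f \<cdot> g = Ident C (Cod C f)" using assms by (meson isoE)
  let ?I = "Ident C (Dom C f)"
  have gf: "a = g \<cdot> f \<cdot> a" if "a \<in> Arr C" "Cod C a = Dom C f" for a
    using reassoc[OF g(1), of a] that by simp
  have 1: "?I \<in> fib" by (simp add: fib.iso iso_ident)
  have pb: "is_pullback C f f ?I ?I"
  proof (rule pullbackI[where V = "Dom C f"])
    fix S u v assume u: "u \<in> Hom C S (Dom C f)" and v: "v \<in> Hom C S (Dom C f)" and e: "f \<cdot> u = f \<cdot> v"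
    have "u = v" using gf[of u] gf[of v] u v e by simp
    then show "\<exists>w\<in>Hom C S (Dom C f). ?I \<cdot> w = u \<and> ?I \<cdot> w = v" using v by (intro bexI[of _ v]) auto
  qed auto
  have "path_str f ?I ?I ?I"
    unfolding path_str_def using pb 1 fib.iso[OF assms] by (intro conjI exI[of _ "?I"]) auto
  moreover have "based_elim ?I"
    unfolding based_elim_def
  proof (intro allI impI, elim conjE)
    fix h u \<pi> \<sigma>
    assume h: "h \<in> Arr C" "Cod C h = Dom C ?I" and V: "is_pullback C ?I (?I \<cdot> h) u \<pi>"
      and \<sigma>: "\<sigma> \<in> Hom C (Dom C h) (Dom C u)" "u \<cdot> \<sigma> = h" "\<pi> \<cdot> \<sigma> = Ident C (Dom C h)"
    note [simp] = h pullbackD(3,4,8)[OF V] \<sigma>(1)[unfolded in_Hom]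
    have [simp]: "Cod C u = Dom C f" "Cod C \<pi> = Dom C h" using pullbackD(6,7)[OF V] h by auto
    have "h \<cdot> \<pi> = u" using pullbackD(9)[OF V] h by simp
    then have "\<sigma> \<cdot> \<pi> = Ident C (Dom C u)"
      using reassoc[OF \<sigma>(2), of \<pi>] reassoc[OF \<sigma>(3), of \<pi>]
      by - (rule pullback_eq[OF V, of _ "Dom C u"]; simp)
    then have "(\<sigma> \<cdot> \<pi>) = Ident C (Cod C \<sigma>)" by simp
    then have "z \<cdot> d \<cdot> \<pi> = m" if "z \<in> fib" "m \<in> Hom C (Cod C \<sigma>) (Cod C z)" "d \<in> Hom C (Dom C \<sigma>) (Dom C z)" "z \<cdot> d = m \<cdot> \<sigma>" for z m d
      using that reassoc[OF that(4), of \<pi>] fib_Arr[OF that(1)] by simp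
    then show "lifts \<sigma>" by (intro liftsI bexI) auto
  qed
  moreover have "weak_elim f ?I ?I"
    unfolding weak_elim_def
  proof (intro allI impI)
    fix q s0 t0 r0 y k x m d
    assume y: "y \<in> fib" "is_pullback C y r0 k x" and m: "m \<in> Hom C (Dom C y) (Cod C f)"
      and d: "d \<in> Hom C (Dom C k) (Dom C f)" "f \<cdot> d = m \<cdot> k"
    note [simp] = pullbackD(1-4,6-8)[OF y(2)]
    show "\<exists>j\<in>Hom C (Dom C y) (Dom C f). f \<cdot> j = m \<and> (\<exists>h\<in>Hom C (Dom C k) (Dom C ?I). ?I \<cdot> h = j \<cdot> k \<and> ?I \<cdot> h = d)"
      using m d gf[of d] reassoc[OF g(2), of m] by (intro bexI[of _ "g \<cdot> m"] bexI[of _ d] conjI) auto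
  qed
  ultimately show ?thesis unfolding path_fibration_def by blast
qed

text \<open>\<open>T\<close> carries a point of \<open>p\<close> along a path of the base display
  \<open>q\<close>. It is taken from \<open>weak_elim\<close> and not from mere lifting because the
  path \<open>\<eta>\<close> from \<open>T \<cdot> \<rho>\<close> to the identity, where
  \<open>\<rho>\<close> pairs a point with reflexivity, is what makes reflexivity for the composite
  possible.\<close>

lemma composite_transport:
  assumes I: "id_str q sq tq rq" and P: "path_str p sp tp rp" and H: "weak_elim p sp tp" and c: "Cod C p = Dom C q"
    and A: "is_pullback C p sq ae au"
  obtains T \<rho> \<eta> where "T \<in> Hom C (Dom C ae) (Dom C p)" "p \<cdot> T = tq \<cdot> au"
    "\<rho> \<in> Hom C (Dom C p) (Dom C ae)" "ae \<cdot> \<rho> = Ident C (Dom C p)" "au \<cdot> \<rho> = rq \<cdot> p"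
    "\<eta> \<in> Hom C (Dom C p) (Dom C sp)" "sp \<cdot> \<eta> = T \<cdot> \<rho>" "tp \<cdot> \<eta> = Ident C (Dom C p)"
proof -
  note Pq = path_strD[OF id_str_path_str[OF I]] and [simp] = path_strD(2-10)[OF id_str_path_str[OF I]]
  note Pp = path_strD[OF P] and [simp] = path_strD(2-10)[OF P] c
  note [simp] = pullbackD(3,4,6-8)[OF A]
  have au: "au \<in> fib" using fib_pullback[OF Pp(1) A] .
  obtain k x where k: "is_pullback C au rq k x" using fib_pullback_ex[OF au, of rq] by auto
  note [simp] = pullbackD(3,4,6-8)[OF k]
  have sq: "p \<cdot> ae = sq \<cdot> au" and kx: "au \<cdot> k = rq \<cdot> x" using pullbackD(9)[OF A] pullbackD(9)[OF k] by auto
  have "p \<cdot> ae \<cdot> k = (tq \<cdot> au) \<cdot> k"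
    using reassoc[OF sq, of k] kx reassoc[OF Pq(12), of x] reassoc[OF Pq(13), of x] by simp
  then obtain T h where T: "T \<in> Hom C (Dom C au) (Dom C p)" "p \<cdot> T = tq \<cdot> au"
    and h: "h \<in> Hom C (Dom C k) (Dom C sp)" "sp \<cdot> h = T \<cdot> k" "tp \<cdot> h = ae \<cdot> k"
    using weak_elimD[OF H I au k, of "tq \<cdot> au" "ae \<cdot> k"] by auto
  note [simp] = T(1)[unfolded in_Hom] h(1)[unfolded in_Hom]
  obtain \<rho> where \<rho>: "\<rho> \<in> Hom C (Dom C p) (Dom C ae)" "ae \<cdot> \<rho> = Ident C (Dom C p)" "au \<cdot> \<rho> = rq \<cdot> p"
    using pullback_lift[OF A, of "Ident C (Dom C p)" "Dom C p" "rq \<cdot> p"] reassoc[OF Pq(12), of p] by auto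
  obtain \<rho>' where \<rho>': "\<rho>' \<in> Hom C (Dom C p) (Dom C k)" "k \<cdot> \<rho>' = \<rho>"
    using pullback_lift[OF k, of \<rho> "Dom C p" p] \<rho> by auto
  show thesis
    by (rule that[of T \<rho> "h \<cdot> \<rho>'"])
      (use T \<rho> \<rho>' reassoc[OF h(2), of \<rho>'] reassoc[OF h(3), of \<rho>'] in auto)
qed

text \<open>
  A path from \<open>e\<close> to \<open>e'\<close> for \<open>q \<cdot> p\<close> is a path \<open>u\<close> for \<open>q\<close> from \<open>p e\<close> to \<open>p e'\<close> together with a path for
  \<open>p\<close> from the transport \<open>T u e\<close> to \<open>e'\<close>.
\<close>

lemma composite_path_str:
  assumes I: "id_str q sq tq rq" and P: "path_str p sp tp rp" and c: "Cod C p = Dom C q"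
    and A: "is_pullback C p sq ae au"
    and T: "T \<in> Hom C (Dom C ae) (Dom C p)" "p \<cdot> T = tq \<cdot> au"
    and \<rho>: "\<rho> \<in> Hom C (Dom C p) (Dom C ae)" "ae \<cdot> \<rho> = Ident C (Dom C p)" "au \<cdot> \<rho> = rq \<cdot> p"
    and \<eta>: "\<eta> \<in> Hom C (Dom C p) (Dom C sp)" "sp \<cdot> \<eta> = T \<cdot> \<rho>" "tp \<cdot> \<eta> = Ident C (Dom C p)"
    and B: "is_pullback C sp T ke ka"
  obtains r where "path_str (q \<cdot> p) (ae \<cdot> ka) (tp \<cdot> ke) r"
proof -
  note Pq = path_strD[OF id_str_path_str[OF I]] and [simp] = path_strD(2-10)[OF id_str_path_str[OF I]]
  note Pp = path_strD[OF P] and [simp] = path_strD(2-10)[OF P] c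
  note [simp] = pullbackD(3,4,6-8)[OF A] T(1)[unfolded in_Hom] \<rho>(1)[unfolded in_Hom] \<eta>(1)[unfolded in_Hom]
  note [simp] = pullbackD(3,4,6-8)[OF B]
  have A': "p \<cdot> ae = sq \<cdot> au" and B': "sp \<cdot> ke = T \<cdot> ka" using pullbackD(9)[OF A] pullbackD(9)[OF B] by auto
  \<comment> \<open>Reflexivity at a point \<open>e\<close>: reflexivity of \<open>q\<close> at
    \<open>p e\<close>, together with the path \<open>\<eta>\<close> from the transported point back
    to \<open>e\<close>.\<close>
  obtain r where r: "r \<in> Hom C (Dom C p) (Dom C ke)" "ke \<cdot> r = \<eta>" "ka \<cdot> r = \<rho>"
    using pullback_lift[OF B, of \<eta> "Dom C p" \<rho>] \<eta>(2) by auto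
  obtain p1 p2 sp' where Pb: "is_pullback C p p p1 p2" "sp' \<in> fib" "Cod C sp' = Dom C p1" "sp = p1 \<cdot> sp'" "tp = p2 \<cdot> sp'"
    using P unfolding path_str_def by blast
  obtain q1 q2 sq' where Qb: "is_pullback C q q q1 q2" "sq' \<in> fib" "Cod C sq' = Dom C q1" "sq = q1 \<cdot> sq'" "tq = q2 \<cdot> sq'"
    using id_str_path_str[OF I] unfolding path_str_def by blast
  note [simp] = pullbackD(3,4,6-8)[OF Pb(1)] pullbackD(3,4,6-8)[OF Qb(1)] fib_Arr[OF Pb(2)] fib_Arr[OF Qb(2)] Pb(3) Qb(3)
  have [simp]: "Dom C sp' = Dom C sp" "Dom C sq' = Dom C sq" using Pb(4) Qb(4) by auto
  have qp: "q \<cdot> p \<in> fib" using fib_comp[OF Pq(1) Pp(1)] by simp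
  obtain P1 P2 where E: "is_pullback C (q \<cdot> p) (q \<cdot> p) P1 P2" using fib_pullback_ex[OF qp, of "q \<cdot> p"] by auto
  note [simp] = pullbackD(3,4,8)[OF E]
  have [simp]: "Cod C P1 = Dom C p" "Cod C P2 = Dom C p" using pullbackD(6,7)[OF E] by auto
  have EE: "q \<cdot> p \<cdot> P1 = q \<cdot> p \<cdot> P2" using pullbackD(9)[OF E] by simp
  have "q \<cdot> p \<cdot> ae \<cdot> ka = q \<cdot> sq \<cdot> au \<cdot> ka" using reassoc[OF A', of ka] by simp
  moreover have "q \<cdot> p \<cdot> tp \<cdot> ke = q \<cdot> sq \<cdot> au \<cdot> ka"
    using reassoc[OF Pp(11), of ke] B' reassoc[OF T(2), of ka] reassoc[OF Pq(11), of "au \<cdot> ka"] by simp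
  ultimately obtain st where st: "st \<in> Hom C (Dom C ke) (Dom C P1)" "P1 \<cdot> st = ae \<cdot> ka" "P2 \<cdot> st = tp \<cdot> ke"
    using pullback_lift[OF E, of "ae \<cdot> ka" "Dom C ke" "tp \<cdot> ke"] by auto
  note [simp] = st(1)[unfolded in_Hom]
  \<comment> \<open>\<open>st\<close> is a fibration in two stages: \<open>c1\<close> adds a path of
    \<open>q\<close> between the images under \<open>p\<close>, and \<open>l\<close> then adds a
    path of \<open>p\<close> from the transported first point to the second point.\<close>
  obtain n1 where n1: "n1 \<in> Hom C (Dom C P1) (Dom C q1)" "q1 \<cdot> n1 = p \<cdot> P1" "q2 \<cdot> n1 = p \<cdot> P2"
    using pullback_lift[OF Qb(1), of "p \<cdot> P1" "Dom C P1" "p \<cdot> P2"] EE by auto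
  note [simp] = n1(1)[unfolded in_Hom]
  obtain u1 c1 where L1: "is_pullback C sq' n1 u1 c1" "c1 \<in> fib" using fib_pullbackE[OF Qb(2), of n1] by auto
  note [simp] = pullbackD(3,4,6-8)[OF L1(1)]
  have L1': "sq' \<cdot> u1 = n1 \<cdot> c1" using pullbackD(9)[OF L1(1)] .
  have su: "sq \<cdot> u1 = p \<cdot> P1 \<cdot> c1" "tq \<cdot> u1 = p \<cdot> P2 \<cdot> c1"
    using L1' reassoc[OF n1(2), of c1] reassoc[OF n1(3), of c1]
      reassoc[OF Qb(4)[symmetric], of u1] reassoc[OF Qb(5)[symmetric], of u1] by auto
  obtain e1 where e1: "e1 \<in> Hom C (Dom C u1) (Dom C ae)" "ae \<cdot> e1 = P1 \<cdot> c1" "au \<cdot> e1 = u1"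
    using pullback_lift[OF A, of "P1 \<cdot> c1" "Dom C u1" u1] su by auto
  note [simp] = e1(1)[unfolded in_Hom]
  have "p \<cdot> T \<cdot> e1 = p \<cdot> P2 \<cdot> c1" using reassoc[OF T(2), of e1] e1(3) su by simp
  then obtain n2 where n2: "n2 \<in> Hom C (Dom C u1) (Dom C p1)" "p1 \<cdot> n2 = T \<cdot> e1" "p2 \<cdot> n2 = P2 \<cdot> c1"
    using pullback_lift[OF Pb(1), of "T \<cdot> e1" "Dom C u1" "P2 \<cdot> c1"] by auto
  note [simp] = n2(1)[unfolded in_Hom]
  have "sq' \<cdot> au \<cdot> ka = n1 \<cdot> st"
    using reassoc[OF n1(2), of st] reassoc[OF n1(3), of st] st(2,3) reassoc[OF A', of ka] reassoc[OF Pp(11), of ke] B' reassoc[OF T(2), of ka]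
      reassoc[OF Qb(4)[symmetric], of "au \<cdot> ka"] reassoc[OF Qb(5)[symmetric], of "au \<cdot> ka"]
    by - (rule pullback_eq[OF Qb(1), of _ "Dom C ke"]; simp)
  then obtain l where l: "l \<in> Hom C (Dom C ke) (Dom C u1)" "u1 \<cdot> l = au \<cdot> ka" "c1 \<cdot> l = st"
    using pullback_lift[OF L1(1), of "au \<cdot> ka" "Dom C ke" st] by auto
  note [simp] = l(1)[unfolded in_Hom]
  have el: "e1 \<cdot> l = ka"
    using reassoc[OF e1(2), of l] reassoc[OF e1(3), of l] l(2,3) st(2) by - (rule pullback_eq[OF A, of _ "Dom C ke"]; simp)
  have "is_pullback C sp' n2 ke l"
  proof (rule pullbackI[where V = "Dom C ke"])
    show "sp' \<cdot> ke = n2 \<cdot> l"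
      using reassoc[OF n2(2), of l] reassoc[OF n2(3), of l] el l(3) st(3) B'
        reassoc[OF Pb(4)[symmetric], of ke] reassoc[OF Pb(5)[symmetric], of ke]
      by - (rule pullback_eq[OF Pb(1), of _ "Dom C ke"]; simp)
    fix S
    {
      fix a b assume a: "a \<in> Hom C S (Dom C sp')" and b: "b \<in> Hom C S (Dom C n2)" and e: "sp' \<cdot> a = n2 \<cdot> b"
      note [simp] = a[unfolded in_Hom] b[unfolded in_Hom]
      have ea: "sp \<cdot> a = T \<cdot> e1 \<cdot> b" "tp \<cdot> a = P2 \<cdot> c1 \<cdot> b"
        using e reassoc[OF n2(2), of b] reassoc[OF n2(3), of b]
          reassoc[OF Pb(4)[symmetric], of a] reassoc[OF Pb(5)[symmetric], of a] by auto
      obtain w where w: "w \<in> Hom C S (Dom C ke)" "ke \<cdot> w = a" "ka \<cdot> w = e1 \<cdot> b"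
        using pullback_lift[OF B, of a S "e1 \<cdot> b"] ea by auto
      note [simp] = w(1)[unfolded in_Hom]
      have "st \<cdot> w = c1 \<cdot> b"
        using reassoc[OF st(2), of w] reassoc[OF st(3), of w] w ea reassoc[OF e1(2), of b]
        by - (rule pullback_eq[OF E, of _ S]; simp)
      then have "l \<cdot> w = b"
        using reassoc[OF l(2), of w] reassoc[OF l(3), of w] w reassoc[OF e1(3), of b]
        by - (rule pullback_eq[OF L1(1), of _ S]; simp)
      then show "\<exists>w\<in>Hom C S (Dom C ke). ke \<cdot> w = a \<and> l \<cdot> w = b" using w by auto
    }
    fix w w' assume w: "w \<in> Hom C S (Dom C ke)" "w' \<in> Hom C S (Dom C ke)" "ke \<cdot> w = ke \<cdot> w'" "l \<cdot> w = l \<cdot> w'"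
    then show "w = w'"
      using reassoc[OF el, of w] reassoc[OF el, of w'] by - (rule pullback_eq[OF B, of _ S]; simp)
  qed auto
  then have "l \<in> fib" using fib_pullback[OF Pb(2)] by blast
  then have "st \<in> fib" using fib_comp[OF L1(2), of l] l by simp
  then have "path_str (q \<cdot> p) (ae \<cdot> ka) (tp \<cdot> ke) r"
    unfolding path_str_def using E qp st r \<rho>(2) \<eta>(3)
    by (intro conjI exI[of _ P1] exI[of _ P2] exI[of _ st]) auto
  then show thesis by (rule that)
qed

text \<open>
  From the given path \<open>(u0, k0)\<close>, first move \<open>k0\<close> to reflexivity over the fixed \<open>u0\<close>, then \<open>u0\<close> to an
  arbitrary \<open>u\<close> along the paths \<open>(u, refl)\<close>, and finally reflexivity to an arbitrary \<open>k\<close> over \<open>u\<close>.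
\<close>

lemma composite_based_elim:
  assumes I: "id_str q sq tq rq" and P: "path_str p sp tp rp" and K: "based_elim sp" and c: "Cod C p = Dom C q"
    and A: "is_pullback C p sq ae au" and T: "T \<in> Hom C (Dom C ae) (Dom C p)" "p \<cdot> T = tq \<cdot> au"
    and B: "is_pullback C sp T ke ka"
  shows "based_elim (ae \<cdot> ka)"
  unfolding based_elim_def
proof (intro allI impI, elim conjE)
  fix h u \<pi> \<sigma>
  assume h: "h \<in> Arr C" "Cod C h = Dom C (ae \<cdot> ka)" and V: "is_pullback C (ae \<cdot> ka) ((ae \<cdot> ka) \<cdot> h) u \<pi>"
    and \<sigma>: "\<sigma> \<in> Hom C (Dom C h) (Dom C u)" "u \<cdot> \<sigma> = h" "\<pi> \<cdot> \<sigma> = Ident C (Dom C h)"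
  note Pq = path_strD[OF id_str_path_str[OF I]] and [simp] = path_strD(2-10)[OF id_str_path_str[OF I]]
  note Pp = path_strD[OF P] and [simp] = path_strD(2-10)[OF P] c
  note [simp] = pullbackD(3,4,6-8)[OF A] T(1)[unfolded in_Hom]
  note [simp] = pullbackD(3,4,6-8)[OF B] h(1)
  have [simp]: "Cod C h = Dom C ke" using h(2) by simp
  note [simp] = \<sigma>(1)[unfolded in_Hom] pullbackD(3,4,8)[OF V]
  have [simp]: "Cod C \<pi> = Dom C h" "Cod C u = Dom C ke" using pullbackD(6,7)[OF V] by auto
  have A': "p \<cdot> ae = sq \<cdot> au" and B': "sp \<cdot> ke = T \<cdot> ka" using pullbackD(9)[OF A] pullbackD(9)[OF B] by auto
  have V': "ae \<cdot> ka \<cdot> u = ae \<cdot> ka \<cdot> h \<cdot> \<pi>" using pullbackD(9)[OF V] by simp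
  have liftV: "\<exists>f \<in> Hom C X (Dom C u). u \<cdot> f = g \<and> \<pi> \<cdot> f = x"
    if "g \<in> Hom C X (Dom C ke)" "x \<in> Hom C X (Dom C h)" "ae \<cdot> ka \<cdot> g = ae \<cdot> ka \<cdot> h \<cdot> x" for X g x
  proof -
    have "(ae \<cdot> ka) \<cdot> g = ((ae \<cdot> ka) \<cdot> h) \<cdot> x" "g \<in> Hom C X (Dom C (ae \<cdot> ka))" "x \<in> Hom C X (Dom C ((ae \<cdot> ka) \<cdot> h))"
      using that by auto
    then show ?thesis using pullback_lift[OF V, of g X x] by metis
  qed
  have eqV: "f = f'" if "f \<in> Hom C X (Dom C u)" "f' \<in> Hom C X (Dom C u)" "ke \<cdot> u \<cdot> f = ke \<cdot> u \<cdot> f'"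
    "ka \<cdot> u \<cdot> f = ka \<cdot> u \<cdot> f'" "\<pi> \<cdot> f = \<pi> \<cdot> f'" for X f f'
  proof (rule pullback_eq[OF V, of _ X])
    show "u \<cdot> f = u \<cdot> f'" using that by - (rule pullback_eq[OF B, of _ X]; simp)
  qed (use that in auto)
  show "lifts \<sigma>"
  proof (rule liftsI)
    fix z m d assume z: "z \<in> fib" and m: "m \<in> Hom C (Cod C \<sigma>) (Cod C z)" and d: "d \<in> Hom C (Dom C \<sigma>) (Dom C z)"
      and zd: "z \<cdot> d = m \<cdot> \<sigma>"
    note [simp] = fib_Arr[OF z] m[unfolded in_Hom] d[unfolded in_Hom]
    obtain ua \<pi>a \<sigma>a where a: "is_pullback C sp (sp \<cdot> ke \<cdot> h) ua \<pi>a" "\<sigma>a \<in> Hom C (Dom C h) (Dom C ua)"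
      "ua \<cdot> \<sigma>a = ke \<cdot> h" "\<pi>a \<cdot> \<sigma>a = Ident C (Dom C h)" "lifts \<sigma>a"
      using based_elimD[OF K Pp(14), of "ke \<cdot> h" "Dom C h"] by auto
    note [simp] = pullbackD(3,4,6,8)[OF a(1)] a(2)[unfolded in_Hom]
    have [simp]: "Cod C \<pi>a = Dom C h" using pullbackD(7)[OF a(1)] by simp
    have sua: "sp \<cdot> ua = T \<cdot> ka \<cdot> h \<cdot> \<pi>a" using pullbackD(9)[OF a(1)] reassoc[OF B', of "h \<cdot> \<pi>a"] by simp
    obtain ga where ga: "ga \<in> Hom C (Dom C ua) (Dom C ke)" "ke \<cdot> ga = ua" "ka \<cdot> ga = ka \<cdot> h \<cdot> \<pi>a"
      using pullback_lift[OF B, of ua "Dom C ua" "ka \<cdot> h \<cdot> \<pi>a"] sua by auto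
    note [simp] = ga(1)[unfolded in_Hom]
    obtain fa where fa: "fa \<in> Hom C (Dom C ua) (Dom C u)" "u \<cdot> fa = ga" "\<pi> \<cdot> fa = \<pi>a"
      using liftV[of ga "Dom C ua" \<pi>a] ga(3) by auto
    note [simp] = fa(1)[unfolded in_Hom]
    have "fa \<cdot> \<sigma>a = \<sigma>"
      using reassoc[OF fa(2), of \<sigma>a] reassoc[OF fa(3), of \<sigma>a] reassoc[OF ga(2), of \<sigma>a] reassoc[OF ga(3), of \<sigma>a] a(3,4) \<sigma>(2,3)
      by - (rule eqV[of _ "Dom C h"]; simp)
    then obtain ja where ja: "ja \<in> Hom C (Dom C ua) (Dom C z)" "z \<cdot> ja = m \<cdot> fa"
      using liftsD[OF a(5) z, of "m \<cdot> fa" d] zd by auto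
    note [simp] = ja(1)[unfolded in_Hom]
    \<comment> \<open>Among the paths of \<open>p\<close> with the same source as
      \<open>ke \<cdot> h\<close> there is also reflexivity; \<open>\<omega>\<close> picks it
      out.\<close>
    have "sp \<cdot> rp \<cdot> T \<cdot> ka \<cdot> h = (sp \<cdot> ke \<cdot> h) \<cdot> Ident C (Dom C h)"
      using reassoc[OF Pp(12), of "T \<cdot> ka \<cdot> h"] reassoc[OF B', of h] by simp
    then obtain \<omega> where \<omega>: "\<omega> \<in> Hom C (Dom C h) (Dom C ua)" "ua \<cdot> \<omega> = rp \<cdot> T \<cdot> ka \<cdot> h" "\<pi>a \<cdot> \<omega> = Ident C (Dom C h)"
      using pullback_lift[OF a(1), of "rp \<cdot> T \<cdot> ka \<cdot> h" "Dom C h" "Ident C (Dom C h)"] by auto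
    note [simp] = \<omega>(1)[unfolded in_Hom]
    obtain ub \<pi>b \<sigma>b where b: "is_pullback C sq (sq \<cdot> au \<cdot> ka \<cdot> h) ub \<pi>b" "\<sigma>b \<in> Hom C (Dom C h) (Dom C ub)"
      "ub \<cdot> \<sigma>b = au \<cdot> ka \<cdot> h" "\<pi>b \<cdot> \<sigma>b = Ident C (Dom C h)" "lifts \<sigma>b"
      using based_elimD[OF id_str_based_elim[OF I] Pq(14), of "au \<cdot> ka \<cdot> h" "Dom C h"] by auto
    note [simp] = pullbackD(3,4,6,8)[OF b(1)] b(2)[unfolded in_Hom]
    have [simp]: "Cod C \<pi>b = Dom C h" using pullbackD(7)[OF b(1)] by simp
    have sub: "sq \<cdot> ub = p \<cdot> ae \<cdot> ka \<cdot> h \<cdot> \<pi>b" using pullbackD(9)[OF b(1)] reassoc[OF A', of "ka \<cdot> h \<cdot> \<pi>b"] by simp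
    \<comment> \<open>\<open>\<kappa>\<close> keeps the starting point of \<open>h\<close> and lets
      the path of \<open>q\<close> vary; \<open>gb\<close> completes it by reflexivity at the
      transported point.\<close>
    obtain \<kappa> where \<kappa>: "\<kappa> \<in> Hom C (Dom C ub) (Dom C ae)" "ae \<cdot> \<kappa> = ae \<cdot> ka \<cdot> h \<cdot> \<pi>b" "au \<cdot> \<kappa> = ub"
      using pullback_lift[OF A, of "ae \<cdot> ka \<cdot> h \<cdot> \<pi>b" "Dom C ub" ub] sub by auto
    note [simp] = \<kappa>(1)[unfolded in_Hom]
    obtain gb where gb: "gb \<in> Hom C (Dom C ub) (Dom C ke)" "ke \<cdot> gb = rp \<cdot> T \<cdot> \<kappa>" "ka \<cdot> gb = \<kappa>"
      using pullback_lift[OF B, of "rp \<cdot> T \<cdot> \<kappa>" "Dom C ub" \<kappa>] reassoc[OF Pp(12), of "T \<cdot> \<kappa>"] by auto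
    note [simp] = gb(1)[unfolded in_Hom]
    obtain fb where fb: "fb \<in> Hom C (Dom C ub) (Dom C u)" "u \<cdot> fb = gb" "\<pi> \<cdot> fb = \<pi>b"
      using liftV[of gb "Dom C ub" \<pi>b] gb(3) \<kappa>(2) by auto
    note [simp] = fb(1)[unfolded in_Hom]
    have \<kappa>b: "\<kappa> \<cdot> \<sigma>b = ka \<cdot> h"
      using reassoc[OF \<kappa>(2), of \<sigma>b] reassoc[OF \<kappa>(3), of \<sigma>b] b(3,4) by - (rule pullback_eq[OF A, of _ "Dom C h"]; simp)
    have "fb \<cdot> \<sigma>b = fa \<cdot> \<omega>"
      using reassoc[OF fa(2), of \<omega>] reassoc[OF fa(3), of \<omega>] reassoc[OF ga(2), of \<omega>] reassoc[OF ga(3), of \<omega>] \<omega>(2,3)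
        reassoc[OF fb(2), of \<sigma>b] reassoc[OF fb(3), of \<sigma>b] reassoc[OF gb(2), of \<sigma>b] reassoc[OF gb(3), of \<sigma>b] \<kappa>b b(4)
      by - (rule eqV[of _ "Dom C h"]; simp)
    then have "z \<cdot> ja \<cdot> \<omega> = (m \<cdot> fb) \<cdot> \<sigma>b" using reassoc[OF ja(2), of \<omega>] by simp
    then obtain jb where jb: "jb \<in> Hom C (Dom C ub) (Dom C z)" "z \<cdot> jb = m \<cdot> fb"
      using liftsD[OF b(5) z, of "m \<cdot> fb" "ja \<cdot> \<omega>"] by auto
    note [simp] = jb(1)[unfolded in_Hom]
    obtain uc \<pi>c \<sigma>c where c: "is_pullback C sp (sp \<cdot> rp \<cdot> T \<cdot> \<kappa>) uc \<pi>c" "\<sigma>c \<in> Hom C (Dom C ub) (Dom C uc)"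
      "uc \<cdot> \<sigma>c = rp \<cdot> T \<cdot> \<kappa>" "\<pi>c \<cdot> \<sigma>c = Ident C (Dom C ub)" "lifts \<sigma>c"
      using based_elimD[OF K Pp(14), of "rp \<cdot> T \<cdot> \<kappa>" "Dom C ub"] by auto
    note [simp] = pullbackD(3,4,6,8)[OF c(1)] c(2)[unfolded in_Hom]
    have [simp]: "Cod C \<pi>c = Dom C ub" using pullbackD(7)[OF c(1)] by simp
    have suc: "sp \<cdot> uc = T \<cdot> \<kappa> \<cdot> \<pi>c" using pullbackD(9)[OF c(1)] reassoc[OF Pp(12), of "T \<cdot> \<kappa> \<cdot> \<pi>c"] by simp
    obtain gc where gc: "gc \<in> Hom C (Dom C uc) (Dom C ke)" "ke \<cdot> gc = uc" "ka \<cdot> gc = \<kappa> \<cdot> \<pi>c"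
      using pullback_lift[OF B, of uc "Dom C uc" "\<kappa> \<cdot> \<pi>c"] suc by auto
    note [simp] = gc(1)[unfolded in_Hom]
    obtain fc where fc: "fc \<in> Hom C (Dom C uc) (Dom C u)" "u \<cdot> fc = gc" "\<pi> \<cdot> fc = \<pi>b \<cdot> \<pi>c"
      using liftV[of gc "Dom C uc" "\<pi>b \<cdot> \<pi>c"] gc(3) reassoc[OF \<kappa>(2), of \<pi>c] by auto
    note [simp] = fc(1)[unfolded in_Hom]
    have "fc \<cdot> \<sigma>c = fb"
      using reassoc[OF fc(2), of \<sigma>c] reassoc[OF fc(3), of \<sigma>c] reassoc[OF gc(2), of \<sigma>c] reassoc[OF gc(3), of \<sigma>c] c(3,4) fb(2,3) gb(2,3)
      by - (rule eqV[of _ "Dom C ub"]; simp)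
    then obtain jc where jc: "jc \<in> Hom C (Dom C uc) (Dom C z)" "z \<cdot> jc = m \<cdot> fc"
      using liftsD[OF c(5) z, of "m \<cdot> fc" jb] jb(2) by auto
    note [simp] = jc(1)[unfolded in_Hom]
    \<comment> \<open>\<open>\<nu>\<close> decomposes the variable path \<open>u\<close> into its
      component for \<open>q\<close> and its component for \<open>p\<close>; \<open>fc\<close> puts
      the two together again, so a lift over \<open>fc\<close> restricts along \<open>\<nu>\<close>
      to one over all of \<open>Dom C u\<close>.\<close>
    have "sq \<cdot> au \<cdot> ka \<cdot> u = sq \<cdot> au \<cdot> ka \<cdot> h \<cdot> \<pi>"
      using reassoc[OF A', of "ka \<cdot> u"] reassoc[OF A', of "ka \<cdot> h \<cdot> \<pi>"] V' by simp
    then obtain \<nu>b where \<nu>b: "\<nu>b \<in> Hom C (Dom C u) (Dom C ub)" "ub \<cdot> \<nu>b = au \<cdot> ka \<cdot> u" "\<pi>b \<cdot> \<nu>b = \<pi>"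
      using pullback_lift[OF b(1), of "au \<cdot> ka \<cdot> u" "Dom C u" \<pi>] by auto
    note [simp] = \<nu>b(1)[unfolded in_Hom]
    have \<kappa>\<nu>: "\<kappa> \<cdot> \<nu>b = ka \<cdot> u"
      using reassoc[OF \<kappa>(2), of \<nu>b] reassoc[OF \<kappa>(3), of \<nu>b] \<nu>b(2,3) V' by - (rule pullback_eq[OF A, of _ "Dom C u"]; simp)
    have "sp \<cdot> ke \<cdot> u = (sp \<cdot> rp \<cdot> T \<cdot> \<kappa>) \<cdot> \<nu>b"
      using reassoc[OF B', of u] reassoc[OF Pp(12), of "T \<cdot> \<kappa> \<cdot> \<nu>b"] \<kappa>\<nu> by simp
    then obtain \<nu> where \<nu>: "\<nu> \<in> Hom C (Dom C u) (Dom C uc)" "uc \<cdot> \<nu> = ke \<cdot> u" "\<pi>c \<cdot> \<nu> = \<nu>b"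
      using pullback_lift[OF c(1), of "ke \<cdot> u" "Dom C u" \<nu>b] by auto
    note [simp] = \<nu>(1)[unfolded in_Hom]
    have "fc \<cdot> \<nu> = Ident C (Dom C u)"
      using reassoc[OF fc(2), of \<nu>] reassoc[OF fc(3), of \<nu>] reassoc[OF gc(2), of \<nu>] reassoc[OF gc(3), of \<nu>] \<nu>(2,3) \<nu>b(3) \<kappa>\<nu>
      by - (rule eqV[of _ "Dom C u"]; simp)
    then have "z \<cdot> jc \<cdot> \<nu> = m" using reassoc[OF jc(2), of \<nu>] by simp
    then show "\<exists>j\<in>Hom C (Cod C \<sigma>) (Dom C z). z \<cdot> j = m" by (intro bexI[of _ "jc \<cdot> \<nu>"]) auto
  qed simp
qed

text \<open>As in lifting against composites, \<open>d\<close> is moved back along the path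
  \<open>h\<close> found for \<open>q\<close>, but the result \<open>d2\<close> must now come with a
  path of \<open>p\<close> from \<open>T (d2, h)\<close> to \<open>d\<close>. The lift
  \<open>j\<close> reaches \<open>d2\<close> only through a path \<open>\<kappa>\<close>; based
  elimination on \<open>\<kappa>\<close> replaces \<open>T (d2, h)\<close> by
  \<open>T (j k, h)\<close>, which gives the second component of the required path.\<close>

lemma composite_weak_elim:
  assumes I: "id_str q sq tq rq" and P: "path_str p sp tp rp" and K: "based_elim sp" and H: "weak_elim p sp tp" and c: "Cod C p = Dom C q"
    and A: "is_pullback C p sq ae au" and T: "T \<in> Hom C (Dom C ae) (Dom C p)" "p \<cdot> T = tq \<cdot> au"
    and \<rho>: "\<rho> \<in> Hom C (Dom C p) (Dom C ae)" "ae \<cdot> \<rho> = Ident C (Dom C p)" "au \<cdot> \<rho> = rq \<cdot> p"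
    and \<eta>: "\<eta> \<in> Hom C (Dom C p) (Dom C sp)" "sp \<cdot> \<eta> = T \<cdot> \<rho>" "tp \<cdot> \<eta> = Ident C (Dom C p)"
    and B: "is_pullback C sp T ke ka"
  shows "weak_elim (q \<cdot> p) (ae \<cdot> ka) (tp \<cdot> ke)"
  unfolding weak_elim_def
proof (intro allI impI)
  note Pq = path_strD[OF id_str_path_str[OF I]] and [simp] = path_strD(2-10)[OF id_str_path_str[OF I]]
  note Pp = path_strD[OF P] and [simp] = path_strD(2-10)[OF P] c
  note [simp] = pullbackD(3,4,6-8)[OF A] T(1)[unfolded in_Hom] \<rho>(1)[unfolded in_Hom] \<eta>(1)[unfolded in_Hom]
  note [simp] = pullbackD(3,4,6-8)[OF B]
  have A': "p \<cdot> ae = sq \<cdot> au" and B': "sp \<cdot> ke = T \<cdot> ka" using pullbackD(9)[OF A] pullbackD(9)[OF B] by auto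
  fix q0 s0 t0 r0 y k x m d
  assume I0: "id_str q0 s0 t0 r0" and y: "y \<in> fib" and k: "is_pullback C y r0 k x"
    and m: "m \<in> Hom C (Dom C y) (Cod C (q \<cdot> p))" and d: "d \<in> Hom C (Dom C k) (Dom C (q \<cdot> p))"
    and e: "(q \<cdot> p) \<cdot> d = m \<cdot> k"
  note [simp] = pullbackD(1-4,6-8)[OF k]
  have [simp]: "m \<in> Arr C" "Dom C m = Dom C y" "Cod C m = Cod C q" "d \<in> Arr C" "Dom C d = Dom C k" "Cod C d = Dom C p"
    using m d by auto
  obtain j1 h where j1: "j1 \<in> Hom C (Dom C y) (Dom C q)" "q \<cdot> j1 = m"
    and h: "h \<in> Hom C (Dom C k) (Dom C sq)" "sq \<cdot> h = j1 \<cdot> k" "tq \<cdot> h = p \<cdot> d"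
    using id_str_elim[OF I0 y k I, of m "p \<cdot> d"] e by auto
  note [simp] = j1(1)[unfolded in_Hom] h(1)[unfolded in_Hom]
  obtain be bu where N: "is_pullback C p tq be bu" "bu \<in> fib" using fib_pullbackE[OF Pp(1), of tq] by auto
  note [simp] = pullbackD(3,4,6-8)[OF N(1)]
  have N': "p \<cdot> be = tq \<cdot> bu" using pullbackD(9)[OF N(1)] .
  obtain ge gb where G: "is_pullback C p (sq \<cdot> bu) ge gb" "gb \<in> fib" using fib_pullbackE[OF Pp(1), of "sq \<cdot> bu"] by auto
  note [simp] = pullbackD(3,4,6,8)[OF G(1)]
  have [simp]: "Cod C gb = Dom C be" using pullbackD(7)[OF G(1)] by simp
  have G': "p \<cdot> ge = sq \<cdot> bu \<cdot> gb" using pullbackD(9)[OF G(1)] by simp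
  obtain e1 where e1: "e1 \<in> Hom C (Dom C ge) (Dom C ae)" "ae \<cdot> e1 = ge" "au \<cdot> e1 = bu \<cdot> gb"
    using pullback_lift[OF A, of ge "Dom C ge" "bu \<cdot> gb"] G' by auto
  note [simp] = e1(1)[unfolded in_Hom]
  have e4: "p \<cdot> T \<cdot> e1 = p \<cdot> be \<cdot> gb"
    using reassoc[OF T(2), of e1] e1(3) reassoc[OF N', of gb] by simp
  \<comment> \<open>To a point over the source, \<open>c4\<close> adds a path of \<open>p\<close>
    from its forward transport to the given point over the target. At reflexivity the point itself
    with \<open>\<eta>\<close> is such a pair.\<close>
  obtain u4 c4 where L4: "c4 \<in> fib" "u4 \<in> Hom C (Dom C c4) (Dom C sp)" "Cod C c4 = Dom C ge"
      "sp \<cdot> u4 = (T \<cdot> e1) \<cdot> c4" "tp \<cdot> u4 = (be \<cdot> gb) \<cdot> c4"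
    and Lu4: "\<And>X v' h'. \<lbrakk>v' \<in> Hom C X (Dom C ge); h' \<in> Hom C X (Dom C sp); sp \<cdot> h' = (T \<cdot> e1) \<cdot> v'; tp \<cdot> h' = (be \<cdot> gb) \<cdot> v'\<rbrakk>
        \<Longrightarrow> \<exists>w \<in> Hom C X (Dom C c4). u4 \<cdot> w = h' \<and> c4 \<cdot> w = v'"
  proof (rule path_str_fibration[OF P _ _ e4, of "Dom C ge"], goal_cases)
    case (3 u c) show ?case by (rule that(1)) (fact 3)+
  qed auto
  note [simp] = fib_Arr[OF L4(1)] L4(2)[unfolded in_Hom] L4(3)
  obtain kN xN where kN: "is_pullback C bu rq kN xN" using fib_pullback_ex[OF N(2), of rq] by auto
  note [simp] = pullbackD(3,4,6-8)[OF kN]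
  have kN': "bu \<cdot> kN = rq \<cdot> xN" using pullbackD(9)[OF kN] .
  have bk: "p \<cdot> be \<cdot> kN = xN" "sq \<cdot> bu \<cdot> kN = xN"
    using reassoc[OF N', of kN] kN' reassoc[OF Pq(13), of xN] reassoc[OF Pq(12), of xN] by auto
  obtain \<gamma> where \<gamma>: "\<gamma> \<in> Hom C (Dom C kN) (Dom C ge)" "ge \<cdot> \<gamma> = be \<cdot> kN" "gb \<cdot> \<gamma> = kN"
    using pullback_lift[OF G(1), of "be \<cdot> kN" "Dom C kN" kN] bk by auto
  note [simp] = \<gamma>(1)[unfolded in_Hom]
  have e\<gamma>: "e1 \<cdot> \<gamma> = \<rho> \<cdot> be \<cdot> kN"
    using reassoc[OF e1(2), of \<gamma>] reassoc[OF e1(3), of \<gamma>] reassoc[OF \<rho>(2), of "be \<cdot> kN"] reassoc[OF \<rho>(3), of "be \<cdot> kN"] \<gamma>(2,3) bk kN'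
    by - (rule pullback_eq[OF A, of _ "Dom C kN"]; simp)
  obtain d4 where d4: "d4 \<in> Hom C (Dom C kN) (Dom C c4)" "c4 \<cdot> d4 = \<gamma>"
  proof -
    have "\<gamma> \<in> Hom C (Dom C kN) (Dom C ge)" "\<eta> \<cdot> be \<cdot> kN \<in> Hom C (Dom C kN) (Dom C sp)" by auto
    moreover have "sp \<cdot> \<eta> \<cdot> be \<cdot> kN = (T \<cdot> e1) \<cdot> \<gamma>" "tp \<cdot> \<eta> \<cdot> be \<cdot> kN = (be \<cdot> gb) \<cdot> \<gamma>"
      using reassoc[OF \<eta>(2), of "be \<cdot> kN"] reassoc[OF \<eta>(3), of "be \<cdot> kN"] e\<gamma> \<gamma>(3) by auto
    ultimately show thesis using Lu4 that by blast
  qed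
  have "gb \<cdot> c4 \<in> fib" using fib_comp[OF G(2) L4(1)] by simp
  then obtain J where J: "J \<in> Hom C (Dom C be) (Dom C c4)" "gb \<cdot> c4 \<cdot> J = Ident C (Dom C be)"
    using liftsD[OF refl_pullback_lifts[OF I N(2) kN], of "gb \<cdot> c4" "Ident C (Dom C be)" d4] d4 \<gamma>(3) by auto
  note [simp] = J(1)[unfolded in_Hom]
  obtain ob where ob: "ob \<in> Hom C (Dom C k) (Dom C be)" "be \<cdot> ob = d" "bu \<cdot> ob = h"
    using pullback_lift[OF N(1), of d "Dom C k" h] h(3) by auto
  note [simp] = ob(1)[unfolded in_Hom]
  have gJ: "gb \<cdot> c4 \<cdot> J \<cdot> ob = ob" using reassoc[of gb "c4 \<cdot> J", OF J(2), of ob] by simp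
  define d2 where "d2 = ge \<cdot> c4 \<cdot> J \<cdot> ob"
  have [simp]: "d2 \<in> Arr C" "Dom C d2 = Dom C k" "Cod C d2 = Dom C p" by (auto simp: d2_def)
  have pd2: "p \<cdot> d2 = j1 \<cdot> k"
    unfolding d2_def using reassoc[OF G', of "c4 \<cdot> J \<cdot> ob"] gJ ob(3) h(2) by simp
  define k2 where "k2 = u4 \<cdot> J \<cdot> ob"
  define \<epsilon> where "\<epsilon> = e1 \<cdot> c4 \<cdot> J \<cdot> ob"
  have [simp]: "k2 \<in> Arr C" "Dom C k2 = Dom C k" "Cod C k2 = Dom C sp"
    "\<epsilon> \<in> Arr C" "Dom C \<epsilon> = Dom C k" "Cod C \<epsilon> = Dom C ae" by (auto simp: k2_def \<epsilon>_def)
  have \<epsilon>: "ae \<cdot> \<epsilon> = d2" "au \<cdot> \<epsilon> = h"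
    unfolding \<epsilon>_def d2_def using reassoc[OF e1(2), of "c4 \<cdot> J \<cdot> ob"] reassoc[OF e1(3), of "c4 \<cdot> J \<cdot> ob"] gJ ob(3) by auto
  have k2: "sp \<cdot> k2 = T \<cdot> \<epsilon>" "tp \<cdot> k2 = d"
    unfolding k2_def \<epsilon>_def using reassoc[OF L4(4), of "J \<cdot> ob"] reassoc[OF L4(5), of "J \<cdot> ob"] gJ ob(2) by auto
  obtain j \<kappa> where j: "j \<in> Hom C (Dom C y) (Dom C p)" "p \<cdot> j = j1"
    and \<kappa>: "\<kappa> \<in> Hom C (Dom C k) (Dom C sp)" "sp \<cdot> \<kappa> = j \<cdot> k" "tp \<cdot> \<kappa> = d2"
    using weak_elimD[OF H I0 y k, of j1 d2] pd2 by auto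
  note [simp] = j(1)[unfolded in_Hom] \<kappa>(1)[unfolded in_Hom]
  obtain u \<pi> \<sigma> where V: "is_pullback C sp (sp \<cdot> \<kappa>) u \<pi>" "\<sigma> \<in> Hom C (Dom C k) (Dom C u)" "u \<cdot> \<sigma> = \<kappa>"
    "\<pi> \<cdot> \<sigma> = Ident C (Dom C k)" "lifts \<sigma>" using based_elimD[OF K Pp(14) \<kappa>(1)] .
  note [simp] = pullbackD(3,4,6,8)[OF V(1)] V(2)[unfolded in_Hom]
  have [simp]: "Cod C \<pi> = Dom C k" using pullbackD(7)[OF V(1)] by simp
  have su: "sp \<cdot> u = j \<cdot> k \<cdot> \<pi>" using pullbackD(9)[OF V(1)] reassoc[OF \<kappa>(2), of \<pi>] by simp
  have "p \<cdot> tp \<cdot> u = sq \<cdot> h \<cdot> \<pi>"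
    using reassoc[OF Pp(11), of u] su reassoc[OF j(2), of "k \<cdot> \<pi>"] reassoc[OF h(2), of \<pi>] by simp
  then obtain \<epsilon>V where \<epsilon>V: "\<epsilon>V \<in> Hom C (Dom C u) (Dom C ae)" "ae \<cdot> \<epsilon>V = tp \<cdot> u" "au \<cdot> \<epsilon>V = h \<cdot> \<pi>"
    using pullback_lift[OF A, of "tp \<cdot> u" "Dom C u" "h \<cdot> \<pi>"] by auto
  note [simp] = \<epsilon>V(1)[unfolded in_Hom]
  have e5: "p \<cdot> T \<cdot> \<epsilon>V = p \<cdot> d \<cdot> \<pi>"
    using reassoc[OF T(2), of \<epsilon>V] \<epsilon>V(3) reassoc[OF h(3), of \<pi>] by simp
  \<comment> \<open>With \<open>u\<close> ranging over the paths that start at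
    \<open>j \<cdot> k\<close>: paths from the transport along \<open>h\<close> of the end of
    \<open>u\<close> to \<open>d\<close>. For \<open>u = \<kappa>\<close> there is
    \<open>k2\<close>; the lift is then evaluated at reflexivity, picked out by
    \<open>\<omega>\<close>.\<close>
  obtain u5 c5 where L5: "c5 \<in> fib" "u5 \<in> Hom C (Dom C c5) (Dom C sp)" "Cod C c5 = Dom C u"
      "sp \<cdot> u5 = (T \<cdot> \<epsilon>V) \<cdot> c5" "tp \<cdot> u5 = (d \<cdot> \<pi>) \<cdot> c5"
    and Lu5: "\<And>X v' h'. \<lbrakk>v' \<in> Hom C X (Dom C u); h' \<in> Hom C X (Dom C sp); sp \<cdot> h' = (T \<cdot> \<epsilon>V) \<cdot> v'; tp \<cdot> h' = (d \<cdot> \<pi>) \<cdot> v'\<rbrakk>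
        \<Longrightarrow> \<exists>w \<in> Hom C X (Dom C c5). u5 \<cdot> w = h' \<and> c5 \<cdot> w = v'"
  proof (rule path_str_fibration[OF P _ _ e5, of "Dom C u"], goal_cases)
    case (3 u c) show ?case by (rule that(1)) (fact 3)+
  qed auto
  note [simp] = fib_Arr[OF L5(1)] L5(2)[unfolded in_Hom] L5(3)
  have \<epsilon>V\<sigma>: "\<epsilon>V \<cdot> \<sigma> = \<epsilon>"
    using reassoc[OF \<epsilon>V(2), of \<sigma>] reassoc[OF \<epsilon>V(3), of \<sigma>] V(3,4) \<epsilon> \<kappa>(3) by - (rule pullback_eq[OF A, of _ "Dom C k"]; simp)
  obtain d5 where d5: "d5 \<in> Hom C (Dom C k) (Dom C c5)" "c5 \<cdot> d5 = \<sigma>"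
  proof -
    have "\<sigma> \<in> Hom C (Dom C k) (Dom C u)" "k2 \<in> Hom C (Dom C k) (Dom C sp)" by auto
    moreover have "sp \<cdot> k2 = (T \<cdot> \<epsilon>V) \<cdot> \<sigma>" "tp \<cdot> k2 = (d \<cdot> \<pi>) \<cdot> \<sigma>" using k2 \<epsilon>V\<sigma> V(4) by auto
    ultimately show thesis using Lu5 that by blast
  qed
  obtain j5 where j5: "j5 \<in> Hom C (Dom C u) (Dom C c5)" "c5 \<cdot> j5 = Ident C (Dom C u)"
    using liftsD[OF V(5) L5(1), of "Ident C (Dom C u)" d5] d5 by auto
  note [simp] = j5(1)[unfolded in_Hom]
  have "sp \<cdot> rp \<cdot> j \<cdot> k = (sp \<cdot> \<kappa>) \<cdot> Ident C (Dom C k)" using reassoc[OF Pp(12), of "j \<cdot> k"] \<kappa>(2) by simp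
  then obtain \<omega> where \<omega>: "\<omega> \<in> Hom C (Dom C k) (Dom C u)" "u \<cdot> \<omega> = rp \<cdot> j \<cdot> k" "\<pi> \<cdot> \<omega> = Ident C (Dom C k)"
    using pullback_lift[OF V(1), of "rp \<cdot> j \<cdot> k" "Dom C k" "Ident C (Dom C k)"] by auto
  note [simp] = \<omega>(1)[unfolded in_Hom]
  have cj: "c5 \<cdot> j5 \<cdot> \<omega> = \<omega>" using reassoc[OF j5(2), of \<omega>] by simp
  obtain l where l: "l \<in> Hom C (Dom C k) (Dom C ke)" "ke \<cdot> l = u5 \<cdot> j5 \<cdot> \<omega>" "ka \<cdot> l = \<epsilon>V \<cdot> \<omega>"
    using pullback_lift[OF B, of "u5 \<cdot> j5 \<cdot> \<omega>" "Dom C k" "\<epsilon>V \<cdot> \<omega>"] reassoc[OF L5(4), of "j5 \<cdot> \<omega>"] cj by auto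
  note [simp] = l(1)[unfolded in_Hom]
  have "(ae \<cdot> ka) \<cdot> l = j \<cdot> k"
    using l(3) reassoc[OF \<epsilon>V(2), of \<omega>] \<omega>(2) reassoc[OF Pp(13), of "j \<cdot> k"] by simp
  moreover have "(tp \<cdot> ke) \<cdot> l = d"
    using l(2) reassoc[OF L5(5), of "j5 \<cdot> \<omega>"] cj \<omega>(3) by simp
  ultimately show "\<exists>j\<in>Hom C (Dom C y) (Dom C (q \<cdot> p)). (q \<cdot> p) \<cdot> j = m \<and>
      (\<exists>h\<in>Hom C (Dom C k) (Dom C (ae \<cdot> ka)). (ae \<cdot> ka) \<cdot> h = j \<cdot> k \<and> (tp \<cdot> ke) \<cdot> h = d)"
    using j j1(2) by (intro bexI[of _ j] conjI bexI[of _ l]) auto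
qed

lemma fib_path_fibration: "f \<in> fib \<Longrightarrow> path_fibration f"
proof (induction rule: fib.induct)
  case (iso f) then show ?case by (rule path_fibration_iso)
next
  case (step q p)
  obtain sq tq rq where I: "id_str q sq tq rq" using step.hyps(1) display_id_str by blast
  obtain sp tp rp where P: "path_str p sp tp rp" and K: "based_elim sp" and H: "weak_elim p sp tp"
    using step.IH unfolding path_fibration_def by blast
  note [simp] = path_strD(2-10)[OF id_str_path_str[OF I]] path_strD(2-10)[OF P]
  obtain ae au where A: "is_pullback C p sq ae au" using fib_pullback_ex[OF step.hyps(3), of sq] step.hyps by auto
  note [simp] = pullbackD(3,4,6-8)[OF A]
  obtain T \<rho> \<eta> where T: "T \<in> Hom C (Dom C ae) (Dom C p)" "p \<cdot> T = tq \<cdot> au"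
    "\<rho> \<in> Hom C (Dom C p) (Dom C ae)" "ae \<cdot> \<rho> = Ident C (Dom C p)" "au \<cdot> \<rho> = rq \<cdot> p"
    "\<eta> \<in> Hom C (Dom C p) (Dom C sp)" "sp \<cdot> \<eta> = T \<cdot> \<rho>" "tp \<cdot> \<eta> = Ident C (Dom C p)"
    using composite_transport[OF I P H step.hyps(5) A] .
  obtain ke ka where B: "is_pullback C sp T ke ka" using fib_pullback_ex[OF path_strD(14)[OF P], of T] T(1) by auto
  show ?case
    using composite_path_str[OF I P step.hyps(5) A T B] composite_based_elim[OF I P K step.hyps(5) A T(1,2) B]
      composite_weak_elim[OF I P K H step.hyps(5) A T B] unfolding path_fibration_def by metis
qed

section \<open>Homotopies and weak equivalences\<close>

definition leibniz :: "'a \<Rightarrow> 'a \<Rightarrow> bool" where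
  "leibniz f g \<longleftrightarrow> (\<forall>X k Q p q a b z m. k \<in> Hom C X (Dom C f) \<longrightarrow> is_product C X (Cod C f) Q p q \<longrightarrow>
     a \<in> Hom C X Q \<longrightarrow> p \<cdot> a = Ident C X \<longrightarrow> q \<cdot> a = f \<cdot> k \<longrightarrow> b \<in> Hom C X Q \<longrightarrow> p \<cdot> b = Ident C X \<longrightarrow> q \<cdot> b = g \<cdot> k \<longrightarrow>
     z \<in> fib \<longrightarrow> m \<in> Hom C Q (Cod C z) \<longrightarrow>
     ((\<exists>d \<in> Hom C X (Dom C z). z \<cdot> d = m \<cdot> a) \<longleftrightarrow> (\<exists>d \<in> Hom C X (Dom C z). z \<cdot> d = m \<cdot> b)))"

definition homotopic :: "'a \<Rightarrow> 'a \<Rightarrow> bool" where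
  "homotopic f g \<longleftrightarrow> f \<in> Arr C \<and> g \<in> Arr C \<and> Dom C g = Dom C f \<and> Cod C g = Cod C f \<and> leibniz f g"

definition weq :: "'a set" where
  "weq = {f \<in> Arr C. \<exists>g \<in> Hom C (Cod C f) (Dom C f). homotopic (g \<cdot> f) (Ident C (Dom C f)) \<and> homotopic (f \<cdot> g) (Ident C (Cod C f))}"

section \<open>Products, and homotopy as a congruence\<close>

lemma prodD:
  assumes "is_product C X Y Q p q"
  shows "p \<in> Hom C Q X" "q \<in> Hom C Q Y"
  using assms unfolding is_product_def by auto

lemma prod_lift:
  assumes "is_product C X Y Q p q" "u \<in> Hom C S X" "v \<in> Hom C S Y"
  obtains w where "w \<in> Hom C S Q" "p \<cdot> w = u" "q \<cdot> w = v"
  using assms unfolding is_product_def by metis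

lemma prod_eq:
  assumes "is_product C X Y Q p q" "w \<in> Hom C S Q" "w' \<in> Hom C S Q" "p \<cdot> w = p \<cdot> w'" "q \<cdot> w = q \<cdot> w'"
  shows "w = w'"
proof -
  have "p \<cdot> w' \<in> Hom C S X" "q \<cdot> w' \<in> Hom C S Y" using prodD[OF assms(1)] assms(3) by auto
  then have "\<exists>!v. v \<in> Hom C S Q \<and> p \<cdot> v = p \<cdot> w' \<and> q \<cdot> v = q \<cdot> w'"
    using assms(1) unfolding is_product_def by blast
  then show ?thesis using assms by blast
qed

lemma pullback_terminal_product:
  assumes T: "is_terminal C T" and f: "f \<in> Hom C X T" "g \<in> Hom C Y T" and P: "is_pullback C f g p q"
  shows "is_product C X Y (Dom C p) p q"
proof -
  have "\<exists>!w. w \<in> Hom C Z (Dom C p) \<and> p \<cdot> w = u \<and> q \<cdot> w = v" if uv: "u \<in> Hom C Z X" "v \<in> Hom C Z Y" for Z u v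
  proof -
    have "Z \<in> Obj C" using uv(1) Dom_Cod_Obj(1)[of u] by simp
    then have "\<exists>!h. h \<in> Hom C Z T" using T unfolding is_terminal_def by blast
    moreover have "f \<cdot> u \<in> Hom C Z T" "g \<cdot> v \<in> Hom C Z T" using f uv by auto
    ultimately have "f \<cdot> u = g \<cdot> v" by blast
    then show ?thesis using P f uv unfolding is_pullback_def by simp
  qed
  then have "\<forall>Z. \<forall>u \<in> Hom C Z X. \<forall>v \<in> Hom C Z Y. \<exists>!w. w \<in> Hom C Z (Dom C p) \<and> p \<cdot> w = u \<and> q \<cdot> w = v"
    by blast
  moreover have "p \<in> Hom C (Dom C p) X" "q \<in> Hom C (Dom C p) Y" using pullbackD[OF P] f by auto
  ultimately show ?thesis unfolding is_product_def by blast
qed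

lemma prod_ex:
  assumes "X \<in> Obj C" "Y \<in> Obj C"
  shows "\<exists>Q p q. is_product C X Y Q p q"
proof -
  obtain T where T: "is_terminal C T" "\<And>X. X \<in> Obj C \<Longrightarrow> Hom C X T \<subseteq> fib" using terminal_ex by blast
  have "\<exists>!f. f \<in> Hom C X T" "\<exists>!g. g \<in> Hom C Y T" using T(1) assms unfolding is_terminal_def by blast+
  then obtain f g where fg: "f \<in> Hom C X T" "g \<in> Hom C Y T" by blast
  then have "f \<in> fib" using T(2) assms by blast
  then obtain p q where "is_pullback C f g p q" using fib_pullback_ex[of f g] fg by auto
  then show ?thesis using pullback_terminal_product[OF T(1) fg] by blast
qed

lemma homotopic_type:
  assumes "homotopic f g"
  shows "f \<in> Arr C" "g \<in> Arr C" "Dom C g = Dom C f" "Cod C g = Cod C f"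
  using assms unfolding homotopic_def by auto

lemma homotopic_iff:
  assumes "homotopic f g" "k \<in> Hom C X (Dom C f)" "is_product C X (Cod C f) Q p q"
    "a \<in> Hom C X Q" "p \<cdot> a = Ident C X" "q \<cdot> a = f \<cdot> k" "b \<in> Hom C X Q" "p \<cdot> b = Ident C X" "q \<cdot> b = g \<cdot> k"
    "z \<in> fib" "m \<in> Hom C Q (Cod C z)"
  shows "(\<exists>d \<in> Hom C X (Dom C z). z \<cdot> d = m \<cdot> a) \<longleftrightarrow> (\<exists>d \<in> Hom C X (Dom C z). z \<cdot> d = m \<cdot> b)"
  using assms(1)[unfolded homotopic_def leibniz_def, THEN conjunct2, THEN conjunct2, THEN conjunct2, THEN conjunct2] assms(2-)
  by blast

lemma homotopic_refl: "f \<in> Arr C \<Longrightarrow> homotopic f f"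
proof -
  have "a = b" if "is_product C X Y Q p q" "a \<in> Hom C X Q" "b \<in> Hom C X Q" "p \<cdot> a = Ident C X"
    "p \<cdot> b = Ident C X" "q \<cdot> a = f \<cdot> k" "q \<cdot> b = f \<cdot> k" for X Y Q p q a b k
    using prod_eq[OF that(1-3)] that by simp
  then show "f \<in> Arr C \<Longrightarrow> homotopic f f" unfolding homotopic_def leibniz_def by blast
qed

lemma homotopic_sym: "homotopic f g \<Longrightarrow> homotopic g f"
  unfolding homotopic_def leibniz_def by simp

lemma homotopic_trans:
  assumes "homotopic f g" "homotopic g h" shows "homotopic f h"
proof -
  note [simp] = homotopic_type[OF assms(1)] homotopic_type[OF assms(2)]
  show ?thesis
    unfolding homotopic_def leibniz_def
  proof (intro conjI allI impI)
    fix X k Q p q a b z m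
    assume k: "k \<in> Hom C X (Dom C f)" and Q: "is_product C X (Cod C f) Q p q"
      and a: "a \<in> Hom C X Q" "p \<cdot> a = Ident C X" "q \<cdot> a = f \<cdot> k"
      and b: "b \<in> Hom C X Q" "p \<cdot> b = Ident C X" "q \<cdot> b = h \<cdot> k" and z: "z \<in> fib" and m: "m \<in> Hom C Q (Cod C z)"
    have X: "X \<in> Obj C" using a(1) by auto
    obtain c where c: "c \<in> Hom C X Q" "p \<cdot> c = Ident C X" "q \<cdot> c = g \<cdot> k"
      using prod_lift[OF Q, of "Ident C X" X "g \<cdot> k"] k X by auto
    have "k \<in> Hom C X (Dom C g)" "is_product C X (Cod C g) Q p q" using k Q by auto
    then show "(\<exists>d \<in> Hom C X (Dom C z). z \<cdot> d = m \<cdot> a) \<longleftrightarrow> (\<exists>d \<in> Hom C X (Dom C z). z \<cdot> d = m \<cdot> b)"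
      using homotopic_iff[OF assms(1) k Q a c z m] homotopic_iff[OF assms(2) _ _ c b z m] by blast
  qed auto
qed

lemma homotopic_precomp:
  assumes "homotopic f g" "e \<in> Arr C" "Cod C e = Dom C f" shows "homotopic (f \<cdot> e) (g \<cdot> e)"
proof -
  note [simp] = homotopic_type[OF assms(1)] assms(2,3)
  show ?thesis
    unfolding homotopic_def leibniz_def
  proof (intro conjI allI impI)
    fix X k Q p q a b z m
    assume k: "k \<in> Hom C X (Dom C (f \<cdot> e))" and Q: "is_product C X (Cod C (f \<cdot> e)) Q p q"
      and a: "a \<in> Hom C X Q" "p \<cdot> a = Ident C X" "q \<cdot> a = (f \<cdot> e) \<cdot> k"
      and b: "b \<in> Hom C X Q" "p \<cdot> b = Ident C X" "q \<cdot> b = (g \<cdot> e) \<cdot> k" and z: "z \<in> fib" and m: "m \<in> Hom C Q (Cod C z)"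
    have "e \<cdot> k \<in> Hom C X (Dom C f)" "is_product C X (Cod C f) Q p q" "q \<cdot> a = f \<cdot> e \<cdot> k" "q \<cdot> b = g \<cdot> e \<cdot> k"
      using k Q a b by auto
    then show "(\<exists>d \<in> Hom C X (Dom C z). z \<cdot> d = m \<cdot> a) \<longleftrightarrow> (\<exists>d \<in> Hom C X (Dom C z). z \<cdot> d = m \<cdot> b)"
      using homotopic_iff[OF assms(1) _ _ a(1,2) _ b(1,2) _ z m] by blast
  qed auto
qed

text \<open>A predicate on the product of \<open>X\<close> with the codomain of \<open>e\<close> is
  pulled back along \<open>E = 1 \<times> e\<close>, which carries the graphs of \<open>f k\<close>
  and \<open>g k\<close> to those of \<open>e f k\<close> and \<open>e g k\<close>.\<close>

lemma homotopic_postcomp: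
  assumes "homotopic f g" "e \<in> Arr C" "Dom C e = Cod C f" shows "homotopic (e \<cdot> f) (e \<cdot> g)"
proof -
  note [simp] = homotopic_type[OF assms(1)] assms(2,3)
  show ?thesis
    unfolding homotopic_def leibniz_def
  proof (intro conjI allI impI)
    fix X k Q p q a b z m
    assume k: "k \<in> Hom C X (Dom C (e \<cdot> f))" and Q: "is_product C X (Cod C (e \<cdot> f)) Q p q"
      and a: "a \<in> Hom C X Q" "p \<cdot> a = Ident C X" "q \<cdot> a = (e \<cdot> f) \<cdot> k"
      and b: "b \<in> Hom C X Q" "p \<cdot> b = Ident C X" "q \<cdot> b = (e \<cdot> g) \<cdot> k" and z: "z \<in> fib" and m: "m \<in> Hom C Q (Cod C z)"
    have [simp]: "X \<in> Obj C" using a(1) by auto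
    have [simp]: "k \<in> Arr C" "Dom C k = X" "Cod C k = Dom C f" using k by auto
    obtain Q' p' q' where Q': "is_product C X (Cod C f) Q' p' q'" using prod_ex[of X "Cod C f"] by auto
    note [simp] = prodD[OF Q', unfolded in_Hom] prodD[OF Q, unfolded in_Hom]
    obtain E where E: "E \<in> Hom C Q' Q" "p \<cdot> E = p'" "q \<cdot> E = e \<cdot> q'"
      using prod_lift[OF Q, of p' Q' "e \<cdot> q'"] by auto
    note [simp] = E(1)[unfolded in_Hom]
    obtain a' where a': "a' \<in> Hom C X Q'" "p' \<cdot> a' = Ident C X" "q' \<cdot> a' = f \<cdot> k"
      using prod_lift[OF Q', of "Ident C X" X "f \<cdot> k"] by auto
    obtain b' where b': "b' \<in> Hom C X Q'" "p' \<cdot> b' = Ident C X" "q' \<cdot> b' = g \<cdot> k"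
      using prod_lift[OF Q', of "Ident C X" X "g \<cdot> k"] by auto
    have "E \<cdot> a' = a"
      using a a' reassoc[OF E(2), of a'] reassoc[OF E(3), of a'] by - (rule prod_eq[OF Q, of _ X]; simp)
    moreover have "E \<cdot> b' = b"
      using b b' reassoc[OF E(2), of b'] reassoc[OF E(3), of b'] by - (rule prod_eq[OF Q, of _ X]; simp)
    ultimately have eq: "(m \<cdot> E) \<cdot> a' = m \<cdot> a" "(m \<cdot> E) \<cdot> b' = m \<cdot> b" using a' b' m by auto
    have "k \<in> Hom C X (Dom C f)" "m \<cdot> E \<in> Hom C Q' (Cod C z)" using m by auto
    then show "(\<exists>d \<in> Hom C X (Dom C z). z \<cdot> d = m \<cdot> a) \<longleftrightarrow> (\<exists>d \<in> Hom C X (Dom C z). z \<cdot> d = m \<cdot> b)"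
      unfolding eq[symmetric] using homotopic_iff[OF assms(1) _ Q' a' b' z] by blast
  qed auto
qed

lemma homotopic_inv_comp:
  assumes "homotopic (g \<cdot> f) (Ident C X)" "homotopic (g' \<cdot> f') (Ident C Y)"
    "f \<in> Hom C X Y" "g \<in> Hom C Y X" "f' \<in> Hom C Y Z" "g' \<in> Hom C Z Y"
  shows "homotopic ((g \<cdot> g') \<cdot> f' \<cdot> f) (Ident C X)"
proof -
  note [simp] = assms(3-6)[unfolded in_Hom]
  have "homotopic ((g' \<cdot> f') \<cdot> f) (Ident C Y \<cdot> f)" by (rule homotopic_precomp[OF assms(2)]) auto
  then have "homotopic (g \<cdot> (g' \<cdot> f') \<cdot> f) (g \<cdot> Ident C Y \<cdot> f)" by (rule homotopic_postcomp) auto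
  then have "homotopic ((g \<cdot> g') \<cdot> f' \<cdot> f) (g \<cdot> f)" by simp
  then show ?thesis using homotopic_trans assms(1) by blast
qed

section \<open>Homotopy equivalences and 2-out-of-6\<close>

lemma weqI:
  assumes "f \<in> Hom C X Y" "g \<in> Hom C Y X" "homotopic (g \<cdot> f) (Ident C X)" "homotopic (f \<cdot> g) (Ident C Y)"
  shows "f \<in> weq"
  using assms unfolding weq_def by auto

lemma weqE:
  assumes "f \<in> weq"
  obtains g where "f \<in> Arr C" "g \<in> Hom C (Cod C f) (Dom C f)" "homotopic (g \<cdot> f) (Ident C (Dom C f))"
    "homotopic (f \<cdot> g) (Ident C (Cod C f))"
  using assms unfolding weq_def by blast

lemma iso_weq: "is_iso C f \<Longrightarrow> f \<in> weq"
  by (erule isoE) (rule weqI[of f "Dom C f" "Cod C f"], auto simp: homotopic_refl)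

lemma weq_comp:
  assumes "f \<in> weq" "g \<in> weq" "Cod C f = Dom C g" shows "g \<cdot> f \<in> weq"
proof -
  obtain f' where f: "f \<in> Arr C" "f' \<in> Hom C (Cod C f) (Dom C f)" "homotopic (f' \<cdot> f) (Ident C (Dom C f))"
    "homotopic (f \<cdot> f') (Ident C (Cod C f))" using assms(1) by (rule weqE)
  obtain g' where g: "g \<in> Arr C" "g' \<in> Hom C (Cod C g) (Dom C g)" "homotopic (g' \<cdot> g) (Ident C (Dom C g))"
    "homotopic (g \<cdot> g') (Ident C (Cod C g))" using assms(2) by (rule weqE)
  have "homotopic ((f' \<cdot> g') \<cdot> g \<cdot> f) (Ident C (Dom C f))"
    using homotopic_inv_comp[OF f(3) g(3)[folded assms(3)], of "Cod C g"] f g assms(3) by simp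
  moreover have "homotopic ((g \<cdot> f) \<cdot> f' \<cdot> g') (Ident C (Cod C g))"
    using homotopic_inv_comp[OF g(4), of f f' "Cod C f"] f g assms(3) homotopic_inv_comp[OF g(4) f(4)[unfolded assms(3)], of "Dom C f"] by simp
  ultimately show ?thesis using f g assms(3) by (intro weqI[of _ "Dom C f" "Cod C g" "f' \<cdot> g'"]) auto
qed

text \<open>With \<open>u\<close> inverse to \<open>g f\<close> and \<open>v\<close> inverse to
  \<open>h g\<close>, evaluating \<open>v h g f u\<close> in two ways shows that \<open>v h\<close>
  and \<open>f u\<close> are homotopic. The map \<open>f u\<close> is then an inverse of
  \<open>g\<close>, while \<open>u g\<close> and \<open>g v\<close> are inverses of \<open>f\<close>
  and \<open>h\<close>.\<close>

lemma weq_2of6: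
  assumes f: "f \<in> Hom C A B" and g: "g \<in> Hom C B D" and h: "h \<in> Hom C D E"
    and gf: "g \<cdot> f \<in> weq" and hg: "h \<cdot> g \<in> weq"
  shows "f \<in> weq \<and> g \<in> weq \<and> h \<in> weq \<and> h \<cdot> g \<cdot> f \<in> weq"
proof -
  note [simp] = f[unfolded in_Hom] g[unfolded in_Hom] h[unfolded in_Hom]
  obtain u where u: "u \<in> Hom C D A" "homotopic (u \<cdot> g \<cdot> f) (Ident C A)" "homotopic (g \<cdot> f \<cdot> u) (Ident C D)"
    using gf by (rule weqE) auto
  obtain v where v: "v \<in> Hom C E B" "homotopic (v \<cdot> h \<cdot> g) (Ident C B)" "homotopic (h \<cdot> g \<cdot> v) (Ident C E)"
    using hg by (rule weqE) auto
  note [simp] = u(1)[unfolded in_Hom] v(1)[unfolded in_Hom]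
  have "homotopic ((v \<cdot> h) \<cdot> g \<cdot> f \<cdot> u) (v \<cdot> h)"
    using homotopic_postcomp[OF u(3), of "v \<cdot> h"] by simp
  moreover have "homotopic ((v \<cdot> h) \<cdot> g \<cdot> f \<cdot> u) (f \<cdot> u)"
    using homotopic_precomp[OF v(2), of "f \<cdot> u"] by simp
  ultimately have vf: "homotopic (v \<cdot> h) (f \<cdot> u)" using homotopic_trans homotopic_sym by blast
  have 1: "homotopic ((f \<cdot> u) \<cdot> g) (Ident C B)"
    using homotopic_trans[OF homotopic_sym[OF homotopic_precomp[OF vf, of g]]] v(2) by simp
  have g1: "g \<in> weq" using 1 u(3) by (intro weqI[of g B D "f \<cdot> u"]) auto
  have f1: "f \<in> weq" using 1 u(2) by (intro weqI[of f A B "u \<cdot> g"]) auto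
  have "homotopic (g \<cdot> v \<cdot> h) (g \<cdot> f \<cdot> u)" using homotopic_postcomp[OF vf, of g] by simp
  then have "homotopic (g \<cdot> v \<cdot> h) (Ident C D)" using homotopic_trans u(3) by blast
  then have h1: "h \<in> weq" using v(3) by (intro weqI[of h D E "g \<cdot> v"]) auto
  show ?thesis using f1 g1 h1 weq_comp[OF gf h1] by simp
qed

text \<open>The path picked out by \<open>\<sigma>\<close> generates all paths with its source, so a
  predicate that holds at it holds at every other such path. This is how based elimination produces
  Leibniz homotopies.\<close>

lemma based_elim_transport:
  assumes K: "based_elim s" and s: "s \<in> fib" and V: "is_pullback C s e u \<pi>"
    and \<sigma>: "\<sigma> \<in> Hom C X (Dom C u)" "\<pi> \<cdot> \<sigma> = Ident C X" and \<sigma>': "\<sigma>' \<in> Hom C X (Dom C u)"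
    and e: "Dom C e = X"
    and z: "z \<in> fib" and m: "m \<in> Hom C (Dom C u) (Cod C z)" and d: "\<exists>d \<in> Hom C X (Dom C z). z \<cdot> d = m \<cdot> \<sigma>"
  shows "\<exists>d \<in> Hom C X (Dom C z). z \<cdot> d = m \<cdot> \<sigma>'"
proof -
  note [simp] = pullbackD(1-4,6-8)[OF V] e
  note [simp] = \<sigma>(1)[unfolded in_Hom] \<sigma>'[unfolded in_Hom] m[unfolded in_Hom] fib_Arr[OF z]
  have "s \<cdot> u \<cdot> \<sigma> = e" using reassoc[OF pullbackD(9)[OF V], of \<sigma>] \<sigma>(2) pullbackD(5)[OF V] by simp
  then have "lifts \<sigma>"
    using K[unfolded based_elim_def, rule_format, of "u \<cdot> \<sigma>" u \<pi> \<sigma>] V \<sigma>(2) by simp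
  moreover obtain d where "d \<in> Hom C X (Dom C z)" "z \<cdot> d = m \<cdot> \<sigma>" using d by blast
  ultimately obtain j where j: "j \<in> Hom C (Dom C u) (Dom C z)" "z \<cdot> j = m"
    using liftsD[of \<sigma> z m d] z by auto
  then show ?thesis using reassoc[OF j(2), of \<sigma>'] by (intro bexI[of _ "j \<cdot> \<sigma>'"]) auto
qed

section \<open>Path objects and acyclic fibrations\<close>

lemma path_object_ex:
  assumes B: "B \<in> Obj C"
  shows "\<exists>P r st. is_path_object C weq fib B P r st"
proof -
  obtain T where T: "is_terminal C T" "\<And>X. X \<in> Obj C \<Longrightarrow> Hom C X T \<subseteq> fib" using terminal_ex by blast
  have "\<exists>!f. f \<in> Hom C B T" using T(1) B unfolding is_terminal_def by blast
  then obtain f where f: "f \<in> Hom C B T" by blast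
  then have "f \<in> fib" using T(2) B by blast
  then obtain s t r where P: "path_str f s t r" and K: "based_elim s" using fib_path_fibration unfolding path_fibration_def by blast
  obtain p1 p2 st where Pb: "is_pullback C f f p1 p2" "st \<in> fib" "Cod C st = Dom C p1" "s = p1 \<cdot> st" "t = p2 \<cdot> st"
    using P unfolding path_str_def by blast
  note Pf = path_strD[OF P] and [simp] = path_strD(2-10)[OF P] f[unfolded in_Hom] B
  note [simp] = pullbackD(3,4,6-8)[OF Pb(1)] fib_Arr[OF Pb(2)] Pb(3)
  have [simp]: "Dom C st = Dom C s" using Pb(4) by simp
  have "homotopic (r \<cdot> s) (Ident C (Dom C s))"
    unfolding homotopic_def leibniz_def
  proof (intro conjI allI impI)
    fix X k Q p q a b z m
    assume k: "k \<in> Hom C X (Dom C (r \<cdot> s))" and Q: "is_product C X (Cod C (r \<cdot> s)) Q p q"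
      and a: "a \<in> Hom C X Q" "p \<cdot> a = Ident C X" "q \<cdot> a = (r \<cdot> s) \<cdot> k"
      and b: "b \<in> Hom C X Q" "p \<cdot> b = Ident C X" "q \<cdot> b = Ident C (Dom C s) \<cdot> k"
      and z: "z \<in> fib" and m: "m \<in> Hom C Q (Cod C z)"
    have [simp]: "X \<in> Obj C" using a(1) by auto
    have [simp]: "k \<in> Arr C" "Dom C k = X" "Cod C k = Dom C s" using k by auto
    note [simp] = prodD[OF Q, unfolded in_Hom] m[unfolded in_Hom] a(1)[unfolded in_Hom] b(1)[unfolded in_Hom] fib_Arr[OF z]
    \<comment> \<open>The paths with the same source as \<open>k\<close>; both \<open>k\<close>
      itself (\<open>\<sigma>\<close>) and reflexivity at that source (\<open>\<tau>\<close>) occur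
      among them. Through \<open>\<mu>\<close> a predicate with parameters in \<open>X\<close>
      becomes one on these paths.\<close>
    obtain u \<pi> where V: "is_pullback C s (s \<cdot> k) u \<pi>" using fib_pullback_ex[OF Pf(14), of "s \<cdot> k"] by auto
    note [simp] = pullbackD(3,4,6,8)[OF V]
    have [simp]: "Cod C \<pi> = X" using pullbackD(7)[OF V] by simp
    obtain \<sigma> where \<sigma>: "\<sigma> \<in> Hom C X (Dom C u)" "u \<cdot> \<sigma> = k" "\<pi> \<cdot> \<sigma> = Ident C X"
      using pullback_lift[OF V, of k X "Ident C X"] by auto
    obtain \<tau> where \<tau>: "\<tau> \<in> Hom C X (Dom C u)" "u \<cdot> \<tau> = r \<cdot> s \<cdot> k" "\<pi> \<cdot> \<tau> = Ident C X"
      using pullback_lift[OF V, of "r \<cdot> s \<cdot> k" X "Ident C X"] reassoc[OF Pf(12), of "s \<cdot> k"] by auto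
    obtain \<mu> where \<mu>: "\<mu> \<in> Hom C (Dom C u) Q" "p \<cdot> \<mu> = \<pi>" "q \<cdot> \<mu> = u"
      using prod_lift[OF Q, of \<pi> "Dom C u" u] by auto
    note [simp] = \<mu>(1)[unfolded in_Hom] \<sigma>(1)[unfolded in_Hom] \<tau>(1)[unfolded in_Hom]
    have "\<mu> \<cdot> \<sigma> = b" using b \<sigma> reassoc[OF \<mu>(2), of \<sigma>] reassoc[OF \<mu>(3), of \<sigma>] by - (rule prod_eq[OF Q, of _ X]; simp)
    moreover have "\<mu> \<cdot> \<tau> = a" using a \<tau> reassoc[OF \<mu>(2), of \<tau>] reassoc[OF \<mu>(3), of \<tau>] by - (rule prod_eq[OF Q, of _ X]; simp)
    ultimately have e: "m \<cdot> a = (m \<cdot> \<mu>) \<cdot> \<tau>" "m \<cdot> b = (m \<cdot> \<mu>) \<cdot> \<sigma>" by auto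
    have m\<mu>: "m \<cdot> \<mu> \<in> Hom C (Dom C u) (Cod C z)" and D: "Dom C (s \<cdot> k) = X" by auto
    show "(\<exists>d \<in> Hom C X (Dom C z). z \<cdot> d = m \<cdot> a) \<longleftrightarrow> (\<exists>d \<in> Hom C X (Dom C z). z \<cdot> d = m \<cdot> b)"
      unfolding e using based_elim_transport[OF K Pf(14) V \<sigma>(1,3) \<tau>(1) D z m\<mu>] based_elim_transport[OF K Pf(14) V \<tau>(1,3) \<sigma>(1) D z m\<mu>] by blast
  qed auto
  then have "r \<in> weq"
    using Pf(12) by (intro weqI[of r B "Dom C s" s]) (auto simp: homotopic_refl)
  then have "is_path_object C weq fib B (Dom C s) r st"
    unfolding is_path_object_def
    using pullback_terminal_product[OF T(1) f f Pb(1)] Pb(2) Pf(12,13)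
      reassoc[OF Pb(4)[symmetric], of r] reassoc[OF Pb(5)[symmetric], of r]
    by (intro exI[of _ "Dom C p1"] exI[of _ p1] exI[of _ p2] exI[of _ "st \<cdot> r"]) auto
  then show ?thesis by blast
qed

text \<open>The instance of Leibniz equality without parameters: \<open>m\<close> is read on the
  product through its second projection.\<close>

lemma homotopic_lift:
  assumes "homotopic f g" "z \<in> fib" "m \<in> Hom C (Cod C f) (Cod C z)" "d \<in> Hom C (Dom C f) (Dom C z)" "z \<cdot> d = m \<cdot> f"
  shows "\<exists>d \<in> Hom C (Dom C f) (Dom C z). z \<cdot> d = m \<cdot> g"
proof -
  note [simp] = homotopic_type[OF assms(1)] assms(3,4)[unfolded in_Hom] fib_Arr[OF assms(2)]
  let ?X = "Dom C f"
  obtain Q p q where Q: "is_product C ?X (Cod C f) Q p q" using prod_ex[of ?X "Cod C f"] by auto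
  note [simp] = prodD[OF Q, unfolded in_Hom]
  obtain a where a: "a \<in> Hom C ?X Q" "p \<cdot> a = Ident C ?X" "q \<cdot> a = f \<cdot> Ident C ?X"
    using prod_lift[OF Q, of "Ident C ?X" ?X f] by auto
  obtain b where b: "b \<in> Hom C ?X Q" "p \<cdot> b = Ident C ?X" "q \<cdot> b = g \<cdot> Ident C ?X"
    using prod_lift[OF Q, of "Ident C ?X" ?X g] by auto
  have "Ident C ?X \<in> Hom C ?X ?X" "m \<cdot> q \<in> Hom C Q (Cod C z)" by auto
  then have "(\<exists>d \<in> Hom C ?X (Dom C z). z \<cdot> d = (m \<cdot> q) \<cdot> a) \<longleftrightarrow> (\<exists>d \<in> Hom C ?X (Dom C z). z \<cdot> d = (m \<cdot> q) \<cdot> b)"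
    using homotopic_iff[OF assms(1) _ Q a b assms(2)] by blast
  moreover have "(m \<cdot> q) \<cdot> a = m \<cdot> f" "(m \<cdot> q) \<cdot> b = m \<cdot> g" using a b by auto
  ultimately show ?thesis using assms(4,5) by auto
qed

lemma acyclic_section:
  assumes "f \<in> weq" "f \<in> fib"
  obtains s where "s \<in> Hom C (Cod C f) (Dom C f)" "f \<cdot> s = Ident C (Cod C f)"
proof -
  obtain g where g: "f \<in> Arr C" "g \<in> Hom C (Cod C f) (Dom C f)" "homotopic (f \<cdot> g) (Ident C (Cod C f))"
    using assms(1) by (rule weqE)
  then show thesis
    using homotopic_lift[OF g(3) assms(2), of "Ident C (Cod C f)" g] that by auto
qed

lemma acyclic_pullback:
  assumes W: "f \<in> weq" and F: "f \<in> fib" and Pb: "is_pullback C f g p q"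
  shows "q \<in> weq"
proof -
  obtain s where s: "s \<in> Hom C (Cod C f) (Dom C f)" "f \<cdot> s = Ident C (Cod C f)" using acyclic_section[OF W F] .
  obtain g' where g': "f \<in> Arr C" "g' \<in> Hom C (Cod C f) (Dom C f)" "homotopic (g' \<cdot> f) (Ident C (Dom C f))"
    using W by (rule weqE)
  note [simp] = s(1)[unfolded in_Hom] g'(1) g'(2)[unfolded in_Hom]
  \<comment> \<open>Precomposing the homotopy from \<open>g' f\<close> to the identity with
    \<open>s f\<close>, and using \<open>f s = 1\<close>, shows that the section may replace the
    given inverse.\<close>
  have "homotopic (g' \<cdot> f) (s \<cdot> f)"
    using homotopic_precomp[OF g'(3), of "s \<cdot> f"] reassoc[OF s(2), of f] by simp
  then have sf: "homotopic (s \<cdot> f) (Ident C (Dom C f))" using homotopic_trans[OF homotopic_sym] g'(3) by blast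
  obtain S T R where P: "path_str f S T R" and K: "based_elim S" using fib_path_fibration[OF F] unfolding path_fibration_def by blast
  obtain p1 p2 st where B: "is_pullback C f f p1 p2" "st \<in> fib" "Cod C st = Dom C p1" "S = p1 \<cdot> st" "T = p2 \<cdot> st"
    using P unfolding path_str_def by blast
  note Pf = path_strD[OF P] and [simp] = path_strD(2-10)[OF P]
  note [simp] = pullbackD(3,4,6-8)[OF B(1)] fib_Arr[OF B(2)] B(3) pullbackD(2-8)[OF Pb]
  have [simp]: "Dom C st = Dom C S" using B(4) by simp
  have fsf: "f \<cdot> s \<cdot> x = x" if "x \<in> Arr C" "Cod C x = Cod C f" for x using reassoc[OF s(2), of x] that by simp
  obtain n where n: "n \<in> Hom C (Dom C f) (Dom C p1)" "p1 \<cdot> n = s \<cdot> f" "p2 \<cdot> n = Ident C (Dom C f)"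
    using pullback_lift[OF B(1), of "s \<cdot> f" "Dom C f" "Ident C (Dom C f)"] fsf[of f] by auto
  note [simp] = n(1)[unfolded in_Hom]
  \<comment> \<open>The fibration tested is \<open>st\<close>, along \<open>n = (s f, 1)\<close>. At
    \<open>s f\<close> reflexivity is a lift, because \<open>s f s f = s f\<close>; hence there is a
    lift at the identity.\<close>
  have "st \<cdot> R \<cdot> s \<cdot> f = n \<cdot> s \<cdot> f"
    using reassoc[OF n(2), of "s \<cdot> f"] reassoc[OF n(3), of "s \<cdot> f"] fsf[of f]
      reassoc[OF B(4)[symmetric], of "R \<cdot> s \<cdot> f"] reassoc[OF B(5)[symmetric], of "R \<cdot> s \<cdot> f"]
      reassoc[OF Pf(12), of "s \<cdot> f"] reassoc[OF Pf(13), of "s \<cdot> f"]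
    by - (rule pullback_eq[OF B(1), of _ "Dom C f"]; simp)
  then obtain d where d: "d \<in> Hom C (Dom C f) (Dom C S)" "st \<cdot> d = n"
    using homotopic_lift[OF sf B(2), of n "R \<cdot> s \<cdot> f"] by auto
  note [simp] = d(1)[unfolded in_Hom]
  have Sd: "S \<cdot> d = s \<cdot> f" "T \<cdot> d = Ident C (Dom C f)"
    using reassoc[OF B(4)[symmetric], of d] reassoc[OF B(5)[symmetric], of d] d(2) n by auto
  have Pb': "f \<cdot> p = g \<cdot> q" using pullbackD(9)[OF Pb] .
  obtain s' where s': "s' \<in> Hom C (Dom C g) (Dom C p)" "p \<cdot> s' = s \<cdot> g" "q \<cdot> s' = Ident C (Dom C g)"
    using pullback_lift[OF Pb, of "s \<cdot> g" "Dom C g" "Ident C (Dom C g)"] fsf[of g] by auto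
  note [simp] = s'(1)[unfolded in_Hom]
  have "homotopic (s' \<cdot> q) (Ident C (Dom C p))"
    unfolding homotopic_def leibniz_def
  proof (intro conjI allI impI)
    fix X k Q p' q' a b z m
    assume k: "k \<in> Hom C X (Dom C (s' \<cdot> q))" and Q: "is_product C X (Cod C (s' \<cdot> q)) Q p' q'"
      and a: "a \<in> Hom C X Q" "p' \<cdot> a = Ident C X" "q' \<cdot> a = (s' \<cdot> q) \<cdot> k"
      and b: "b \<in> Hom C X Q" "p' \<cdot> b = Ident C X" "q' \<cdot> b = Ident C (Dom C p) \<cdot> k"
      and z: "z \<in> fib" and m: "m \<in> Hom C Q (Cod C z)"
    have [simp]: "X \<in> Obj C" using a(1) by auto
    have [simp]: "k \<in> Arr C" "Dom C k = X" "Cod C k = Dom C p" using k by auto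
    note [simp] = prodD[OF Q, unfolded in_Hom] m[unfolded in_Hom] a(1)[unfolded in_Hom] b(1)[unfolded in_Hom] fib_Arr[OF z]
    \<comment> \<open>The contraction \<open>d\<close> at \<open>p k\<close> is a path from
      \<open>p s' q k\<close> to \<open>p k\<close> in a fibre of \<open>f\<close>. Because the
      paths are fibrewise, their targets define a map \<open>\<nu>\<close> into the pullback whose
      component in \<open>Dom C g\<close> is \<open>q k\<close> throughout.\<close>
    define \<delta> where "\<delta> = d \<cdot> p \<cdot> k"
    have [simp]: "\<delta> \<in> Arr C" "Dom C \<delta> = X" "Cod C \<delta> = Dom C S" by (auto simp: \<delta>_def)
    have S\<delta>: "S \<cdot> \<delta> = p \<cdot> s' \<cdot> q \<cdot> k" and T\<delta>: "T \<cdot> \<delta> = p \<cdot> k"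
      unfolding \<delta>_def using reassoc[OF Sd(1), of "p \<cdot> k"] reassoc[OF Sd(2), of "p \<cdot> k"] reassoc[OF Pb', of k] reassoc[OF s'(2), of "q \<cdot> k"]
      by auto
    obtain u \<pi> where V: "is_pullback C S (S \<cdot> \<delta>) u \<pi>" using fib_pullback_ex[OF Pf(14), of "S \<cdot> \<delta>"] by auto
    note [simp] = pullbackD(3,4,6,8)[OF V]
    have [simp]: "Cod C \<pi> = X" using pullbackD(7)[OF V] by simp
    have Su: "S \<cdot> u = p \<cdot> s' \<cdot> q \<cdot> k \<cdot> \<pi>" using pullbackD(9)[OF V] unfolding S\<delta> by simp
    have qs: "q \<cdot> s' \<cdot> x = x" if "x \<in> Arr C" "Cod C x = Dom C g" for x using reassoc[OF s'(3), of x] that by simp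
    have "f \<cdot> T \<cdot> u = g \<cdot> q \<cdot> k \<cdot> \<pi>"
      using reassoc[OF Pf(11), of u] Su reassoc[OF Pb', of "s' \<cdot> q \<cdot> k \<cdot> \<pi>"] qs[of "q \<cdot> k \<cdot> \<pi>"] by simp
    then obtain \<nu> where \<nu>: "\<nu> \<in> Hom C (Dom C u) (Dom C p)" "p \<cdot> \<nu> = T \<cdot> u" "q \<cdot> \<nu> = q \<cdot> k \<cdot> \<pi>"
      using pullback_lift[OF Pb, of "T \<cdot> u" "Dom C u" "q \<cdot> k \<cdot> \<pi>"] by auto
    note [simp] = \<nu>(1)[unfolded in_Hom]
    obtain \<sigma> where \<sigma>: "\<sigma> \<in> Hom C X (Dom C u)" "u \<cdot> \<sigma> = \<delta>" "\<pi> \<cdot> \<sigma> = Ident C X"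
      using pullback_lift[OF V, of \<delta> X "Ident C X"] by auto
    obtain \<tau> where \<tau>: "\<tau> \<in> Hom C X (Dom C u)" "u \<cdot> \<tau> = R \<cdot> p \<cdot> s' \<cdot> q \<cdot> k" "\<pi> \<cdot> \<tau> = Ident C X"
      using pullback_lift[OF V, of "R \<cdot> p \<cdot> s' \<cdot> q \<cdot> k" X "Ident C X"] reassoc[OF Pf(12), of "p \<cdot> s' \<cdot> q \<cdot> k"] S\<delta> by auto
    obtain \<mu> where \<mu>: "\<mu> \<in> Hom C (Dom C u) Q" "p' \<cdot> \<mu> = \<pi>" "q' \<cdot> \<mu> = \<nu>"
      using prod_lift[OF Q, of \<pi> "Dom C u" \<nu>] by auto
    note [simp] = \<mu>(1)[unfolded in_Hom] \<sigma>(1)[unfolded in_Hom] \<tau>(1)[unfolded in_Hom]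
    have "\<nu> \<cdot> \<sigma> = k"
      using reassoc[OF \<nu>(2), of \<sigma>] reassoc[OF \<nu>(3), of \<sigma>] \<sigma>(2,3) T\<delta> by - (rule pullback_eq[OF Pb, of _ X]; simp)
    moreover have "\<nu> \<cdot> \<tau> = s' \<cdot> q \<cdot> k"
      using reassoc[OF \<nu>(2), of \<tau>] reassoc[OF \<nu>(3), of \<tau>] \<tau>(2,3) reassoc[OF Pf(13), of "p \<cdot> s' \<cdot> q \<cdot> k"] qs[of "q \<cdot> k"]
      by - (rule pullback_eq[OF Pb, of _ X]; simp)
    ultimately have "\<mu> \<cdot> \<sigma> = b" "\<mu> \<cdot> \<tau> = a"
      using a b \<sigma>(3) \<tau>(3) reassoc[OF \<mu>(2), of \<sigma>] reassoc[OF \<mu>(3), of \<sigma>] reassoc[OF \<mu>(2), of \<tau>] reassoc[OF \<mu>(3), of \<tau>]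
      by - (rule prod_eq[OF Q, of _ X]; simp)+
    then have e: "m \<cdot> a = (m \<cdot> \<mu>) \<cdot> \<tau>" "m \<cdot> b = (m \<cdot> \<mu>) \<cdot> \<sigma>" by auto
    have m\<mu>: "m \<cdot> \<mu> \<in> Hom C (Dom C u) (Cod C z)" and D: "Dom C (S \<cdot> \<delta>) = X" by auto
    show "(\<exists>d \<in> Hom C X (Dom C z). z \<cdot> d = m \<cdot> a) \<longleftrightarrow> (\<exists>d \<in> Hom C X (Dom C z). z \<cdot> d = m \<cdot> b)"
      unfolding e using based_elim_transport[OF K Pf(14) V \<sigma>(1,3) \<tau>(1) D z m\<mu>] based_elim_transport[OF K Pf(14) V \<tau>(1,3) \<sigma>(1) D z m\<mu>] by blast
  qed auto
  then show ?thesis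
    using s'(3) by (intro weqI[of q "Dom C p" "Dom C g" s']) (auto simp: homotopic_refl)
qed

theorem path_category: "path_category C weq fib"
proof
  show "weq \<subseteq> Arr C" unfolding weq_def by blast
  show "fib \<subseteq> Arr C" using fib_Arr by blast
  show "f \<in> fib" if "is_iso C f" for f using that by (rule fib.iso)
  show "g \<cdot> f \<in> fib" if "f \<in> fib" "g \<in> fib" "Cod C f = Dom C g" for f g using fib_comp that by blast
  show "\<exists>p q. is_pullback C f g p q" if "f \<in> fib" "g \<in> Arr C" "Cod C g = Cod C f" for f g
    using fib_pullback_ex[OF that] by blast
  show "q \<in> fib" if "f \<in> fib" "is_pullback C f g p q" for f g p q using fib_pullback that by blast
  show "\<exists>T. is_terminal C T \<and> (\<forall>X \<in> Obj C. Hom C X T \<subseteq> fib)" by (rule terminal_ex)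
  show "f \<in> weq" if "is_iso C f" for f using that by (rule iso_weq)
  show "f \<in> weq \<and> g \<in> weq \<and> h \<in> weq \<and> h \<cdot> g \<cdot> f \<in> weq"
    if "f \<in> Hom C A B" "g \<in> Hom C B D" "h \<in> Hom C D E" "g \<cdot> f \<in> weq" "h \<cdot> g \<in> weq" for f g h A B D E
    using weq_2of6[OF that] .
  show "\<exists>P r st. is_path_object C weq fib B P r st" if "B \<in> Obj C" for B using path_object_ex[OF that] .
  show "\<exists>s \<in> Hom C (Cod C f) (Dom C f). f \<cdot> s = Ident C (Cod C f)" if "f \<in> weq \<inter> fib" for f
    using acyclic_section[of f] that by blast
  show "\<exists>p q. is_pullback C f g p q" if "f \<in> weq \<inter> fib" "g \<in> Arr C" "Cod C g = Cod C f" for f g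
    using fib_pullback_ex[of f g] that by blast
  show "q \<in> weq \<inter> fib" if "f \<in> weq \<inter> fib" "is_pullback C f g p q" for f g p q
    using that acyclic_pullback fib_pullback by blast
qed

end

section \<open>Substitution calculus\<close>

lemma up_Var_comp: "up (Var \<circ> \<rho>) = Var \<circ> case_nat 0 (Suc \<circ> \<rho>)"
  by (rule ext) (simp add: up_def split: nat.split)

lemma rename_subst: "rename \<rho> e = subst (Var \<circ> \<rho>) e"
  by (induction e arbitrary: \<rho>) (simp_all add: up_Var_comp)

lemma rename_id [simp]: "rename (\<lambda>i. i) e = e"
proof (induction e)
  case (Bind e)
  have "case_nat 0 (Suc \<circ> (\<lambda>i. i)) = (\<lambda>i. i)" by (rule ext) (simp split: nat.split)
  then show ?case using Bind by simp
qed (simp_all add: map_idI)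

lemma rename_rename: "rename \<rho> (rename \<tau> e) = rename (\<rho> \<circ> \<tau>) e"
proof (induction e arbitrary: \<rho> \<tau>)
  case (Bind e)
  have "case_nat 0 (Suc \<circ> \<rho>) \<circ> case_nat 0 (Suc \<circ> \<tau>) = case_nat 0 (Suc \<circ> (\<rho> \<circ> \<tau>))"
    by (rule ext) (simp split: nat.split)
  then show ?case by (simp only: rename.simps Bind)
qed simp_all

lemma subst_rename: "subst \<sigma> (rename \<rho> e) = subst (\<sigma> \<circ> \<rho>) e"
proof (induction e arbitrary: \<rho> \<sigma>)
  case (Bind e)
  have "up \<sigma> \<circ> case_nat 0 (Suc \<circ> \<rho>) = up (\<sigma> \<circ> \<rho>)"
    by (rule ext) (simp add: up_def split: nat.split)
  then show ?case by (simp only: rename.simps subst.simps Bind)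
qed simp_all

lemma rename_of_subst: "rename \<rho> (subst \<sigma> e) = subst (rename \<rho> \<circ> \<sigma>) e"
proof (induction e arbitrary: \<rho> \<sigma>)
  case (Bind e)
  have "rename (case_nat 0 (Suc \<circ> \<rho>)) \<circ> up \<sigma> = up (rename \<rho> \<circ> \<sigma>)"
    by (rule ext) (simp add: up_def rename_rename comp_def split: nat.split)
  then show ?case by (simp only: rename.simps subst.simps Bind)
qed simp_all

lemma up_comp: "subst (up \<sigma>) \<circ> up \<tau> = up (subst \<sigma> \<circ> \<tau>)"
  by (rule ext) (simp add: up_def subst_rename rename_of_subst comp_def split: nat.split)

lemma subst_subst: "subst \<sigma> (subst \<tau> e) = subst (subst \<sigma> \<circ> \<tau>) e"
  by (induction e arbitrary: \<sigma> \<tau>) (simp_all add: up_comp)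

lemma up_Var [simp]: "up Var = Var"
  by (rule ext) (simp add: up_def split: nat.split)

lemma subst_Var [simp]: "subst Var e = e"
  by (induction e) (simp_all add: map_idI)

lemma ups_Var [simp]: "(up ^^ n) Var = Var"
  by (induction n) simp_all

lemma ups_Suc: "(up ^^ Suc n) \<sigma> = up ((up ^^ n) \<sigma>)"
  by simp

lemma ups_comp: "subst ((up ^^ n) \<sigma>) \<circ> (up ^^ n) \<tau> = (up ^^ n) (subst \<sigma> \<circ> \<tau>)"
proof (induction n)
  case (Suc n) then show ?case by (simp only: ups_Suc up_comp)
qed (simp add: comp_def)

lemma ups: "(up ^^ n) \<sigma> i = (if i < n then Var i else rename (\<lambda>j. j + n) (\<sigma> (i - n)))"
proof (induction n arbitrary: i)
  case 0 then show ?case by simp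
next
  case (Suc n)
  show ?case unfolding ups_Suc by (cases i) (auto simp: up_def Suc rename_rename comp_def)
qed

lemma inst_Var [simp]: "inst n Var e = e"
  by (simp add: inst_def)

lemma inst_Var_fun [simp]: "inst n Var = (\<lambda>e. e)"
  by (simp add: fun_eq_iff)

lemma inst_inst: "inst n \<sigma> (inst n \<tau> e) = inst n (subst \<sigma> \<circ> \<tau>) e"
  by (simp add: inst_def subst_subst ups_comp)

lemma inst_0 [simp]: "inst 0 \<sigma> = subst \<sigma>"
  by (simp add: inst_def fun_eq_iff)

lemma inst_add: "inst n ((up ^^ m) \<sigma>) e = inst (n + m) \<sigma> e"
  by (simp add: inst_def funpow_add)

lemma length_inst_ctx [simp]: "length (inst_ctx \<sigma> \<Delta>) = length \<Delta>"
  by (induction \<Delta>) simp_all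

lemma inst_ctx_Var [simp]: "inst_ctx Var \<Delta> = \<Delta>"
  by (induction \<Delta>) simp_all

lemma inst_ctx_inst_ctx: "inst_ctx \<sigma> (inst_ctx \<tau> \<Delta>) = inst_ctx (subst \<sigma> \<circ> \<tau>) \<Delta>"
  by (induction \<Delta>) (simp_all add: inst_inst comp_def)

lemma inst_ctx_append: "inst_ctx \<sigma> (\<Theta> @ \<Delta>) = inst_ctx ((up ^^ length \<Delta>) \<sigma>) \<Theta> @ inst_ctx \<sigma> \<Delta>"
  by (induction \<Theta>) (simp_all add: inst_add)

lemma nth_inst_ctx: "i < length \<Delta> \<Longrightarrow> inst_ctx \<sigma> \<Delta> ! i = inst (length \<Delta> - Suc i) \<sigma> (\<Delta> ! i)"
proof (induction \<Delta> arbitrary: i)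
  case (Cons A \<Delta>) then show ?case by (cases i) simp_all
qed simp

lemma drop_inst_ctx: "drop i (inst_ctx \<sigma> \<Delta>) = inst_ctx \<sigma> (drop i \<Delta>)"
proof (induction \<Delta> arbitrary: i)
  case (Cons A \<Delta>) then show ?case by (cases i) simp_all
qed simp

text \<open>Substitutions are total functions, and two that agree on a context usually differ beyond
  it; well-scopedness of derivable expressions makes this difference invisible.\<close>

lemma scoped_cong: "\<lbrakk>scoped n e; \<And>i. i < n \<Longrightarrow> \<sigma> i = \<tau> i\<rbrakk> \<Longrightarrow> subst \<sigma> e = subst \<tau> e"
proof (induction e arbitrary: n \<sigma> \<tau>)
  case (Con c es)
  have "subst \<sigma> x = subst \<tau> x" if "x \<in> set es" for x
    by (rule Con.IH[OF that, of n]) (use Con.prems that in \<open>auto simp: list_all_iff\<close>)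
  then show ?case by simp
next
  case (Bind e)
  have "up \<sigma> i = up \<tau> i" if "i < Suc n" for i
    using that Bind.prems(2) by (auto simp: up_def split: nat.split)
  then show ?case using Bind.IH[of "Suc n" "up \<sigma>" "up \<tau>"] Bind.prems(1) by simp
qed simp

lemma scoped_inst_cong:
  assumes "scoped (m + n) e" "\<And>i. i < n \<Longrightarrow> \<sigma> i = \<tau> i" shows "inst m \<sigma> e = inst m \<tau> e"
  unfolding inst_def by (rule scoped_cong[OF assms(1)]) (auto simp: ups assms(2))

lemma scoped_subst_Var: "\<lbrakk>scoped n e; \<And>i. i < n \<Longrightarrow> \<sigma> i = Var i\<rbrakk> \<Longrightarrow> subst \<sigma> e = e"
  using scoped_cong[of n e \<sigma> Var] by simp

primrec scoped_tel :: "nat \<Rightarrow> 'c ctx \<Rightarrow> bool" where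
  "scoped_tel n [] \<longleftrightarrow> True"
| "scoped_tel n (A # \<Delta>) \<longleftrightarrow> scoped (length \<Delta> + n) A \<and> scoped_tel n \<Delta>"

lemma inst_ctx_cong: "\<lbrakk>scoped_tel n \<Delta>; \<And>i. i < n \<Longrightarrow> \<sigma> i = \<tau> i\<rbrakk> \<Longrightarrow> inst_ctx \<sigma> \<Delta> = inst_ctx \<tau> \<Delta>"
proof (induction \<Delta>)
  case (Cons A \<Delta>)
  have "inst (length \<Delta>) \<sigma> A = inst (length \<Delta>) \<tau> A"
    using Cons.prems by (intro scoped_inst_cong[where n = n]) auto
  then show ?case using Cons by simp
qed simp

lemma sub_Nil: "sub k [] = (\<lambda>i. Var (i + k))"
  by (simp add: sub_def fun_eq_iff)

lemma sub_0_Nil [simp]: "sub 0 [] = Var"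
  by (simp add: sub_Nil fun_eq_iff)

lemma sub_nth [simp]: "i < length t \<Longrightarrow> sub k t i = t ! i"
  by (simp add: sub_def)

lemma weaken_weaken: "weaken k (weaken l e) = weaken (k + l) e"
  by (simp add: subst_subst sub_Nil comp_def add.commute add.left_commute)

lemma sub_inst: "length s = n \<Longrightarrow> subst (sub 0 s) (inst n \<tau> e) = subst (\<lambda>i. if i < n then s ! i else \<tau> (i - n)) e"
proof -
  assume "length s = n"
  then have "subst (sub 0 s) \<circ> (up ^^ n) \<tau> = (\<lambda>i. if i < n then s ! i else \<tau> (i - n))"
    by (auto simp: fun_eq_iff ups subst_rename sub_def comp_def)
  then show ?thesis by (simp add: inst_def subst_subst)
qed

lemma sub_append: "(\<lambda>i. if i < length s then s ! i else sub 0 t (i - length s)) = sub 0 (s @ t)"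
  by (auto simp: fun_eq_iff sub_def nth_append)

declare judgement.map_ident [simp]

lemma map_judgement_comp: "map_judgement f (map_judgement g J) = map_judgement (f \<circ> g) J"
  by (cases J) simp_all

lemma map_judgement_cong: "(\<And>e. e \<in> set_judgement J \<Longrightarrow> f e = g e) \<Longrightarrow> map_judgement f J = map_judgement g J"
  by (cases J) auto

abbreviation ids :: "nat \<Rightarrow> 'c expr list" where "ids n \<equiv> map Var [0..<n]"

abbreviation scomp :: "'c expr list \<Rightarrow> 'c expr list \<Rightarrow> 'c expr list" where
  "scomp u t \<equiv> map (subst (sub 0 t)) u"

lemma subst_scomp: "scoped (length u) e \<Longrightarrow> subst (sub 0 t) (subst (sub 0 u) e) = subst (sub 0 (scomp u t)) e"
  unfolding subst_subst by (rule scoped_cong) auto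

text \<open>The sequence of variables that represents the projection dropping the innermost entry of
  a context.\<close>

definition wk :: "nat \<Rightarrow> 'c expr list" where "wk n = map (weaken 1) (ids n)"

lemma length_wk [simp]: "length (wk n) = n"
  by (simp add: wk_def)

lemma nth_wk [simp]: "i < n \<Longrightarrow> wk n ! i = Var (Suc i)"
  by (simp add: wk_def sub_Nil)

lemma ids_Suc: "ids (Suc n) = Var 0 # wk n"
  by (rule nth_equalityI) (auto simp: nth_Cons' wk_def sub_Nil simp del: upt_Suc)

lemma subst_wk: "scoped n e \<Longrightarrow> subst (sub 0 (wk n)) e = weaken 1 e"
  by (rule scoped_cong) (auto simp: sub_Nil)

lemma subst_Cons_weaken: "subst (sub 0 (a # s)) (weaken (Suc 0) e) = subst (sub 0 s) e"
proof -
  have "subst (sub 0 (a # s)) \<circ> sub (Suc 0) [] = sub 0 s" by (auto simp: fun_eq_iff sub_def)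
  then show ?thesis by (simp only: subst_subst)
qed

lemma scomp_wk_Cons: "length s = n \<Longrightarrow> scomp (wk n) (a # s) = s"
  by (rule nth_equalityI) auto

lemma scomp_Cons_weaken: "scomp (map (weaken (Suc 0)) u) (a # s) = scomp u s"
  using subst_Cons_weaken by auto

text \<open>The map of extended contexts that is the identity on the \<open>n\<close> new innermost
  variables and \<open>t\<close> on the remaining ones: the upper edge in the pullback of a
  dependent projection along \<open>t\<close>.\<close>

definition lift_tms :: "nat \<Rightarrow> 'c expr list \<Rightarrow> 'c expr list" where
  "lift_tms n t = ids n @ map (weaken n) t"

lemma lift_tms_0 [simp]: "lift_tms 0 t = t"
  by (simp add: lift_tms_def map_idI)

lemma lift_tms_Suc: "lift_tms (Suc n) t = Var 0 # map (weaken 1) (lift_tms n t)"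
  unfolding lift_tms_def by (simp only: ids_Suc wk_def map_append append_Cons map_map comp_def weaken_weaken) simp

lemma sub_ext: "scoped (n + length t) e \<Longrightarrow> subst (sub 0 (lift_tms n t)) e = inst n (sub 0 t) e"
  unfolding inst_def by (rule scoped_cong) (auto simp: lift_tms_def ups nth_append rename_subst sub_Nil comp_def)

lemma inst_weaken: "inst n \<sigma> (weaken n e) = weaken n (subst \<sigma> e)"
proof -
  have "(up ^^ n) \<sigma> (i + n) = weaken n (\<sigma> i)" for i
    by (simp add: ups rename_subst sub_Nil comp_def)
  then have "subst ((up ^^ n) \<sigma>) \<circ> sub n [] = subst (sub n []) \<circ> \<sigma>"
    by (simp add: fun_eq_iff sub_def)
  then show ?thesis by (simp only: inst_def subst_subst)
qed

lemma inst_Con [simp]: "inst n \<sigma> (Con c es) = Con c (map (inst n \<sigma>) es)"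
  by (simp add: inst_def fun_eq_iff)

lemma inst_Var_less [simp]: "i < n \<Longrightarrow> inst n \<sigma> (Var i) = Var i"
  by (simp add: inst_def ups)

lemma subst_Binds: "subst \<sigma> ((Bind ^^ k) d) = (Bind ^^ k) (inst k \<sigma> d)"
proof (induction k arbitrary: \<sigma>)
  case (Suc k)
  have "inst k (up \<sigma>) d = inst (Suc k) \<sigma> d" using inst_add[of k 1 \<sigma> d] by simp
  then show ?case using Suc by simp
qed simp

text \<open>Stability of the eliminators under substitution holds already for raw expressions:
  \<open>d\<close> binds \<open>x\<close> and the variables of the parameter, and the parameter
  variables are passed back as arguments, which \<open>inst n\<close> leaves fixed.\<close>

lemma elim_tm_inst: "inst n \<sigma> (elim_tm c n as d) = elim_tm c n (map (subst \<sigma>) as) (inst (Suc n) \<sigma> d)"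
proof -
  have "map (inst n \<sigma>) (map Var (rev [0..<n])) = map Var (rev [0..<n])"
    by (rule map_idI) auto
  moreover have "inst n \<sigma> (weaken n ((Bind ^^ Suc n) d)) = weaken n ((Bind ^^ Suc n) (inst (Suc n) \<sigma> d))"
    by (subst inst_weaken, subst subst_Binds[of \<sigma>]) (rule refl)
  ultimately show ?thesis
    unfolding elim_tm_def by (simp add: inst_weaken comp_def del: funpow.simps)
qed

lemma id_ctx_inst: "inst_ctx \<sigma> (id_ctx c A) = id_ctx c (subst \<sigma> A)"
  using inst_weaken[of 2 \<sigma> A] inst_weaken[of 1 \<sigma> A] by (simp add: id_ctx_def numeral_2_eq_2)

lemma length_id_ctx [simp]: "length (id_ctx c A) = 3"
  by (simp add: id_ctx_def)

lemma weaken_ids: "map (weaken k) (ids n) = map Var [k..<k + n]"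
  by (rule nth_equalityI) (auto simp: sub_Nil add.commute)

section \<open>Simultaneous substitution and congruence\<close>

context type_theory
begin

abbreviation "wfc \<equiv> wf_ctx (\<turnstile>)"
abbreviation "cm \<equiv> ctx_mor (\<turnstile>)"
abbreviation "cr \<equiv> ctx_rel (\<turnstile>)"

lemma wf_Cons [simp]: "wfc (A # \<Gamma>) \<longleftrightarrow> \<Gamma> \<turnstile> IsType A \<and> wfc \<Gamma>"
  unfolding wf_ctx_def by (auto simp: less_Suc_eq_0_disj)

lemma wf_Nil [simp]: "wfc []"
  unfolding wf_ctx_def by simp

lemma wf_append: "wfc (\<Delta> @ \<Gamma>) \<Longrightarrow> wfc \<Gamma>"
  by (induction \<Delta>) auto

lemma wf_nth: "\<lbrakk>wfc \<Gamma>; i < length \<Gamma>\<rbrakk> \<Longrightarrow> drop (Suc i) \<Gamma> \<turnstile> IsType (\<Gamma> ! i)"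
  unfolding wf_ctx_def by blast

lemma wf_scoped_tel: "wfc (\<Theta> @ \<Gamma>) \<Longrightarrow> scoped_tel (length \<Gamma>) \<Theta>"
  by (induction \<Theta>) (auto dest: context_scoped)

lemma wf_scoped: "\<lbrakk>wfc \<Gamma>; i < length \<Gamma>\<rbrakk> \<Longrightarrow> scoped (length \<Gamma> - Suc i) (\<Gamma> ! i)"
  using context_scoped[OF wf_nth[of \<Gamma> i]] by simp

lemma scopedD:
  "\<Gamma> \<turnstile> IsType A \<Longrightarrow> scoped (length \<Gamma>) A"
  "\<Gamma> \<turnstile> HasType a A \<Longrightarrow> scoped (length \<Gamma>) a"
  "\<Gamma> \<turnstile> HasType a A \<Longrightarrow> scoped (length \<Gamma>) A"
  "\<Gamma> \<turnstile> EqType A B \<Longrightarrow> scoped (length \<Gamma>) B"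
  using context_scoped by fastforce+

lemma weaken_tel:
  "\<lbrakk>\<Gamma> @ \<Xi> \<turnstile> J; wfc (\<Delta> @ \<Xi>)\<rbrakk>
    \<Longrightarrow> inst_ctx (sub (length \<Delta>) []) \<Gamma> @ \<Delta> @ \<Xi> \<turnstile> map_judgement (inst (length \<Gamma>) (sub (length \<Delta>) [])) J"
proof (induction \<Delta>)
  case Nil
  then show ?case by simp
next
  case (Cons A \<Delta>)
  have e: "subst (sub (Suc 0) []) \<circ> sub (length \<Delta>) [] = sub (Suc (length \<Delta>)) []"
    by (simp add: sub_Nil fun_eq_iff)
  have "inst_ctx (sub 1 []) (inst_ctx (sub (length \<Delta>) []) \<Gamma>) @ A # \<Delta> @ \<Xi>
      \<turnstile> map_judgement (inst (length \<Gamma>) (sub 1 [])) (map_judgement (inst (length \<Gamma>) (sub (length \<Delta>) [])) J)"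
    using weakening[of "inst_ctx (sub (length \<Delta>) []) \<Gamma>" "\<Delta> @ \<Xi>" _ A] Cons by simp
  then show ?case by (simp add: map_judgement_comp inst_ctx_inst_ctx inst_inst comp_def e[unfolded comp_def])
qed

lemma multi_weaken:
  "\<lbrakk>\<Gamma> \<turnstile> J; wfc \<Delta>\<rbrakk> \<Longrightarrow> inst_ctx (sub (length \<Delta>) []) \<Gamma> @ \<Delta> \<turnstile> map_judgement (inst (length \<Gamma>) (sub (length \<Delta>) [])) J"
  using weaken_tel[of \<Gamma> "[]" J \<Delta>] by simp

lemma cm_Nil [simp]: "cm \<Delta> [] t \<longleftrightarrow> wfc \<Delta> \<and> t = []"
  unfolding ctx_mor_def by auto

lemma cm_Cons:
  "cm \<Delta> (A # \<Gamma>) t \<longleftrightarrow> (\<exists>a s. t = a # s \<and> cm \<Delta> \<Gamma> s \<and> \<Gamma> \<turnstile> IsType A \<and> \<Delta> \<turnstile> HasType a (subst (sub 0 s) A))"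
proof (cases t)
  case (Cons a s)
  have "(\<forall>i<Suc (length \<Gamma>). \<Delta> \<turnstile> HasType ((a # s) ! i) (subst (sub 0 (drop (Suc i) (a # s))) ((A # \<Gamma>) ! i))) \<longleftrightarrow>
    (\<Delta> \<turnstile> HasType a (subst (sub 0 s) A)) \<and> (\<forall>i<length \<Gamma>. \<Delta> \<turnstile> HasType (s ! i) (subst (sub 0 (drop (Suc i) s)) (\<Gamma> ! i)))"
    by (auto simp: less_Suc_eq_0_disj)
  then show ?thesis using Cons unfolding ctx_mor_def by auto
qed (auto simp: ctx_mor_def)

lemma cmD: "cm \<Delta> \<Gamma> t \<Longrightarrow> wfc \<Delta> \<and> wfc \<Gamma> \<and> length t = length \<Gamma>"
  unfolding ctx_mor_def by blast

lemma cm_drop: "cm \<Delta> \<Gamma> t \<Longrightarrow> cm \<Delta> (drop i \<Gamma>) (drop i t)"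
proof (induction \<Gamma> arbitrary: t i)
  case (Cons A \<Gamma>) then show ?case by (cases i) (auto simp: cm_Cons)
qed simp

text \<open>The innermost entry of \<open>\<Gamma>\<close> is moved into the telescope
  \<open>\<Theta>\<close>; the earlier entries are then substituted by induction and the last
  variable by the substitution rule. The base case weakens by \<open>\<Delta>\<close>, and for a
  telescope over the empty context this is the same as substituting.\<close>

lemma simultaneous_subst_under:
  "\<lbrakk>\<Theta> @ \<Gamma> \<turnstile> J; cm \<Delta> \<Gamma> t\<rbrakk> \<Longrightarrow> inst_ctx (sub 0 t) \<Theta> @ \<Delta> \<turnstile> map_judgement (inst (length \<Theta>) (sub 0 t)) J"
proof (induction \<Gamma> arbitrary: \<Theta> J t)
  case Nil
  have "scoped_tel 0 \<Theta>" using wf_scoped_tel[of \<Theta> "[]"] context_wf[OF Nil(1)] by simp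
  then have 1: "inst_ctx (sub (length \<Delta>) []) \<Theta> = inst_ctx (sub 0 t) \<Theta>" by (rule inst_ctx_cong) simp
  have "map_judgement (inst (length \<Theta>) (sub (length \<Delta>) [])) J = map_judgement (inst (length \<Theta>) (sub 0 t)) J"
    using context_scoped[OF Nil(1)] by (intro map_judgement_cong scoped_inst_cong[where n = 0]) auto
  then show ?case using multi_weaken[of \<Theta> J \<Delta>] Nil 1 by simp
next
  case (Cons A \<Gamma>)
  obtain a s where t: "t = a # s" "cm \<Delta> \<Gamma> s" "\<Delta> \<turnstile> HasType a (subst (sub 0 s) A)"
    using Cons.prems(2) unfolding cm_Cons by blast
  let ?\<sigma> = "up (sub 0 s)"
  have E: "inst (Suc (length \<Theta>)) (sub 0 s) = inst (length \<Theta>) ?\<sigma>"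
    using inst_add[of "length \<Theta>" 1 "sub 0 s"] by (simp add: fun_eq_iff)
  have "inst_ctx ?\<sigma> \<Theta> @ subst (sub 0 s) A # \<Delta> \<turnstile> map_judgement (inst (length \<Theta>) ?\<sigma>) J"
    using Cons.IH[of "\<Theta> @ [A]" J s] Cons.prems(1) t(2) by (simp add: inst_ctx_append E)
  note * = substitution[OF this t(3)]
  have e: "subst (sub 0 [a]) \<circ> ?\<sigma> = sub 0 t"
    by (auto simp: fun_eq_iff t(1) up_def subst_rename comp_def sub_def split: nat.split)
  show ?case using * by (simp add: inst_ctx_inst_ctx map_judgement_comp comp_def inst_inst e[unfolded comp_def])
qed

lemma simultaneous_subst: "\<lbrakk>\<Gamma> \<turnstile> J; cm \<Delta> \<Gamma> t\<rbrakk> \<Longrightarrow> \<Delta> \<turnstile> map_judgement (subst (sub 0 t)) J"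
  using simultaneous_subst_under[of "[]" \<Gamma> J \<Delta> t] by simp

lemma weaken1: "\<lbrakk>\<Gamma> \<turnstile> J; \<Gamma> \<turnstile> IsType A\<rbrakk> \<Longrightarrow> A # \<Gamma> \<turnstile> map_judgement (weaken 1) J"
  using weakening[of "[]" \<Gamma> J A] by simp

lemma var_type: "\<lbrakk>wfc \<Gamma>; i < length \<Gamma>\<rbrakk> \<Longrightarrow> \<Gamma> \<turnstile> HasType (Var i) (weaken (Suc i) (\<Gamma> ! i))"
proof (induction \<Gamma> arbitrary: i)
  case (Cons A \<Gamma>)
  then show ?case
  proof (cases i)
    case (Suc j)
    then have "A # \<Gamma> \<turnstile> map_judgement (weaken 1) (HasType (Var j) (weaken (Suc j) (\<Gamma> ! j)))"
      using Cons by (intro weaken1) auto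
    then show ?thesis using Suc by (simp add: weaken_weaken) (simp add: sub_Nil)
  qed (use variable in simp)
qed simp

lemma cm_weaken: "\<lbrakk>cm \<Delta> \<Gamma> t; \<Delta> \<turnstile> IsType A\<rbrakk> \<Longrightarrow> cm (A # \<Delta>) \<Gamma> (map (weaken 1) t)"
proof (induction \<Gamma> arbitrary: t)
  case (Cons B \<Gamma>)
  obtain a s where t: "t = a # s" "cm \<Delta> \<Gamma> s" "\<Gamma> \<turnstile> IsType B" "\<Delta> \<turnstile> HasType a (subst (sub 0 s) B)"
    using Cons.prems(1) unfolding cm_Cons by blast
  have "weaken 1 (subst (sub 0 s) B) = subst (sub 0 (map (weaken 1) s)) B"
    unfolding subst_subst using cmD[OF t(2)] by (intro scoped_cong[OF scopedD(1)[OF t(3)]]) auto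
  then show ?case using weaken1[OF t(4) Cons.prems(2)] Cons.IH[OF t(2) Cons.prems(2)] t by (simp add: cm_Cons)
qed (simp add: cmD)

lemma cm_ids: "wfc \<Gamma> \<Longrightarrow> cm \<Gamma> \<Gamma> (ids (length \<Gamma>))"
proof (induction \<Gamma>)
  case (Cons A \<Gamma>)
  have e: "ids (length (A # \<Gamma>)) = Var 0 # map (weaken 1) (ids (length \<Gamma>))"
    by (rule nth_equalityI) (auto simp: sub_Nil nth_Cons' simp del: upt_Suc)
  have A: "\<Gamma> \<turnstile> IsType A" and w: "wfc \<Gamma>" using Cons.prems by auto
  have "subst (sub 0 (map (weaken 1) (ids (length \<Gamma>)))) A = weaken 1 A"
    by (rule scoped_cong[OF scopedD(1)[OF A]]) (simp add: sub_Nil)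
  then show ?case unfolding e cm_Cons using variable[OF A] cm_weaken[OF Cons.IH[OF w] A] A by auto
qed simp

lemma sub_ids: "scoped n e \<Longrightarrow> subst (sub 0 (ids n)) e = e"
  by (rule scoped_subst_Var) auto

text \<open>Terms for the types of \<open>\<Theta>\<close>, a context over \<open>\<Delta>\<close>, while \<open>cm\<close> concerns closed contexts.\<close>

definition tel_section :: "'c ctx \<Rightarrow> 'c ctx \<Rightarrow> 'c expr list \<Rightarrow> bool" where
  "tel_section \<Delta> \<Theta> t \<longleftrightarrow> length t = length \<Theta> \<and>
     (\<forall>i < length \<Theta>. \<Delta> \<turnstile> HasType (t ! i) (subst (sub 0 (drop (Suc i) t)) (\<Theta> ! i)))"

lemma tel_section_Nil [simp]: "tel_section \<Delta> [] t \<longleftrightarrow> t = []"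
  unfolding tel_section_def by auto

lemma tel_section_Cons: "tel_section \<Delta> (A # \<Theta>) (a # t) \<longleftrightarrow> tel_section \<Delta> \<Theta> t \<and> \<Delta> \<turnstile> HasType a (subst (sub 0 t) A)"
  unfolding tel_section_def by (auto simp: less_Suc_eq_0_disj)

lemma tel_section_drop: "tel_section \<Delta> \<Theta> t \<Longrightarrow> tel_section \<Delta> (drop i \<Theta>) (drop i t)"
  unfolding tel_section_def by (auto simp: add.commute)

lemma tel_section_cm: "\<lbrakk>tel_section \<Delta> \<Theta> t; wfc (\<Theta> @ \<Delta>)\<rbrakk> \<Longrightarrow> cm \<Delta> (\<Theta> @ \<Delta>) (t @ ids (length \<Delta>))"
proof (induction \<Theta> arbitrary: t)
  case (Cons A \<Theta>)
  then obtain a s where t: "t = a # s" by (cases t) (auto simp: tel_section_def)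
  then have s: "tel_section \<Delta> \<Theta> s" "\<Delta> \<turnstile> HasType a (subst (sub 0 s) A)" using Cons.prems(1) tel_section_Cons by auto
  have A: "\<Theta> @ \<Delta> \<turnstile> IsType A" using Cons.prems(2) by simp
  have "length s = length \<Theta>" using s(1) unfolding tel_section_def by blast
  then have "subst (sub 0 s) A = subst (sub 0 (s @ ids (length \<Delta>))) A"
    by (intro scoped_cong[OF scopedD(1)[OF A]]) (auto simp: sub_def nth_append)
  then show ?case using Cons.IH[OF s(1)] Cons.prems(2) s(2) A by (simp add: cm_Cons t)
qed (simp add: cm_ids)

lemma tel_section_subst: 
  assumes "\<Theta> @ \<Delta> \<turnstile> J" "tel_section \<Delta> \<Theta> t"
  shows "\<Delta> \<turnstile> map_judgement (subst (sub 0 t)) J"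
proof -
  have "length t = length \<Theta>" using assms(2) unfolding tel_section_def by blast
  then have "map_judgement (subst (sub 0 (t @ ids (length \<Delta>)))) J = map_judgement (subst (sub 0 t)) J"
    using context_scoped[OF assms(1)]
    by (intro map_judgement_cong, intro scoped_cong) (auto simp: sub_def nth_append)
  then show ?thesis using simultaneous_subst[OF assms(1) tel_section_cm[OF assms(2) context_wf[OF assms(1)]]] by simp
qed

text \<open>
  The outermost variable is replaced first: the rest is then a telescope over \<open>\<Delta>\<close> again, and no
  context remains to be converted.
\<close>

lemma tel_section_cong:
  assumes "length \<Theta> = n" "tel_section \<Delta> \<Theta> t" "tel_section \<Delta> \<Theta> t'"
    "\<And>i. i < n \<Longrightarrow> \<Delta> \<turnstile> EqTerm (t ! i) (t' ! i) (subst (sub 0 (drop (Suc i) t)) (\<Theta> ! i))"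
    "\<Theta> @ \<Delta> \<turnstile> IsType B"
  shows "\<Delta> \<turnstile> EqType (subst (sub 0 t) B) (subst (sub 0 t') B) \<and>
    (\<forall>b. \<Theta> @ \<Delta> \<turnstile> HasType b B \<longrightarrow> \<Delta> \<turnstile> EqTerm (subst (sub 0 t) b) (subst (sub 0 t') b) (subst (sub 0 t) B))"
  using assms
proof (induction n arbitrary: \<Theta> t t' B)
  case 0
  then show ?case using type_refl[OF 0(5)] term_refl by auto
next
  case (Suc n)
  obtain \<Theta>1 A where \<Theta>: "\<Theta> = \<Theta>1 @ [A]" "length \<Theta>1 = n" using Suc.prems(1) by (metis append_butlast_last_id length_butlast diff_Suc_1 length_0_conv nat.distinct(1))
  have lt: "length t = Suc n" "length t' = Suc n" using Suc.prems unfolding tel_section_def by auto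
  obtain r a where t: "t = r @ [a]" "length r = n" using lt(1) by (metis append_butlast_last_id length_butlast diff_Suc_1 length_0_conv nat.distinct(1))
  obtain r' a' where t': "t' = r' @ [a']" "length r' = n" using lt(2) by (metis append_butlast_last_id length_butlast diff_Suc_1 length_0_conv nat.distinct(1))
  have wf1: "wfc (\<Theta>1 @ A # \<Delta>)" using context_wf[OF Suc.prems(5)] \<Theta> by simp
  have a: "\<Delta> \<turnstile> HasType a A" "\<Delta> \<turnstile> HasType a' A" "\<Delta> \<turnstile> EqTerm a a' A"
    using Suc.prems(2,3) Suc.prems(4)[of n] \<Theta> t t' unfolding tel_section_def by (auto simp: nth_append)
  have split: "subst (sub 0 s) (inst (length s) (sub 0 [c]) e) = subst (sub 0 (s @ [c])) e" for s c e
    by (simp add: sub_inst sub_append)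
  have step: "\<Delta> \<turnstile> EqType (subst (sub 0 (s @ [a])) K) (subst (sub 0 (s @ [a'])) K) \<and>
      (\<forall>b. \<Theta>' @ A # \<Delta> \<turnstile> HasType b K \<longrightarrow> \<Delta> \<turnstile> EqTerm (subst (sub 0 (s @ [a])) b) (subst (sub 0 (s @ [a'])) b) (subst (sub 0 (s @ [a])) K))"
    if K: "\<Theta>' @ A # \<Delta> \<turnstile> IsType K" and s: "tel_section \<Delta> (inst_ctx (sub 0 [a]) \<Theta>') s" for \<Theta>' s K
  proof -
    have l: "length \<Theta>' = length s" using s unfolding tel_section_def by simp
    show ?thesis
      using tel_section_subst[OF cong_type[OF K a] s] tel_section_subst[OF cong_term[OF _ a] s] by (auto simp: l split)
  qed
  let ?\<Theta>a = "\<lambda>c. inst_ctx (sub 0 [c]) \<Theta>1"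
  have types: "subst (sub 0 (drop (Suc i) x)) (?\<Theta>a c ! i) = subst (sub 0 (drop (Suc i) (x @ [c]))) (\<Theta> ! i)"
    if "i < n" "length x = n" for i c x
    using that split[of "drop (Suc i) x" c "\<Theta> ! i"] \<Theta> by (simp add: nth_inst_ctx nth_append)
  have section_init: "tel_section \<Delta> (?\<Theta>a c) x" if x: "tel_section \<Delta> \<Theta> (x @ [c])" "length x = n" for c x
    unfolding tel_section_def
  proof (intro conjI allI impI)
    fix i assume "i < length (?\<Theta>a c)"
    then have i: "i < n" using \<Theta> by simp
    then have "\<Delta> \<turnstile> HasType ((x @ [c]) ! i) (subst (sub 0 (drop (Suc i) (x @ [c]))) (\<Theta> ! i))"
      using x(1)[unfolded tel_section_def, THEN conjunct2, rule_format, of i] \<Theta> by simp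
    then show "\<Delta> \<turnstile> HasType (x ! i) (subst (sub 0 (drop (Suc i) x)) (?\<Theta>a c ! i))"
      using types[OF i x(2)] i x(2) by (simp add: nth_append)
  qed (use x \<Theta> in simp)
  have r: "tel_section \<Delta> (?\<Theta>a a) r" and r': "tel_section \<Delta> (?\<Theta>a a') r'"
    using section_init Suc.prems(2,3) t t' by auto
  have eq: "\<Delta> \<turnstile> EqType (subst (sub 0 (drop (Suc i) r)) (?\<Theta>a a ! i)) (subst (sub 0 (drop (Suc i) r)) (?\<Theta>a a' ! i))"
    if i: "i < n" for i
  proof -
    have "drop (Suc i) \<Theta>1 @ A # \<Delta> \<turnstile> IsType (\<Theta>1 ! i)"
      using wf_nth[OF wf1, of i] i \<Theta> by (simp add: nth_append)
    moreover have "tel_section \<Delta> (inst_ctx (sub 0 [a]) (drop (Suc i) \<Theta>1)) (drop (Suc i) r)"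
      using tel_section_drop[OF r, of "Suc i"] by (simp add: drop_inst_ctx)
    ultimately show ?thesis using step i \<Theta> t(2) types[OF i t(2)] by (simp add: nth_append)
  qed
  \<comment> \<open>\<open>r\<close> is a section of the telescope taken at \<open>a\<close>,
    whereas the induction hypothesis compares sections of the telescope taken at \<open>a'\<close>;
    the types of the entries are converted one by one.\<close>
  have r2: "tel_section \<Delta> (?\<Theta>a a') r"
    using r eq \<Theta>(2) term_conv unfolding tel_section_def by auto
  have eq2: "\<Delta> \<turnstile> EqTerm (r ! i) (r' ! i) (subst (sub 0 (drop (Suc i) r)) (?\<Theta>a a' ! i))" if i: "i < n" for i
    using Suc.prems(4)[of i] i t t' types[OF i t(2), of a] term_eq_conv[OF _ eq[OF i]] by (simp add: nth_append)
  have B: "\<Theta>1 @ A # \<Delta> \<turnstile> IsType B" using Suc.prems(5) \<Theta> by simp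
  have B': "?\<Theta>a a' @ \<Delta> \<turnstile> IsType (inst n (sub 0 [a']) B)" using substitution[OF B a(2)] \<Theta> by simp
  have b': "?\<Theta>a a' @ \<Delta> \<turnstile> HasType (inst n (sub 0 [a']) b) (inst n (sub 0 [a']) B)" if "\<Theta>1 @ A # \<Delta> \<turnstile> HasType b B" for b
    using substitution[OF that a(2)] \<Theta> by simp
  have lq: "length (?\<Theta>a a') = n" using \<Theta> by simp
  note IH = Suc.IH[OF lq r2 r' eq2 B']
  have 1: "\<Delta> \<turnstile> EqType (subst (sub 0 t) B) (subst (sub 0 (r @ [a'])) B)" using step[OF B r] t by blast
  have 2: "\<Delta> \<turnstile> EqType (subst (sub 0 (r @ [a'])) B) (subst (sub 0 t') B)"
    using IH split[of r a'] split[of r' a'] t t' \<Theta> by simp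
  show ?case
  proof (intro conjI allI impI)
    show "\<Delta> \<turnstile> EqType (subst (sub 0 t) B) (subst (sub 0 t') B)" using type_trans[OF 1 2] .
    fix b assume "\<Theta> @ \<Delta> \<turnstile> HasType b B"
    then have b: "\<Theta>1 @ A # \<Delta> \<turnstile> HasType b B" using \<Theta> by simp
    have "\<Delta> \<turnstile> EqTerm (subst (sub 0 (r @ [a'])) b) (subst (sub 0 t') b) (subst (sub 0 (r @ [a'])) B)"
      using IH[THEN conjunct2, rule_format, OF _ b'[OF b]] split[of r a'] split[of r' a'] t t' \<Theta> by simp
    then show "\<Delta> \<turnstile> EqTerm (subst (sub 0 t) b) (subst (sub 0 t') b) (subst (sub 0 t) B)"
      using step[OF B r] b t term_trans term_eq_conv type_sym[OF 1] by blast
  qed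
qed

text \<open>The types are formed with the first sequence, so symmetry and transitivity involve a
  conversion of types.\<close>

definition eqs :: "'c ctx \<Rightarrow> 'c ctx \<Rightarrow> 'c expr list \<Rightarrow> 'c expr list \<Rightarrow> bool" where
  "eqs \<Delta> \<Gamma> t t' \<longleftrightarrow> (\<forall>i < length \<Gamma>. \<Delta> \<turnstile> EqTerm (t ! i) (t' ! i) (subst (sub 0 (drop (Suc i) t)) (\<Gamma> ! i)))"

text \<open>The context \<open>\<Gamma>\<close> is weakened to a telescope over
  \<open>\<Delta>\<close>, where the congruence for sections applies; after the terms are
  substituted, the weakening leaves no trace.\<close>

lemma simultaneous_cong:
  assumes "cm \<Delta> \<Gamma> t" "cm \<Delta> \<Gamma> t'" "eqs \<Delta> \<Gamma> t t'" "\<Gamma> \<turnstile> IsType B"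
  shows "\<Delta> \<turnstile> EqType (subst (sub 0 t) B) (subst (sub 0 t') B)"
    and "\<Gamma> \<turnstile> HasType b B \<Longrightarrow> \<Delta> \<turnstile> EqTerm (subst (sub 0 t) b) (subst (sub 0 t') b) (subst (sub 0 t) B)"
proof -
  note w = cmD[OF assms(1)] cmD[OF assms(2)]
  let ?\<sigma> = "sub (length \<Delta>) []"
  let ?\<Theta> = "inst_ctx ?\<sigma> \<Gamma>"
  have E: "subst (sub 0 s) (inst (length s) ?\<sigma> e) = subst (sub 0 s) e" if "scoped (length s) e" for s e
    unfolding sub_inst[OF refl] using that by (rule scoped_cong) simp
  have T: "subst (sub 0 (drop (Suc i) x)) (?\<Theta> ! i) = subst (sub 0 (drop (Suc i) x)) (\<Gamma> ! i)"
    if "length x = length \<Gamma>" "i < length \<Gamma>" for i x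
    using E[of "drop (Suc i) x" "\<Gamma> ! i"] that wf_scoped[of \<Gamma> i] w by (simp add: nth_inst_ctx)
  have s: "tel_section \<Delta> ?\<Theta> t" "tel_section \<Delta> ?\<Theta> t'" using assms(1,2) T unfolding tel_section_def ctx_mor_def by auto
  have e: "\<Delta> \<turnstile> EqTerm (t ! i) (t' ! i) (subst (sub 0 (drop (Suc i) t)) (?\<Theta> ! i))" if "i < length \<Gamma>" for i
    using assms(3) that T w unfolding eqs_def by simp
  have B: "?\<Theta> @ \<Delta> \<turnstile> IsType (inst (length \<Gamma>) ?\<sigma> B)" using multi_weaken[OF assms(4)] w by simp
  note C = tel_section_cong[OF length_inst_ctx s e B]
  have EB: "subst (sub 0 x) (inst (length \<Gamma>) ?\<sigma> e) = subst (sub 0 x) e"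
    if "length x = length \<Gamma>" "scoped (length \<Gamma>) e" for x e using E[of x e] that by simp
  show "\<Delta> \<turnstile> EqType (subst (sub 0 t) B) (subst (sub 0 t') B)"
    using conjunct1[OF C] EB[of t B] EB[of t' B] scopedD(1)[OF assms(4)] w by simp
  assume b: "\<Gamma> \<turnstile> HasType b B"
  show "\<Delta> \<turnstile> EqTerm (subst (sub 0 t) b) (subst (sub 0 t') b) (subst (sub 0 t) B)"
    using conjunct2[OF C, rule_format, of "inst (length \<Gamma>) ?\<sigma> b"] multi_weaken[OF b, of \<Delta>] EB[of t B] EB[of t b] EB[of t' b] scopedD(1)[OF assms(4)] scopedD(2)[OF b] w
    by simp
qed

section \<open>The classifying category\<close>

lemma cr_Nil [simp]: "([], \<Gamma>') \<in> cr \<longleftrightarrow> \<Gamma>' = []"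
  unfolding ctx_rel_def by auto

lemma cr_Cons:
  "(A # \<Gamma>, \<Gamma>'') \<in> cr \<longleftrightarrow> (\<exists>A' \<Gamma>'. \<Gamma>'' = A' # \<Gamma>' \<and> (\<Gamma>, \<Gamma>') \<in> cr \<and> \<Gamma> \<turnstile> IsType A \<and> \<Gamma>' \<turnstile> IsType A' \<and> \<Gamma> \<turnstile> EqType A A')"
proof (cases \<Gamma>'')
  case (Cons A' \<Gamma>')
  have "(\<forall>i<Suc (length \<Gamma>). drop (Suc i) (A # \<Gamma>) \<turnstile> EqType ((A # \<Gamma>) ! i) ((A' # \<Gamma>') ! i)) \<longleftrightarrow>
    \<Gamma> \<turnstile> EqType A A' \<and> (\<forall>i<length \<Gamma>. drop (Suc i) \<Gamma> \<turnstile> EqType (\<Gamma> ! i) (\<Gamma>' ! i))"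
    by (auto simp: less_Suc_eq_0_disj)
  then show ?thesis using Cons unfolding ctx_rel_def by auto
qed (auto simp: ctx_rel_def)

lemma crD: "(\<Gamma>, \<Gamma>') \<in> cr \<Longrightarrow> wfc \<Gamma> \<and> wfc \<Gamma>' \<and> length \<Gamma>' = length \<Gamma>"
  unfolding ctx_rel_def by auto

text \<open>The identity sequence is a morphism from \<open>\<Gamma>'\<close> to
  \<open>\<Gamma>\<close> and acts as the identity on expressions in scope, so conversion of
  contexts is an instance of simultaneous substitution. The two claims need each other in the
  induction on the context.\<close>

lemma cr_conversion: "(\<Gamma>, \<Gamma>') \<in> cr \<Longrightarrow> (\<forall>J. \<Gamma> \<turnstile> J \<longrightarrow> \<Gamma>' \<turnstile> J) \<and> cm \<Gamma>' \<Gamma> (ids (length \<Gamma>))"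
proof (induction \<Gamma> arbitrary: \<Gamma>')
  case (Cons A \<Gamma>)
  obtain A' \<Gamma>1 where G: "\<Gamma>' = A' # \<Gamma>1" "(\<Gamma>, \<Gamma>1) \<in> cr" "\<Gamma> \<turnstile> IsType A" "\<Gamma>1 \<turnstile> IsType A'" "\<Gamma> \<turnstile> EqType A A'"
    using Cons.prems cr_Cons by blast
  have e: "ids (length (A # \<Gamma>)) = Var 0 # map (weaken 1) (ids (length \<Gamma>))"
    by (rule nth_equalityI) (auto simp: sub_Nil nth_Cons' simp del: upt_Suc)
  have A: "subst (sub 0 (map (weaken 1) (ids (length \<Gamma>)))) A = weaken 1 A"
    by (rule scoped_cong[OF scopedD(1)[OF G(3)]]) (simp add: sub_Nil)
  have "\<Gamma>1 \<turnstile> EqType A' A" using Cons.IH[OF G(2)] G(5) type_sym by blast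
  then have "\<Gamma>' \<turnstile> EqType (weaken 1 A') (weaken 1 A)" using weaken1[of \<Gamma>1 "EqType A' A" A'] G by simp
  then have "\<Gamma>' \<turnstile> HasType (Var 0) (weaken 1 A)" using term_conv variable[OF G(4)] G(1) by blast
  then have c: "cm \<Gamma>' (A # \<Gamma>) (ids (length (A # \<Gamma>)))"
    unfolding e cm_Cons using cm_weaken[of \<Gamma>1 \<Gamma> "ids (length \<Gamma>)" A'] Cons.IH[OF G(2)] G A by (auto simp del: map_map)
  have "\<Gamma>' \<turnstile> J" if J: "A # \<Gamma> \<turnstile> J" for J
  proof -
    have "map_judgement (subst (sub 0 (ids (length (A # \<Gamma>))))) J = map_judgement (\<lambda>e. e) J"
      using context_scoped[OF J] by (intro map_judgement_cong sub_ids)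
    then show ?thesis using simultaneous_subst[OF J c] by simp
  qed
  then show ?case using c by blast
qed simp

lemma ctx_conversion: "\<lbrakk>(\<Gamma>, \<Gamma>') \<in> cr; \<Gamma> \<turnstile> J\<rbrakk> \<Longrightarrow> \<Gamma>' \<turnstile> J"
  using cr_conversion by blast

lemma cr_refl: "wfc \<Gamma> \<Longrightarrow> (\<Gamma>, \<Gamma>) \<in> cr"
  by (induction \<Gamma>) (auto simp: cr_Cons type_refl)

lemma cr_sym: "(\<Gamma>, \<Gamma>') \<in> cr \<Longrightarrow> (\<Gamma>', \<Gamma>) \<in> cr"
proof (induction \<Gamma> arbitrary: \<Gamma>')
  case (Cons A \<Gamma>) then show ?case using ctx_conversion type_sym by (fastforce simp: cr_Cons)
qed simp

lemma cr_trans: "\<lbrakk>(\<Gamma>, \<Gamma>') \<in> cr; (\<Gamma>', \<Gamma>'') \<in> cr\<rbrakk> \<Longrightarrow> (\<Gamma>, \<Gamma>'') \<in> cr"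
proof (induction \<Gamma> arbitrary: \<Gamma>' \<Gamma>'')
  case (Cons A \<Gamma>)
  obtain A1 \<Gamma>1 where 1: "\<Gamma>' = A1 # \<Gamma>1" "(\<Gamma>, \<Gamma>1) \<in> cr" "\<Gamma> \<turnstile> IsType A" "\<Gamma> \<turnstile> EqType A A1"
    using Cons.prems(1) cr_Cons by blast
  obtain A2 \<Gamma>2 where 2: "\<Gamma>'' = A2 # \<Gamma>2" "(\<Gamma>1, \<Gamma>2) \<in> cr" "\<Gamma>2 \<turnstile> IsType A2" "\<Gamma>1 \<turnstile> EqType A1 A2"
    using Cons.prems(2) 1 cr_Cons by blast
  show ?case using Cons.IH 1 2 ctx_conversion[OF cr_sym[OF 1(2)] 2(4)] type_trans by (auto simp: cr_Cons)
qed simp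

lemma cr_equiv: "equiv {\<Gamma>. wfc \<Gamma>} cr"
  by (rule equivI) (auto simp: refl_on_def sym_def trans_def cr_refl dest: cr_sym crD intro: cr_trans)

lemma eqs_Cons: "eqs \<Delta> (A # \<Gamma>) (a # s) (b # s') \<longleftrightarrow> \<Delta> \<turnstile> EqTerm a b (subst (sub 0 s) A) \<and> eqs \<Delta> \<Gamma> s s'"
  unfolding eqs_def by (auto simp: less_Suc_eq_0_disj)

lemma cm_Cons_iff [simp]: "cm \<Delta> (A # \<Gamma>) (a # s) \<longleftrightarrow> cm \<Delta> \<Gamma> s \<and> \<Gamma> \<turnstile> IsType A \<and> \<Delta> \<turnstile> HasType a (subst (sub 0 s) A)"
  by (simp add: cm_Cons)

lemma cm_conv:
  assumes "cm \<Delta> \<Gamma> t" "(\<Delta>, \<Delta>') \<in> cr" "(\<Gamma>, \<Gamma>') \<in> cr" shows "cm \<Delta>' \<Gamma>' t"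
  using assms(1,3)
proof (induction \<Gamma> arbitrary: t \<Gamma>')
  case Nil then show ?case using crD[OF assms(2)] by simp
next
  case (Cons A \<Gamma>)
  obtain a s where t: "t = a # s" "cm \<Delta> \<Gamma> s" "\<Delta> \<turnstile> HasType a (subst (sub 0 s) A)" using Cons.prems(1) cm_Cons by blast
  obtain A1 \<Gamma>1 where G: "\<Gamma>' = A1 # \<Gamma>1" "(\<Gamma>, \<Gamma>1) \<in> cr" "\<Gamma>1 \<turnstile> IsType A1" "\<Gamma> \<turnstile> EqType A A1"
    using Cons.prems(2) cr_Cons by blast
  have "\<Delta> \<turnstile> HasType a (subst (sub 0 s) A1)" using term_conv[OF t(3)] simultaneous_subst[OF G(4) t(2)] by simp
  then show ?case using Cons.IH[OF t(2) G(2)] t G ctx_conversion[OF assms(2)] by auto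
qed

lemma eqs_refl: "cm \<Delta> \<Gamma> t \<Longrightarrow> eqs \<Delta> \<Gamma> t t"
  unfolding eqs_def ctx_mor_def using term_refl by blast

lemma eqs_conv:
  assumes "cm \<Delta> \<Gamma> t" "eqs \<Delta> \<Gamma> t t'" "(\<Delta>, \<Delta>') \<in> cr" "(\<Gamma>, \<Gamma>') \<in> cr" shows "eqs \<Delta>' \<Gamma>' t t'"
  unfolding eqs_def
proof (intro allI impI)
  fix i assume "i < length \<Gamma>'"
  then have i: "i < length \<Gamma>" using crD[OF assms(4)] by simp
  have "drop (Suc i) \<Gamma> \<turnstile> EqType (\<Gamma> ! i) (\<Gamma>' ! i)" using assms(4) i unfolding ctx_rel_def by blast
  from simultaneous_subst[OF this cm_drop[OF assms(1)]] assms(2) i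
  have "\<Delta> \<turnstile> EqTerm (t ! i) (t' ! i) (subst (sub 0 (drop (Suc i) t)) (\<Gamma>' ! i))"
    unfolding eqs_def using term_eq_conv by auto
  then show "\<Delta>' \<turnstile> EqTerm (t ! i) (t' ! i) (subst (sub 0 (drop (Suc i) t)) (\<Gamma>' ! i))" using ctx_conversion[OF assms(3)] by blast
qed

lemma eqs_drop: "eqs \<Delta> \<Gamma> t t' \<Longrightarrow> length t = length \<Gamma> \<Longrightarrow> length t' = length \<Gamma> \<Longrightarrow> eqs \<Delta> (drop i \<Gamma>) (drop i t) (drop i t')"
  unfolding eqs_def by (auto simp: add.commute)

lemma eqs_types:
  assumes "cm \<Delta> \<Gamma> t" "cm \<Delta> \<Gamma> t'" "eqs \<Delta> \<Gamma> t t'" "i < length \<Gamma>"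
  shows "\<Delta> \<turnstile> EqType (subst (sub 0 (drop (Suc i) t)) (\<Gamma> ! i)) (subst (sub 0 (drop (Suc i) t')) (\<Gamma> ! i))"
  using simultaneous_cong(1)[OF cm_drop[OF assms(1)] cm_drop[OF assms(2)] eqs_drop[OF assms(3)] wf_nth] assms cmD by blast

lemma eqs_sym: "\<lbrakk>cm \<Delta> \<Gamma> t; cm \<Delta> \<Gamma> t'; eqs \<Delta> \<Gamma> t t'\<rbrakk> \<Longrightarrow> eqs \<Delta> \<Gamma> t' t"
  using eqs_types term_sym term_eq_conv unfolding eqs_def by blast

lemma eqs_trans:
  "\<lbrakk>cm \<Delta> \<Gamma> t; cm \<Delta> \<Gamma> t'; eqs \<Delta> \<Gamma> t t'; eqs \<Delta> \<Gamma> t' t''\<rbrakk> \<Longrightarrow> eqs \<Delta> \<Gamma> t t''"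
  using type_sym[OF eqs_types] term_trans term_eq_conv unfolding eqs_def by meson

lemma mor_rel_iff: "((\<Delta>, \<Gamma>, t), (\<Delta>', \<Gamma>', t')) \<in> mor_rel (\<turnstile>) \<longleftrightarrow>
    cm \<Delta> \<Gamma> t \<and> cm \<Delta>' \<Gamma>' t' \<and> (\<Delta>, \<Delta>') \<in> cr \<and> (\<Gamma>, \<Gamma>') \<in> cr \<and> eqs \<Delta> \<Gamma> t t'"
  unfolding mor_rel_def eqs_def by auto

lemma mor_equiv: "equiv {(\<Delta>, \<Gamma>, t). cm \<Delta> \<Gamma> t} (mor_rel (\<turnstile>))"
proof (rule equivI)
  show "mor_rel (\<turnstile>) \<subseteq> {(\<Delta>, \<Gamma>, t). cm \<Delta> \<Gamma> t} \<times> {(\<Delta>, \<Gamma>, t). cm \<Delta> \<Gamma> t}"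
    unfolding mor_rel_def by auto
  show "refl_on {(\<Delta>, \<Gamma>, t). cm \<Delta> \<Gamma> t} (mor_rel (\<turnstile>))"
    unfolding refl_on_def using cr_refl eqs_refl cmD by (auto simp: mor_rel_iff)
  show "sym (mor_rel (\<turnstile>))"
    unfolding sym_def
  proof (clarsimp simp: mor_rel_iff)
    fix \<Delta> \<Gamma> t \<Delta>' \<Gamma>' t'
    assume a: "cm \<Delta> \<Gamma> t" "cm \<Delta>' \<Gamma>' t'" "(\<Delta>, \<Delta>') \<in> cr" "(\<Gamma>, \<Gamma>') \<in> cr" "eqs \<Delta> \<Gamma> t t'"
    have t': "cm \<Delta> \<Gamma> t'" using cm_conv[OF a(2) cr_sym[OF a(3)] cr_sym[OF a(4)]] .
    show "(\<Delta>', \<Delta>) \<in> cr \<and> (\<Gamma>', \<Gamma>) \<in> cr \<and> eqs \<Delta>' \<Gamma>' t' t"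
      using cr_sym a eqs_conv[OF t' eqs_sym[OF a(1) t' a(5)] a(3,4)] by blast
  qed
  show "trans (mor_rel (\<turnstile>))"
    unfolding trans_def
  proof (clarsimp simp: mor_rel_iff)
    fix \<Delta> \<Gamma> t \<Delta>' \<Gamma>' t' \<Delta>'' \<Gamma>'' t''
    assume a: "cm \<Delta> \<Gamma> t" "cm \<Delta>' \<Gamma>' t'" "(\<Delta>, \<Delta>') \<in> cr" "(\<Gamma>, \<Gamma>') \<in> cr" "eqs \<Delta> \<Gamma> t t'"
      and b: "(\<Delta>', \<Delta>'') \<in> cr" "(\<Gamma>', \<Gamma>'') \<in> cr" "eqs \<Delta>' \<Gamma>' t' t''"
    have t': "cm \<Delta> \<Gamma> t'" using cm_conv[OF a(2) cr_sym[OF a(3)] cr_sym[OF a(4)]] .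
    show "(\<Delta>, \<Delta>'') \<in> cr \<and> (\<Gamma>, \<Gamma>'') \<in> cr \<and> eqs \<Delta> \<Gamma> t t''"
      using cr_trans a b eqs_trans[OF a(1) t' a(5)] eqs_conv[OF a(2) b(3) cr_sym[OF a(3)] cr_sym[OF a(4)]] by blast
  qed
qed

lemma cm_comp:
  assumes "cm \<Delta> \<Gamma> t" "cm \<Gamma> \<Theta> u" shows "cm \<Delta> \<Theta> (scomp u t)"
  using assms(2)
proof (induction \<Theta> arbitrary: u)
  case Nil then show ?case using cmD[OF assms(1)] by simp
next
  case (Cons A \<Theta>)
  obtain a s where u: "u = a # s" "cm \<Gamma> \<Theta> s" "\<Theta> \<turnstile> IsType A" "\<Gamma> \<turnstile> HasType a (subst (sub 0 s) A)"
    using Cons.prems cm_Cons by blast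
  then show ?case
    using Cons.IH[OF u(2)] simultaneous_subst[OF u(4) assms(1)] subst_scomp[of s A t] scopedD(1)[OF u(3)] cmD[OF u(2)] by simp
qed

text \<open>Through the intermediate sequence \<open>scomp u' t\<close>: the equalities between
  \<open>u\<close> and \<open>u'\<close> are substituted along \<open>t\<close>, and the fixed terms
  \<open>u'\<close> respect equality of \<open>t\<close> and \<open>t'\<close>.\<close>

lemma eqs_comp:
  assumes t: "cm \<Delta> \<Gamma> t" "cm \<Delta> \<Gamma> t'" "eqs \<Delta> \<Gamma> t t'" and u: "cm \<Gamma> \<Theta> u" "cm \<Gamma> \<Theta> u'" "eqs \<Gamma> \<Theta> u u'"
  shows "eqs \<Delta> \<Theta> (scomp u t) (scomp u' t')"
  unfolding eqs_def
proof (intro allI impI)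
  fix i assume i: "i < length \<Theta>"
  let ?T = "\<lambda>u. subst (sub 0 (drop (Suc i) u)) (\<Theta> ! i)"
  have l: "length u = length \<Theta>" "length u' = length \<Theta>" using cmD u by auto
  have "subst (sub 0 t) (?T u) = subst (sub 0 (scomp (drop (Suc i) u) t)) (\<Theta> ! i)"
    using wf_scoped[of \<Theta> i] i l cmD[OF u(1)] by (intro subst_scomp) simp
  then have T: "subst (sub 0 t) (?T u) = ?T (scomp u t)" by (simp add: drop_map)
  have ty: "\<Gamma> \<turnstile> IsType (?T u')" using simultaneous_subst[OF wf_nth[of \<Theta> i] cm_drop[OF u(2)]] i cmD[OF u(1)] by simp
  have E: "\<Gamma> \<turnstile> EqType (?T u) (?T u')" using eqs_types[OF u i] .
  have 1: "\<Delta> \<turnstile> EqTerm (subst (sub 0 t) (u ! i)) (subst (sub 0 t) (u' ! i)) (subst (sub 0 t) (?T u))"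
    using simultaneous_subst[OF _ t(1), of "EqTerm (u ! i) (u' ! i) (?T u)"] u(3) i unfolding eqs_def by simp
  have "\<Gamma> \<turnstile> HasType (u' ! i) (?T u')" using u(2) i unfolding ctx_mor_def by blast
  then have "\<Delta> \<turnstile> EqTerm (subst (sub 0 t) (u' ! i)) (subst (sub 0 t') (u' ! i)) (subst (sub 0 t) (?T u'))"
    using simultaneous_cong(2)[OF t ty] by blast
  then have "\<Delta> \<turnstile> EqTerm (subst (sub 0 t) (u' ! i)) (subst (sub 0 t') (u' ! i)) (subst (sub 0 t) (?T u))"
    using simultaneous_subst[OF type_sym[OF E] t(1)] term_eq_conv by auto
  then show "\<Delta> \<turnstile> EqTerm (scomp u t ! i) (scomp u' t' ! i) (?T (scomp u t))"
    using term_trans[OF 1] T i l by simp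
qed

section \<open>Morphism classes and computation with representatives\<close>

abbreviation "cls \<equiv> mor_class (\<turnstile>)"
abbreviation "CC \<equiv> classifying_category (\<turnstile>)"
definition ob :: "'c ctx \<Rightarrow> 'c ctx set" where "ob \<Gamma> = cr `` {\<Gamma>}"

lemma in_cls: "(\<Delta>', \<Gamma>', t') \<in> cls \<Delta> \<Gamma> t \<longleftrightarrow> cm \<Delta> \<Gamma> t \<and> cm \<Delta>' \<Gamma>' t' \<and> (\<Delta>, \<Delta>') \<in> cr \<and> (\<Gamma>, \<Gamma>') \<in> cr \<and> eqs \<Delta> \<Gamma> t t'"
  unfolding mor_class_def by (simp add: mor_rel_iff)

lemma cls_eq: "\<lbrakk>cm \<Delta> \<Gamma> t; cm \<Delta>' \<Gamma>' t'\<rbrakk> \<Longrightarrow> cls \<Delta> \<Gamma> t = cls \<Delta>' \<Gamma>' t' \<longleftrightarrow> (\<Delta>, \<Delta>') \<in> cr \<and> (\<Gamma>, \<Gamma>') \<in> cr \<and> eqs \<Delta> \<Gamma> t t'"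
  unfolding mor_class_def
  by (subst eq_equiv_class_iff[OF mor_equiv]) (auto simp: mor_rel_iff)

lemma cls_eq1: "\<lbrakk>cm \<Delta> \<Gamma> t; cm \<Delta> \<Gamma> t'\<rbrakk> \<Longrightarrow> cls \<Delta> \<Gamma> t = cls \<Delta> \<Gamma> t' \<longleftrightarrow> eqs \<Delta> \<Gamma> t t'"
  using cls_eq[of \<Delta> \<Gamma> t \<Delta> \<Gamma> t'] cr_refl cmD by blast

lemma ob_eq: "\<lbrakk>wfc \<Gamma>; wfc \<Gamma>'\<rbrakk> \<Longrightarrow> ob \<Gamma> = ob \<Gamma>' \<longleftrightarrow> (\<Gamma>, \<Gamma>') \<in> cr"
  unfolding ob_def by (subst eq_equiv_class_iff[OF cr_equiv]) auto

lemma Obj_iff: "X \<in> Obj CC \<longleftrightarrow> (\<exists>\<Gamma>. wfc \<Gamma> \<and> X = ob \<Gamma>)"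
  by (auto simp: classifying_category_def quotient_def ob_def)

lemma Arr_iff: "f \<in> Arr CC \<longleftrightarrow> (\<exists>\<Delta> \<Gamma> t. cm \<Delta> \<Gamma> t \<and> f = cls \<Delta> \<Gamma> t)"
  by (auto simp: classifying_category_def quotient_def mor_class_def)

lemma Dom_cls: "cm \<Delta> \<Gamma> t \<Longrightarrow> Dom CC (cls \<Delta> \<Gamma> t) = ob \<Delta>"
proof -
  assume t: "cm \<Delta> \<Gamma> t"
  have "\<exists>\<Gamma>' t'. (\<Delta>', \<Gamma>', t') \<in> cls \<Delta> \<Gamma> t" if "(\<Delta>, \<Delta>') \<in> cr" for \<Delta>'
    using cm_conv[OF t that cr_refl] cr_refl eqs_refl[OF t] cmD[OF t] that t by (auto simp: in_cls)
  then show ?thesis by (auto simp: classifying_category_def in_cls ob_def)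
qed

lemma Cod_cls: "cm \<Delta> \<Gamma> t \<Longrightarrow> Cod CC (cls \<Delta> \<Gamma> t) = ob \<Gamma>"
proof -
  assume t: "cm \<Delta> \<Gamma> t"
  have "\<exists>\<Delta>' t'. (\<Delta>', \<Gamma>', t') \<in> cls \<Delta> \<Gamma> t" if "(\<Gamma>, \<Gamma>') \<in> cr" for \<Gamma>'
    using cm_conv[OF t cr_refl that] cr_refl eqs_refl[OF t] cmD[OF t] that t by (auto simp: in_cls)
  then show ?thesis by (auto simp: classifying_category_def in_cls ob_def)
qed

lemma cls_Hom: "cm \<Delta> \<Gamma> t \<Longrightarrow> cls \<Delta> \<Gamma> t \<in> Hom CC (ob \<Delta>) (ob \<Gamma>)"
  unfolding Hom_def using Dom_cls Cod_cls Arr_iff by blast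

lemma ArrE:
  assumes "f \<in> Arr CC" obtains \<Delta> \<Gamma> t where "cm \<Delta> \<Gamma> t" "f = cls \<Delta> \<Gamma> t"
  using assms Arr_iff by auto

lemma HomE_cls:
  assumes "f \<in> Hom CC X Y" obtains \<Delta> \<Gamma> t where "cm \<Delta> \<Gamma> t" "f = cls \<Delta> \<Gamma> t" "X = ob \<Delta>" "Y = ob \<Gamma>"
proof -
  have f: "f \<in> Arr CC" "Dom CC f = X" "Cod CC f = Y" using assms unfolding Hom_def by auto
  from f(1) obtain \<Delta> \<Gamma> t where "cm \<Delta> \<Gamma> t" "f = cls \<Delta> \<Gamma> t" by (rule ArrE)
  then show thesis using that f Dom_cls Cod_cls by simp
qed

text \<open>Conversion of contexts moves a representative to whatever contexts have been chosen for
  source and target, so equations between morphisms become equations between sequences of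
  terms.\<close>

lemma HomE:
  assumes "f \<in> Hom CC (ob \<Delta>) (ob \<Gamma>)" "wfc \<Delta>" "wfc \<Gamma>"
  obtains t where "cm \<Delta> \<Gamma> t" "f = cls \<Delta> \<Gamma> t"
proof -
  obtain \<Delta>' \<Gamma>' t where t: "cm \<Delta>' \<Gamma>' t" "f = cls \<Delta>' \<Gamma>' t" "ob \<Delta> = ob \<Delta>'" "ob \<Gamma> = ob \<Gamma>'"
    using assms(1) by (rule HomE_cls)
  have c: "(\<Delta>', \<Delta>) \<in> cr" "(\<Gamma>', \<Gamma>) \<in> cr"
    using assms(2,3) t(3,4) ob_eq[of \<Delta>' \<Delta>] ob_eq[of \<Gamma>' \<Gamma>] cmD[OF t(1)] by auto
  have "cm \<Delta> \<Gamma> t" using cm_conv[OF t(1) c] .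
  then show thesis using that[of t] cls_eq[OF t(1), of \<Delta> \<Gamma> t] eqs_refl[OF t(1)] c t(2) by blast
qed

text \<open>The union that defines composition runs over all matching representatives; by congruence
  they all yield one and the same class.\<close>

lemma Comp_cls: 
  assumes t: "cm \<Delta> \<Gamma> t" and u: "cm \<Gamma> \<Theta> u"
  shows "Comp CC (cls \<Gamma> \<Theta> u) (cls \<Delta> \<Gamma> t) = cls \<Delta> \<Theta> (scomp u t)"
proof -
  have e: "cls \<Delta>' \<Theta>' (scomp u' t') = cls \<Delta> \<Theta> (scomp u t)"
    if "(\<Delta>', \<Gamma>', t') \<in> cls \<Delta> \<Gamma> t" "(\<Gamma>', \<Theta>', u') \<in> cls \<Gamma> \<Theta> u" for \<Delta>' \<Gamma>' \<Theta>' t' u'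
  proof -
    have 1: "cm \<Delta>' \<Gamma>' t'" "(\<Delta>, \<Delta>') \<in> cr" "(\<Gamma>, \<Gamma>') \<in> cr" "eqs \<Delta> \<Gamma> t t'"
      and 2: "cm \<Gamma>' \<Theta>' u'" "(\<Theta>, \<Theta>') \<in> cr" "eqs \<Gamma> \<Theta> u u'" using that by (auto simp: in_cls)
    have 3: "cm \<Delta> \<Gamma> t'" "cm \<Gamma> \<Theta> u'" using cm_conv 1 2 cr_sym by blast+
    have "eqs \<Delta> \<Theta> (scomp u t) (scomp u' t')" using eqs_comp[OF t 3(1) 1(4) u 3(2) 2(3)] .
    then show ?thesis
      using cls_eq[OF cm_comp[OF t u] cm_comp[OF 1(1) 2(1)]] 1 2 by simp
  qed
  have m: "(\<Delta>, \<Gamma>, t) \<in> cls \<Delta> \<Gamma> t" "(\<Gamma>, \<Theta>, u) \<in> cls \<Gamma> \<Theta> u"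
    using t u cr_refl eqs_refl cmD by (auto simp: in_cls)
  have "{cls \<Delta>' \<Theta>' (scomp u' t') | \<Delta>' \<Gamma>' \<Theta>' t' u'. (\<Delta>', \<Gamma>', t') \<in> cls \<Delta> \<Gamma> t \<and> (\<Gamma>', \<Theta>', u') \<in> cls \<Gamma> \<Theta> u} = {cls \<Delta> \<Theta> (scomp u t)}"
    using e m by blast
  then show ?thesis by (simp add: classifying_category_def)
qed

lemma Ident_ob: "wfc \<Gamma> \<Longrightarrow> Ident CC (ob \<Gamma>) = cls \<Gamma> \<Gamma> (ids (length \<Gamma>))"
proof -
  assume w: "wfc \<Gamma>"
  have "cls \<Gamma>' \<Gamma>' (ids (length \<Gamma>')) = cls \<Gamma> \<Gamma> (ids (length \<Gamma>))" if "(\<Gamma>, \<Gamma>') \<in> cr" for \<Gamma>'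
    using cls_eq[OF cm_ids[of \<Gamma>'] cm_ids[of \<Gamma>]] crD[OF that] cr_sym[OF that] eqs_refl[OF cm_ids[of \<Gamma>']] by simp
  then have "(\<Union>\<Gamma>' \<in> ob \<Gamma>. cls \<Gamma>' \<Gamma>' (ids (length \<Gamma>'))) = cls \<Gamma> \<Gamma> (ids (length \<Gamma>))"
    using cr_refl[OF w] unfolding ob_def by blast
  then show ?thesis by (simp add: classifying_category_def)
qed

lemma scomp_ids: "length t = n \<Longrightarrow> scomp (ids n) t = t"
  by (rule nth_equalityI) auto

lemma cm_scoped: "\<lbrakk>cm \<Delta> \<Gamma> t; e \<in> set t\<rbrakk> \<Longrightarrow> scoped (length \<Delta>) e"
  unfolding ctx_mor_def in_set_conv_nth using scopedD(2) by metis

lemma ids_scomp: "cm \<Delta> \<Gamma> t \<Longrightarrow> scomp t (ids (length \<Delta>)) = t"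
  using cm_scoped sub_ids by (intro map_idI) blast

lemma scomp_assoc: "cm \<Gamma> \<Theta> u \<Longrightarrow> cm \<Theta> \<Lambda> v \<Longrightarrow> scomp (scomp v u) t = scomp v (scomp u t)"
  using cm_scoped subst_scomp[of u _ t] cmD by fastforce

lemma category_CC: "category CC"
proof
  fix f assume "f \<in> Arr CC"
  then obtain \<Delta> \<Gamma> t where "cm \<Delta> \<Gamma> t" "f = cls \<Delta> \<Gamma> t" by (rule ArrE)
  then show "Dom CC f \<in> Obj CC" "Cod CC f \<in> Obj CC" using Dom_cls Cod_cls cmD unfolding Obj_iff by blast+
next
  fix X assume "X \<in> Obj CC"
  then obtain \<Gamma> where "wfc \<Gamma>" "X = ob \<Gamma>" using Obj_iff by auto
  then show "Ident CC X \<in> Hom CC X X" using Ident_ob cls_Hom[OF cm_ids] by simp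
next
  fix f g X Y Z assume "f \<in> Hom CC X Y"
  then obtain \<Delta> \<Gamma> t where t: "cm \<Delta> \<Gamma> t" "f = cls \<Delta> \<Gamma> t" "X = ob \<Delta>" "Y = ob \<Gamma>" by (rule HomE_cls)
  assume g: "g \<in> Hom CC Y Z"
  then obtain \<Gamma>' \<Theta> u' where Z: "cm \<Gamma>' \<Theta> u'" "Z = ob \<Theta>" by (rule HomE_cls)
  obtain u where "cm \<Gamma> \<Theta> u" "g = cls \<Gamma> \<Theta> u" using HomE[of g \<Gamma> \<Theta>] g Z t cmD by metis
  then show "Comp CC g f \<in> Hom CC X Z" using Comp_cls[OF t(1)] cls_Hom[OF cm_comp[OF t(1)]] t Z by simp
next
  fix f X Y assume "f \<in> Hom CC X Y"
  then obtain \<Delta> \<Gamma> t where t: "cm \<Delta> \<Gamma> t" "f = cls \<Delta> \<Gamma> t" "X = ob \<Delta>" "Y = ob \<Gamma>" by (rule HomE_cls)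
  have w: "wfc \<Delta>" "wfc \<Gamma>" "length t = length \<Gamma>" using cmD[OF t(1)] by auto
  show "Comp CC f (Ident CC X) = f" "Comp CC (Ident CC Y) f = f"
    using Comp_cls[OF cm_ids[OF w(1)] t(1)] Comp_cls[OF t(1) cm_ids[OF w(2)]] ids_scomp[OF t(1)] scomp_ids[OF w(3)] t w
    by (simp_all add: Ident_ob)
next
  fix f g h W X Y Z assume "f \<in> Hom CC W X" and g: "g \<in> Hom CC X Y" and h: "h \<in> Hom CC Y Z"
  then obtain \<Delta> \<Gamma> t where t: "cm \<Delta> \<Gamma> t" "f = cls \<Delta> \<Gamma> t" "W = ob \<Delta>" "X = ob \<Gamma>" by (auto elim: HomE_cls)
  from g obtain \<Gamma>' \<Theta> u' where Y: "cm \<Gamma>' \<Theta> u'" "Y = ob \<Theta>" by (rule HomE_cls)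
  from h obtain \<Theta>' \<Lambda> v' where Z: "cm \<Theta>' \<Lambda> v'" "Z = ob \<Lambda>" by (rule HomE_cls)
  obtain u where u: "cm \<Gamma> \<Theta> u" "g = cls \<Gamma> \<Theta> u" using HomE[of g \<Gamma> \<Theta>] g t Y cmD by metis
  obtain v where v: "cm \<Theta> \<Lambda> v" "h = cls \<Theta> \<Lambda> v" using HomE[of h \<Theta> \<Lambda>] h Y Z cmD by metis
  show "Comp CC h (Comp CC g f) = Comp CC (Comp CC h g) f"
    using Comp_cls[OF t(1) u(1)] Comp_cls[OF u(1) v(1)] Comp_cls[OF cm_comp[OF t(1) u(1)] v(1)]
      Comp_cls[OF t(1) cm_comp[OF u(1) v(1)]] scomp_assoc[OF u(1) v(1), of t] t u v
    by (simp del: map_map)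
qed

interpretation CC: category CC by (rule category_CC)

section \<open>Dependent projections and their pullbacks\<close>

lemma Obj_ob [simp]: "wfc \<Gamma> \<Longrightarrow> ob \<Gamma> \<in> Obj CC"
  unfolding Obj_iff by blast

lemma cls_type [simp]:
  assumes "cm \<Delta> \<Gamma> t"
  shows "cls \<Delta> \<Gamma> t \<in> Arr CC" "Dom CC (cls \<Delta> \<Gamma> t) = ob \<Delta>" "Cod CC (cls \<Delta> \<Gamma> t) = ob \<Gamma>"
  using cls_Hom[OF assms] unfolding Hom_def by auto

lemma HomE_Cons:
  assumes "f \<in> Hom CC (ob \<Delta>) (ob (A # \<Gamma>))" "wfc \<Delta>" "\<Gamma> \<turnstile> IsType A"
  obtains a s where "cm \<Delta> \<Gamma> s" "\<Delta> \<turnstile> HasType a (subst (sub 0 s) A)" "f = cls \<Delta> (A # \<Gamma>) (a # s)"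
proof -
  have "wfc (A # \<Gamma>)" using assms(3) context_wf by simp
  then obtain t where "cm \<Delta> (A # \<Gamma>) t" "f = cls \<Delta> (A # \<Gamma>) t" using HomE[OF assms(1,2)] by blast
  then show thesis using that unfolding cm_Cons by blast
qed

lemma cm_wk: "\<Gamma> \<turnstile> IsType A \<Longrightarrow> cm (A # \<Gamma>) \<Gamma> (wk (length \<Gamma>))"
  unfolding wk_def by (rule cm_weaken[OF cm_ids]) (use context_wf in auto)

definition proj :: "'c ctx \<Rightarrow> 'c expr \<Rightarrow> ('c ctx \<times> 'c ctx \<times> 'c expr list) set" where
  "proj \<Gamma> A = cls (A # \<Gamma>) \<Gamma> (wk (length \<Gamma>))"

lemma proj_type [simp]:
  assumes "\<Gamma> \<turnstile> IsType A"
  shows "proj \<Gamma> A \<in> Arr CC" "Dom CC (proj \<Gamma> A) = ob (A # \<Gamma>)" "Cod CC (proj \<Gamma> A) = ob \<Gamma>"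
  unfolding proj_def using cm_wk[OF assms] by auto

lemma proj_comp:
  assumes "cm \<Delta> \<Gamma> s" "\<Gamma> \<turnstile> IsType A" "\<Delta> \<turnstile> HasType a (subst (sub 0 s) A)"
  shows "Comp CC (proj \<Gamma> A) (cls \<Delta> (A # \<Gamma>) (a # s)) = cls \<Delta> \<Gamma> s"
  unfolding proj_def using Comp_cls[of \<Delta> "A # \<Gamma>" "a # s" \<Gamma> "wk (length \<Gamma>)"] assms cm_wk cmD[OF assms(1)]
  by (simp add: scomp_wk_Cons)

lemma comp_proj:
  assumes "cm \<Delta> \<Gamma> s" "\<Delta> \<turnstile> IsType A"
  shows "Comp CC (cls \<Delta> \<Gamma> s) (proj \<Delta> A) = cls (A # \<Delta>) \<Gamma> (map (weaken 1) s)"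
proof -
  have "scomp s (wk (length \<Delta>)) = map (weaken 1) s"
    by (intro map_cong refl subst_wk cm_scoped[OF assms(1)])
  then show ?thesis using Comp_cls[OF cm_wk[OF assms(2)] assms(1)] unfolding proj_def by (simp only:)
qed

lemma subst_IsType: "\<lbrakk>cm \<Theta> \<Gamma> t; \<Gamma> \<turnstile> IsType A\<rbrakk> \<Longrightarrow> \<Theta> \<turnstile> IsType (subst (sub 0 t) A)"
  using simultaneous_subst[of \<Gamma> "IsType A"] by simp

lemma cm_lift:
  assumes "cm \<Theta> \<Gamma> t" "\<Gamma> \<turnstile> IsType A"
  shows "cm (subst (sub 0 t) A # \<Theta>) (A # \<Gamma>) (Var 0 # map (weaken 1) t)"
proof -
  have "subst (sub 0 (map (weaken 1) t)) A = weaken 1 (subst (sub 0 t) A)"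
    unfolding subst_subst using cmD[OF assms(1)] by (intro scoped_cong[OF scopedD(1)[OF assms(2)]]) auto
  then show ?thesis
    using cm_weaken[OF assms(1) subst_IsType[OF assms]] variable[OF subst_IsType[OF assms]] assms(2) by simp
qed

text \<open>A map into the pulled back context is a sequence \<open>a # w\<close>, with
  \<open>a\<close> from the map into \<open>A # \<Gamma>\<close> and \<open>w\<close> the map into
  \<open>\<Theta>\<close>. The square of representatives commutes only up to definitional equality,
  so the type of \<open>a\<close> is converted by congruence of substitution in
  \<open>A\<close>.\<close>

lemma proj_pullback:
  assumes t: "cm \<Theta> \<Gamma> t" and A: "\<Gamma> \<turnstile> IsType A"
  shows "is_pullback CC (proj \<Gamma> A) (cls \<Theta> \<Gamma> t)
    (cls (subst (sub 0 t) A # \<Theta>) (A # \<Gamma>) (Var 0 # map (weaken 1) t)) (proj \<Theta> (subst (sub 0 t) A))"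
proof (rule CC.pullbackI[where V = "ob (subst (sub 0 t) A # \<Theta>)"])
  let ?A = "subst (sub 0 t) A" and ?e = "Var 0 # map (weaken 1) t"
  have tA: "\<Theta> \<turnstile> IsType ?A" by (rule subst_IsType[OF t A])
  note e = cm_lift[OF t A]
  note [simp] = cls_type[OF t] cls_type[OF e] proj_type[OF A] proj_type[OF tA]
  have l: "length t = length \<Gamma>" using cmD[OF t] by simp
  have scA: "scoped (length t) A" using scopedD(1)[OF A] l by simp
  show "Comp CC (proj \<Gamma> A) (cls (?A # \<Theta>) (A # \<Gamma>) ?e) = Comp CC (cls \<Theta> \<Gamma> t) (proj \<Theta> ?A)"
    using proj_comp[of "?A # \<Theta>" \<Gamma> "map (weaken 1) t" A "Var 0"] e comp_proj[OF t tA] A by simp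
  fix S
  have TA: "subst (sub 0 s) ?A = subst (sub 0 (scomp t s)) A" for s
    by (rule subst_scomp[OF scA])
  {
    fix u v assume u: "u \<in> Hom CC S (Dom CC (proj \<Gamma> A))" and v: "v \<in> Hom CC S (Dom CC (cls \<Theta> \<Gamma> t))"
      and eq: "Comp CC (proj \<Gamma> A) u = Comp CC (cls \<Theta> \<Gamma> t) v"
    have "S \<in> Obj CC" using u by auto
    then obtain \<Psi> where S: "wfc \<Psi>" "S = ob \<Psi>" unfolding Obj_iff by blast
    have u': "u \<in> Hom CC (ob \<Psi>) (ob (A # \<Gamma>))" using u S by simp
    obtain a s where s: "cm \<Psi> \<Gamma> s" "\<Psi> \<turnstile> HasType a (subst (sub 0 s) A)" "u = cls \<Psi> (A # \<Gamma>) (a # s)"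
      by (rule HomE_Cons[OF u' S(1) A])
    have v': "v \<in> Hom CC (ob \<Psi>) (ob \<Theta>)" using v S by simp
    obtain w where w: "cm \<Psi> \<Theta> w" "v = cls \<Psi> \<Theta> w" using HomE[OF v' S(1)] cmD[OF t] by blast
    note tw = cm_comp[OF w(1) t]
    have es: "eqs \<Psi> \<Gamma> s (scomp t w)"
      using eq proj_comp[OF s(1) A s(2)] Comp_cls[OF w(1) t] cls_eq1[OF s(1) tw] s(3) w(2) by simp
    have a: "\<Psi> \<turnstile> HasType a (subst (sub 0 w) ?A)"
      unfolding TA using term_conv[OF s(2) simultaneous_cong(1)[OF s(1) tw es A]] .
    have aw: "cm \<Psi> (?A # \<Theta>) (a # w)" using w(1) tA a by simp
    have "scomp ?e (a # w) = a # scomp t w" by (simp add: scomp_Cons_weaken del: map_map)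
    then have "Comp CC (cls (?A # \<Theta>) (A # \<Gamma>) ?e) (cls \<Psi> (?A # \<Theta>) (a # w)) = cls \<Psi> (A # \<Gamma>) (a # scomp t w)"
      using Comp_cls[OF aw e] by (simp only:)
    also have "\<dots> = u"
      using cls_eq1[of \<Psi> "A # \<Gamma>" "a # s" "a # scomp t w"] s A tw a es term_refl[OF s(2)]
      by (simp add: eqs_Cons TA)
    finally show "\<exists>w\<in>Hom CC S (ob (?A # \<Theta>)). Comp CC (cls (?A # \<Theta>) (A # \<Gamma>) ?e) w = u \<and> Comp CC (proj \<Theta> ?A) w = v"
      using proj_comp[OF w(1) tA a] w(2) S(2) cls_Hom[OF aw] by (intro bexI[of _ "cls \<Psi> (?A # \<Theta>) (a # w)"]) auto
  }
  fix w w' assume w: "w \<in> Hom CC S (ob (?A # \<Theta>))" "w' \<in> Hom CC S (ob (?A # \<Theta>))"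
    and eq: "Comp CC (cls (?A # \<Theta>) (A # \<Gamma>) ?e) w = Comp CC (cls (?A # \<Theta>) (A # \<Gamma>) ?e) w'"
      "Comp CC (proj \<Theta> ?A) w = Comp CC (proj \<Theta> ?A) w'"
  have "S \<in> Obj CC" using w by auto
  then obtain \<Psi> where S: "wfc \<Psi>" "S = ob \<Psi>" unfolding Obj_iff by blast
  obtain a s where s: "cm \<Psi> \<Theta> s" "\<Psi> \<turnstile> HasType a (subst (sub 0 s) ?A)" "w = cls \<Psi> (?A # \<Theta>) (a # s)"
    using HomE_Cons[OF _ S(1) tA, of w] w S by metis
  obtain a' s' where s': "cm \<Psi> \<Theta> s'" "\<Psi> \<turnstile> HasType a' (subst (sub 0 s') ?A)" "w' = cls \<Psi> (?A # \<Theta>) (a' # s')"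
    using HomE_Cons[OF _ S(1) tA, of w'] w S by metis
  have c: "cm \<Psi> (?A # \<Theta>) (a # s)" "cm \<Psi> (?A # \<Theta>) (a' # s')" using s s' tA by auto
  have 1: "eqs \<Psi> \<Theta> s s'"
    using eq(2) proj_comp[OF s(1) tA s(2)] proj_comp[OF s'(1) tA s'(2)] s(3) s'(3) cls_eq1[OF s(1) s'(1)] by simp
  have sc: "scomp ?e (b # x) = b # scomp t x" for b x
    by (simp add: scomp_Cons_weaken del: map_map)
  have "eqs \<Psi> (A # \<Gamma>) (scomp ?e (a # s)) (scomp ?e (a' # s'))"
    using eq(1) Comp_cls[OF c(1) e] Comp_cls[OF c(2) e] s(3) s'(3) cls_eq1[OF cm_comp[OF c(1) e] cm_comp[OF c(2) e]]
    by (simp del: map_map list.map)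
  then have "\<Psi> \<turnstile> EqTerm a a' (subst (sub 0 s) ?A)" unfolding sc by (simp add: eqs_Cons TA)
  then show "w = w'" using 1 cls_eq1[OF c] s(3) s'(3) by (simp add: eqs_Cons)
qed (use cm_lift[OF t A] subst_IsType[OF t A] t A in auto)

text \<open>The dependent projection, written through \<open>weaken\<close> so as to suit induction
  on \<open>\<Delta>\<close>; \<open>weaken_ids\<close> gives the other form.\<close>

definition pr :: "'c ctx \<Rightarrow> 'c ctx \<Rightarrow> ('c ctx \<times> 'c ctx \<times> 'c expr list) set" where
  "pr \<Delta> \<Gamma> = cls (\<Delta> @ \<Gamma>) \<Gamma> (map (weaken (length \<Delta>)) (ids (length \<Gamma>)))"

lemma pr_Nil: "wfc \<Gamma> \<Longrightarrow> pr [] \<Gamma> = Ident CC (ob \<Gamma>)"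
  unfolding pr_def by (simp add: Ident_ob map_idI del: map_map)

lemma cm_pr: "wfc (\<Delta> @ \<Gamma>) \<Longrightarrow> cm (\<Delta> @ \<Gamma>) \<Gamma> (map (weaken (length \<Delta>)) (ids (length \<Gamma>)))"
proof (induction \<Delta>)
  case Nil
  have "map (weaken 0) t = t" for t :: "'c expr list" by (simp add: map_idI)
  then show ?case using Nil cm_ids by (simp del: map_map)
next
  case (Cons A \<Delta>)
  have "map (weaken 1) (map (weaken (length \<Delta>)) t) = map (weaken (length (A # \<Delta>))) t" for t :: "'c expr list"
    by (simp only: map_map comp_def weaken_weaken) simp
  then show ?case using cm_weaken[OF Cons.IH, of A] Cons.prems by (simp del: map_map)
qed

lemma pr_type [simp]:
  assumes "wfc (\<Delta> @ \<Gamma>)"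
  shows "pr \<Delta> \<Gamma> \<in> Arr CC" "Dom CC (pr \<Delta> \<Gamma>) = ob (\<Delta> @ \<Gamma>)" "Cod CC (pr \<Delta> \<Gamma>) = ob \<Gamma>"
  unfolding pr_def using cm_pr[OF assms] by auto

lemma pr_Cons:
  assumes "wfc (A # \<Delta> @ \<Gamma>)"
  shows "pr (A # \<Delta>) \<Gamma> = Comp CC (pr \<Delta> \<Gamma>) (proj (\<Delta> @ \<Gamma>) A)"
proof -
  have "map (weaken 1) (map (weaken (length \<Delta>)) t) = map (weaken (length (A # \<Delta>))) t" for t :: "'c expr list"
    by (simp only: map_map comp_def weaken_weaken) simp
  then show ?thesis unfolding pr_def using comp_proj[OF cm_pr[of \<Delta> \<Gamma>], of A] assms by (simp del: map_map)
qed

lemma wf_inst_ctx: "\<lbrakk>wfc (\<Delta> @ \<Gamma>); cm \<Theta> \<Gamma> t\<rbrakk> \<Longrightarrow> wfc (inst_ctx (sub 0 t) \<Delta> @ \<Theta>)"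
proof (induction \<Delta>)
  case (Cons A \<Delta>) then show ?case using simultaneous_subst_under[of \<Delta> \<Gamma> "IsType A" \<Theta> t] by simp
qed (use cmD in auto)

lemma cm_ext: "\<lbrakk>wfc (\<Delta> @ \<Gamma>); cm \<Theta> \<Gamma> t\<rbrakk> \<Longrightarrow> cm (inst_ctx (sub 0 t) \<Delta> @ \<Theta>) (\<Delta> @ \<Gamma>) (lift_tms (length \<Delta>) t)"
proof (induction \<Delta>)
  case (Cons A \<Delta>)
  then have c: "cm (inst_ctx (sub 0 t) \<Delta> @ \<Theta>) (\<Delta> @ \<Gamma>) (lift_tms (length \<Delta>) t)" and A: "\<Delta> @ \<Gamma> \<turnstile> IsType A" by auto
  have "subst (sub 0 (lift_tms (length \<Delta>) t)) A = inst (length \<Delta>) (sub 0 t) A"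
    using scopedD(1)[OF A] cmD[OF Cons.prems(2)] by (intro sub_ext) simp
  then show ?case using cm_lift[OF c A] by (simp add: lift_tms_Suc del: cm_Cons_iff)
qed simp

lemma pr_pullback:
  "\<lbrakk>wfc (\<Delta> @ \<Gamma>); cm \<Theta> \<Gamma> t\<rbrakk> \<Longrightarrow> is_pullback CC (pr \<Delta> \<Gamma>) (cls \<Theta> \<Gamma> t)
     (cls (inst_ctx (sub 0 t) \<Delta> @ \<Theta>) (\<Delta> @ \<Gamma>) (lift_tms (length \<Delta>) t)) (pr (inst_ctx (sub 0 t) \<Delta>) \<Theta>)"
proof (induction \<Delta>)
  case Nil
  then have w: "wfc \<Gamma>" "wfc \<Theta>" using cmD by auto
  note [simp] = cls_type[OF Nil(2)]
  obtain p where p: "is_pullback CC (Ident CC (ob \<Gamma>)) (cls \<Theta> \<Gamma> t) p (Ident CC (ob \<Theta>))"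
    using w CC.pullback_of_iso[OF CC.iso_ident[of "ob \<Gamma>"], of "cls \<Theta> \<Gamma> t"] by auto
  have "p = cls \<Theta> \<Gamma> t" using CC.pullbackD[OF p] w by simp
  then show ?case using p w by (simp add: pr_Nil)
next
  case (Cons A \<Delta>)
  then have w: "wfc (\<Delta> @ \<Gamma>)" and A: "\<Delta> @ \<Gamma> \<turnstile> IsType A" by auto
  let ?\<Theta> = "inst_ctx (sub 0 t) \<Delta> @ \<Theta>"
  note c = cm_ext[OF w Cons.prems(2)]
  have e: "subst (sub 0 (lift_tms (length \<Delta>) t)) A = inst (length \<Delta>) (sub 0 t) A"
    using scopedD(1)[OF A] cmD[OF Cons.prems(2)] by (intro sub_ext) simp
  have tA: "?\<Theta> \<turnstile> IsType (inst (length \<Delta>) (sub 0 t) A)" using subst_IsType[OF c A] e by simp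
  show ?case
    using CC.pullback_paste[OF Cons.IH[OF w Cons.prems(2)] proj_pullback[OF c A]]
      pr_Cons[of A \<Delta> \<Gamma>] pr_Cons[of "inst (length \<Delta>) (sub 0 t) A" "inst_ctx (sub 0 t) \<Delta>" \<Theta>] Cons.prems wf_inst_ctx[OF w Cons.prems(2)] tA
    by (simp add: e lift_tms_Suc)
qed

end

section \<open>Identity structures in the classifying category\<close>

context propositional_identity_types
begin

interpretation CC: category CC by (rule category_CC)

lemma id_types:
  assumes "\<Gamma> \<turnstile> IsType A"
  shows "A # \<Gamma> \<turnstile> IsType (weaken 1 A)" "weaken 1 A # A # \<Gamma> \<turnstile> IsType (Con \<I> [weaken 2 A, Var 1, Var 0])"
proof -
  show 1: "A # \<Gamma> \<turnstile> IsType (weaken 1 A)" using weaken1[OF assms assms] by simp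
  have w: "wfc (weaken 1 A # A # \<Gamma>)" using 1 assms context_wf[OF assms] by simp
  have "weaken 1 A # A # \<Gamma> \<turnstile> HasType (Var 1) (weaken 2 A)" "weaken 1 A # A # \<Gamma> \<turnstile> HasType (Var 0) (weaken 2 A)"
    using var_type[OF w, of 1] var_type[OF w, of 0] weaken_weaken[of 1 1 A] by (simp_all add: numeral_2_eq_2)
  then show "weaken 1 A # A # \<Gamma> \<turnstile> IsType (Con \<I> [weaken 2 A, Var 1, Var 0])" by (rule Id_form)
qed

lemma wf_id_ctx: "\<Gamma> \<turnstile> IsType A \<Longrightarrow> wfc (id_ctx \<I> A @ \<Gamma>)"
  using id_types[of \<Gamma> A] context_wf by (simp add: id_ctx_def)

text \<open>
  Elimination at the generic point \<open>(Var 2, Var 1, Var 0)\<close> of the context \<open>id_ctx\<close>, which is also taken as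
  the ambient context; hence everything is weakened by three variables first.
\<close>

lemma J_generic:
  assumes A: "\<Gamma> \<turnstile> IsType A" and C: "\<Delta> @ id_ctx \<I> A @ \<Gamma> \<turnstile> IsType C"
    and d: "inst_ctx (at_refl \<r>) \<Delta> @ A # \<Gamma> \<turnstile> HasType \<delta> (inst (length \<Delta>) (at_refl \<r>) C)"
  obtains j h where "\<Delta> @ id_ctx \<I> A @ \<Gamma> \<turnstile> HasType j C"
    "inst_ctx (at_refl \<r>) \<Delta> @ A # \<Gamma> \<turnstile> HasType h
       (Con \<I> [inst (length \<Delta>) (at_refl \<r>) C, inst (length \<Delta>) (at_refl \<r>) j, \<delta>])"
proof -
  let ?n = "length \<Delta>"
  let ?D = "\<lambda>k. inst_ctx ((up ^^ 3) (sub k [])) \<Delta>" and ?C = "\<lambda>k. inst ?n ((up ^^ 3) (sub k [])) C"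
    and ?d = "\<lambda>k. inst ?n (up (sub k [])) \<delta>"
  \<comment> \<open>Weakening the outer context commutes with setting the generic point to
    reflexivity; this carries the premise \<open>\<delta>\<close> to a larger ambient
    context.\<close>
  have comm: "subst (up (sub k [])) \<circ> at_refl \<r> = subst (at_refl \<r>) \<circ> (up ^^ 3) (sub k [])" for k
  proof
    fix i
    show "(subst (up (sub k [])) \<circ> at_refl \<r>) i = (subst (at_refl \<r>) \<circ> (up ^^ 3) (sub k [])) i"
    proof (cases "i < 3")
      case True
      then have "i = 0 \<or> i = 1 \<or> i = 2" by auto
      then show ?thesis by (auto simp: ups sub_def up_def)
    next
      case False
      then obtain m where "i = m + 3" by (metis add.commute le_Suc_ex not_less)
      then show ?thesis by (simp add: ups sub_def up_def)
    qed
  qed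
  have C': "?D (length E) @ id_ctx \<I> (weaken (length E) A) @ E @ \<Gamma> \<turnstile> IsType (?C (length E))"
    and d': "inst_ctx (at_refl \<r>) (?D (length E)) @ weaken (length E) A # E @ \<Gamma>
        \<turnstile> HasType (?d (length E)) (inst (length (?D (length E))) (at_refl \<r>) (?C (length E)))"
    if E: "wfc (E @ \<Gamma>)" for E
  proof -
    have "inst (?n + 3) (sub (length E) []) C = ?C (length E)" by (simp only: inst_add)
    then show "?D (length E) @ id_ctx \<I> (weaken (length E) A) @ E @ \<Gamma> \<turnstile> IsType (?C (length E))"
      using weaken_tel[of "\<Delta> @ id_ctx \<I> A" \<Gamma> "IsType C" E] C E by (simp add: inst_ctx_append id_ctx_inst)
    have e: "inst (Suc ?n) (sub (length E) [] :: nat \<Rightarrow> 'c expr) = inst ?n (up (sub (length E) []))"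
      using inst_add[of ?n 1 "sub (length E) [] :: nat \<Rightarrow> 'c expr"] by (simp add: fun_eq_iff)
    have "inst_ctx (sub (length E) []) (inst_ctx (at_refl \<r>) \<Delta> @ [A]) @ E @ \<Gamma> \<turnstile>
        map_judgement (inst (Suc ?n) (sub (length E) [])) (HasType \<delta> (inst ?n (at_refl \<r>) C))"
      using weaken_tel[of "inst_ctx (at_refl \<r>) \<Delta> @ [A]" \<Gamma> "HasType \<delta> (inst ?n (at_refl \<r>) C)" E] d E by simp
    then have "inst_ctx (up (sub (length E) [])) (inst_ctx (at_refl \<r>) \<Delta>) @ weaken (length E) A # E @ \<Gamma> \<turnstile>
        HasType (?d (length E)) (inst ?n (up (sub (length E) [])) (inst ?n (at_refl \<r>) C))"
      unfolding e by (simp add: inst_ctx_append)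
    then show "inst_ctx (at_refl \<r>) (?D (length E)) @ weaken (length E) A # E @ \<Gamma>
        \<turnstile> HasType (?d (length E)) (inst (length (?D (length E))) (at_refl \<r>) (?C (length E)))"
      by (simp only: length_inst_ctx inst_ctx_inst_ctx inst_inst comm)
  qed
  have w3: "wfc (id_ctx \<I> A @ \<Gamma>)" by (rule wf_id_ctx[OF A])
  have w1: "wfc ([A] @ \<Gamma>)" using A context_wf[OF A] by simp
  have p: "id_ctx \<I> A @ \<Gamma> \<turnstile> HasType (Var 0) (Con \<I> [weaken 3 A, Var 2, Var 1])"
    using var_type[OF w3, of 0] weaken_weaken[of 1 2 A] by (simp add: id_ctx_def sub_Nil numeral_3_eq_3 numeral_2_eq_2)
  have k3: "length (id_ctx \<I> A) = 3" "length [A] = 1" by simp_all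
  \<comment> \<open>Weakening past the three generic variables and then substituting these same
    variables is the identity, so this instance of elimination returns to the original context and
    type.\<close>
  have path3: "subst (at_path (Var 2) (Var 1) (Var 0)) \<circ> (up ^^ 3) (sub 3 []) = Var"
  proof
    fix i
    show "(subst (at_path (Var 2) (Var 1) (Var 0)) \<circ> (up ^^ 3) (sub 3 [])) i = Var i"
    proof (cases "i < 3")
      case True
      then have "i = 0 \<or> i = 1 \<or> i = 2" by auto
      then show ?thesis by (auto simp: ups sub_def)
    next
      case False
      then obtain m where "i = m + 3" by (metis add.commute le_Suc_ex not_less)
      then show ?thesis by (simp add: ups sub_def)
    qed
  qed
  define j where "j = elim_tm \<J> ?n [Var 2, Var 1, Var 0] (?d 3)"
  have "inst_ctx (at_path (Var 2) (Var 1) (Var 0)) (?D 3) @ id_ctx \<I> A @ \<Gamma>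
      \<turnstile> HasType (elim_tm \<J> (length (?D 3)) [Var 2, Var 1, Var 0] (?d 3)) (inst (length (?D 3)) (at_path (Var 2) (Var 1) (Var 0)) (?C 3))"
    by (rule Id_elim[OF C'[OF w3, unfolded k3] p d'[OF w3, unfolded k3]])
  then have j: "\<Delta> @ id_ctx \<I> A @ \<Gamma> \<turnstile> HasType j C"
    unfolding j_def by (simp only: length_inst_ctx inst_ctx_inst_ctx inst_inst path3 inst_ctx_Var inst_Var)
  have a: "A # \<Gamma> \<turnstile> HasType (Var 0) (weaken 1 A)" using variable[OF A] .
  have path1: "subst (at_path (Var 0) (Var 0) (Con \<r> [Var 0])) \<circ> (up ^^ 3) (sub 1 []) = at_refl \<r>"
  proof
    fix i
    show "(subst (at_path (Var 0) (Var 0) (Con \<r> [Var 0])) \<circ> (up ^^ 3) (sub 1 [])) i = at_refl \<r> i"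
    proof (cases "i < 3")
      case True
      then have "i = 0 \<or> i = 1 \<or> i = 2" by auto
      then show ?thesis by (auto simp: ups sub_def)
    next
      case False
      then obtain m where "i = m + 3" by (metis add.commute le_Suc_ex not_less)
      then show ?thesis by (simp add: ups sub_def)
    qed
  qed
  have up1: "subst (sub 0 [Var 0]) \<circ> up (sub 1 []) = Var"
    by (auto simp: fun_eq_iff up_def sub_def split: nat.split)
  \<comment> \<open>Reflexivity at the generic point turns weakening by three variables into
    weakening by one. So \<open>j\<close> there is the elimination term over the ambient context
    \<open>A # \<Gamma>\<close>, the one to which the computation rule applies.\<close>
  have refl3: "subst (at_refl \<r>) \<circ> sub 3 [] = sub 1 []" by (auto simp: fun_eq_iff sub_def)
  have "inst (Suc ?n) (at_refl \<r>) (?d 3) = inst ?n (up (at_refl \<r>)) (?d 3)"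
    using inst_add[of ?n 1 "at_refl \<r>" "?d 3"] by simp
  also have "\<dots> = ?d 1" by (simp only: inst_inst up_comp refl3)
  finally have jr: "inst ?n (at_refl \<r>) j = elim_tm \<J> ?n [Var 0, Var 0, Con \<r> [Var 0]] (?d 1)"
    unfolding j_def by (simp add: elim_tm_inst sub_def)
  have "inst_ctx (at_path (Var 0) (Var 0) (Con \<r> [Var 0])) (?D 1) @ A # \<Gamma> \<turnstile>
      HasType (elim_tm \<H> (length (?D 1)) [Var 0] (?d 1))
       (Con \<I> [inst (length (?D 1)) (at_path (Var 0) (Var 0) (Con \<r> [Var 0])) (?C 1),
         elim_tm \<J> (length (?D 1)) [Var 0, Var 0, Con \<r> [Var 0]] (?d 1), inst (length (?D 1)) (sub 0 [Var 0]) (?d 1)])"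
    using Id_comp[OF _ a, of "?D 1" "?C 1" "?d 1"] C'[OF w1, unfolded k3] d'[OF w1, unfolded k3] by simp
  then have "inst_ctx (at_refl \<r>) \<Delta> @ A # \<Gamma> \<turnstile> HasType (elim_tm \<H> ?n [Var 0] (?d 1))
       (Con \<I> [inst ?n (at_refl \<r>) C, inst ?n (at_refl \<r>) j, \<delta>])"
    by (simp only: length_inst_ctx inst_ctx_inst_ctx inst_inst path1 up1 inst_Var jr)
  then show thesis using that j by blast
qed

text \<open>The second projection from the kernel pair of a display, and reflexivity, as sequences of terms.\<close>

definition sw :: "nat \<Rightarrow> 'c expr list" where "sw n = Var 0 # map (weaken 1) (wk n)"

definition rl :: "nat \<Rightarrow> 'c expr list" where "rl n = Con \<r> [Var 0] # Var 0 # Var 0 # wk n"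

abbreviation "Idt A \<equiv> Con \<I> [weaken 2 A, Var 1, Var 0]"

definition ID where
  "ID q p1 p2 st r \<longleftrightarrow> (\<exists>\<Gamma> A. \<Gamma> \<turnstile> IsType A \<and> q = proj \<Gamma> A \<and> p1 = proj (A # \<Gamma>) (weaken 1 A) \<and>
     p2 = cls (weaken 1 A # A # \<Gamma>) (A # \<Gamma>) (sw (length \<Gamma>)) \<and> st = proj (weaken 1 A # A # \<Gamma>) (Idt A) \<and>
     r = cls (A # \<Gamma>) (id_ctx \<I> A @ \<Gamma>) (rl (length \<Gamma>)))"

lemma ID_E:
  assumes "ID q p1 p2 st r"
  obtains \<Gamma> A where "\<Gamma> \<turnstile> IsType A" "q = proj \<Gamma> A" "p1 = proj (A # \<Gamma>) (weaken 1 A)"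
     "p2 = cls (weaken 1 A # A # \<Gamma>) (A # \<Gamma>) (sw (length \<Gamma>))" "st = proj (weaken 1 A # A # \<Gamma>) (Idt A)"
     "r = cls (A # \<Gamma>) (id_ctx \<I> A @ \<Gamma>) (rl (length \<Gamma>))"
  using assms unfolding ID_def by blast

lemma subst_weaken2: "subst (sub 0 (a # b # s)) (weaken 2 e) = subst (sub 0 s) e"
proof -
  have "weaken 2 e = weaken (Suc 0) (weaken (Suc 0) e)" using weaken_weaken[of 1 1 e] by (simp add: numeral_2_eq_2)
  then show ?thesis by (simp only: subst_Cons_weaken)
qed

lemma subst_wk_weaken: "\<Gamma> \<turnstile> IsType A \<Longrightarrow> subst (sub 0 (wk (length \<Gamma>))) A = weaken 1 A"
  by (rule subst_wk) (rule scopedD(1))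

lemma cm_sw:
  assumes A: "\<Gamma> \<turnstile> IsType A" shows "cm (weaken 1 A # A # \<Gamma>) (A # \<Gamma>) (sw (length \<Gamma>))"
  using cm_lift[OF cm_wk[OF A] A] subst_wk_weaken[OF A] by (simp add: sw_def del: cm_Cons_iff)

lemma cm_rl:
  assumes A: "\<Gamma> \<turnstile> IsType A" shows "cm (A # \<Gamma>) (id_ctx \<I> A @ \<Gamma>) (rl (length \<Gamma>))"
proof -
  have v: "A # \<Gamma> \<turnstile> HasType (Var 0) (weaken 1 A)" using variable[OF A] .
  show ?thesis
    unfolding rl_def id_ctx_def
    using cm_wk[OF A] A id_types[OF A] v Id_intro[OF v] subst_wk_weaken[OF A]
    by (simp add: subst_Cons_weaken subst_weaken2)
qed

lemma id_ctx_append: "id_ctx \<I> A @ \<Gamma> = Idt A # weaken 1 A # A # \<Gamma>"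
  by (simp add: id_ctx_def)

text \<open>The kernel pair is the pullback of the projection along itself, and
  \<open>weaken 1 A\<close> is the result of substituting that projection into
  \<open>A\<close>.\<close>

lemma ID_pullback_CC: "ID q p1 p2 st r \<Longrightarrow> is_pullback CC q q p1 p2"
proof (elim ID_E)
  fix \<Gamma> A assume A: "\<Gamma> \<turnstile> IsType A" and [simp]: "q = proj \<Gamma> A" "p1 = proj (A # \<Gamma>) (weaken 1 A)"
    "p2 = cls (weaken 1 A # A # \<Gamma>) (A # \<Gamma>) (sw (length \<Gamma>))"
  show ?thesis
    using CC.pullback_sym[OF proj_pullback[OF cm_wk[OF A] A]] subst_wk_weaken[OF A] by (simp add: proj_def sw_def)
qed

lemma ID_refl: "ID q p1 p2 st r \<Longrightarrow> r \<in> Hom CC (Dom CC q) (Dom CC st) \<and>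
  Comp CC p1 (Comp CC st r) = Ident CC (Dom CC q) \<and> Comp CC p2 (Comp CC st r) = Ident CC (Dom CC q)"
proof (elim ID_E)
  fix \<Gamma> A assume A: "\<Gamma> \<turnstile> IsType A" and q: "q = proj \<Gamma> A" and p1: "p1 = proj (A # \<Gamma>) (weaken 1 A)"
    and p2: "p2 = cls (weaken 1 A # A # \<Gamma>) (A # \<Gamma>) (sw (length \<Gamma>))" and st: "st = proj (weaken 1 A # A # \<Gamma>) (Idt A)"
    and r: "r = cls (A # \<Gamma>) (id_ctx \<I> A @ \<Gamma>) (rl (length \<Gamma>))"
  note T = id_types[OF A]
  let ?w = "wk (length \<Gamma>)"
  have c3: "cm (A # \<Gamma>) (Idt A # weaken 1 A # A # \<Gamma>) (Con \<r> [Var 0] # Var 0 # Var 0 # ?w)"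
    using cm_rl[OF A] by (simp only: id_ctx_append rl_def)
  have c2: "cm (A # \<Gamma>) (weaken 1 A # A # \<Gamma>) (Var 0 # Var 0 # ?w)" and c1: "cm (A # \<Gamma>) (A # \<Gamma>) (Var 0 # ?w)"
    and t3: "A # \<Gamma> \<turnstile> HasType (Con \<r> [Var 0]) (subst (sub 0 (Var 0 # Var 0 # ?w)) (Idt A))"
    and t2: "A # \<Gamma> \<turnstile> HasType (Var 0) (subst (sub 0 (Var 0 # ?w)) (weaken 1 A))"
    using c3 unfolding cm_Cons_iff by blast+
  have i: "Ident CC (ob (A # \<Gamma>)) = cls (A # \<Gamma>) (A # \<Gamma>) (Var 0 # ?w)"
  proof -
    have "(ids (length (A # \<Gamma>)) :: 'c expr list) = Var 0 # ?w" using ids_Suc by (simp del: upt_Suc)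
    then show ?thesis using Ident_ob[of "A # \<Gamma>"] A context_wf[OF A] by (simp del: upt_Suc)
  qed
  have 1: "Comp CC st r = cls (A # \<Gamma>) (weaken 1 A # A # \<Gamma>) (Var 0 # Var 0 # ?w)"
    unfolding st r id_ctx_append rl_def by (rule proj_comp[OF c2 T(2) t3])
  have 2: "Comp CC p1 (Comp CC st r) = Ident CC (ob (A # \<Gamma>))"
    unfolding 1 p1 i by (rule proj_comp[OF c1 T(1) t2])
  have "scomp (sw (length \<Gamma>)) (Var 0 # Var 0 # ?w) = Var 0 # ?w"
    unfolding sw_def by (simp add: scomp_Cons_weaken scomp_wk_Cons del: map_map)
  then have 3: "Comp CC p2 (Comp CC st r) = Ident CC (ob (A # \<Gamma>))"
    unfolding 1 p2 i using Comp_cls[OF c2 cm_sw[OF A]] by (simp only:)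
  have "r \<in> Hom CC (ob (A # \<Gamma>)) (ob (id_ctx \<I> A @ \<Gamma>))" unfolding r by (rule cls_Hom[OF cm_rl[OF A]])
  then show ?thesis using 2 3 proj_type[OF A] proj_type[OF T(2)] unfolding q st id_ctx_append by simp
qed

text \<open>Every component is built by operations that commute with substitution. Lifting
  \<open>t\<close> once, twice and three times gives \<open>?e1\<close>, \<open>?e2\<close>,
  \<open>?e3\<close>, each the upper edge in the pullback of one projection; the square of path
  objects is the pasting of the three.\<close>

lemma ID_stable:
  assumes "ID q p1 p2 st r" "g \<in> Arr CC" "Cod CC g = Cod CC q"
  shows "\<exists>q' p1' p2' st' r' e \<pi>. ID q' p1' p2' st' r' \<and> is_pullback CC q g e q' \<and>
         is_pullback CC (Comp CC q (Comp CC p1 st)) g \<pi> (Comp CC q' (Comp CC p1' st')) \<and>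
         Comp CC p1 (Comp CC st \<pi>) = Comp CC e (Comp CC p1' st') \<and>
         Comp CC p2 (Comp CC st \<pi>) = Comp CC e (Comp CC p2' st') \<and> Comp CC \<pi> r' = Comp CC r e"
proof -
  obtain \<Gamma> A where A: "\<Gamma> \<turnstile> IsType A" and q: "q = proj \<Gamma> A" and p1: "p1 = proj (A # \<Gamma>) (weaken 1 A)"
    and p2: "p2 = cls (weaken 1 A # A # \<Gamma>) (A # \<Gamma>) (sw (length \<Gamma>))" and st: "st = proj (weaken 1 A # A # \<Gamma>) (Idt A)"
    and r: "r = cls (A # \<Gamma>) (id_ctx \<I> A @ \<Gamma>) (rl (length \<Gamma>))" using assms(1) by (rule ID_E)
  note T = id_types[OF A]
  obtain \<Theta> \<Gamma>' t' where t': "cm \<Theta> \<Gamma>' t'" "g = cls \<Theta> \<Gamma>' t'" using assms(2) by (rule ArrE)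
  have "g \<in> Hom CC (ob \<Theta>) (ob \<Gamma>)" using assms(2,3) t' q A by simp
  then obtain t where t: "cm \<Theta> \<Gamma> t" and g: "g = cls \<Theta> \<Gamma> t" using HomE cmD[OF t'(1)] context_wf[OF A] by metis
  define B where "B = subst (sub 0 t) A"
  have B: "\<Theta> \<turnstile> IsType B" unfolding B_def by (rule subst_IsType[OF t A])
  note TB = id_types[OF B]
  let ?e1 = "Var 0 # map (weaken 1) t"
  let ?e2 = "Var 0 # map (weaken 1) ?e1"
  let ?e3 = "Var 0 # map (weaken 1) ?e2"
  have tw: "map (subst (sub 0 (wk (length \<Theta>)))) t = map (weaken 1) t"
    by (intro map_cong refl subst_wk cm_scoped[OF t])
  have lt: "length t = length \<Gamma>" using cmD[OF t] by simp
  have wA: "subst (sub 0 (map (weaken 1) t)) A = weaken 1 B"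
    unfolding B_def subst_subst using lt by (intro scoped_cong[OF scopedD(1)[OF A]]) auto
  have c1: "cm (B # \<Theta>) (A # \<Gamma>) ?e1" unfolding B_def by (rule cm_lift[OF t A])
  have s1: "subst (sub 0 ?e1) (weaken 1 A) = weaken 1 B" using wA by (simp add: subst_Cons_weaken)
  have c2: "cm (weaken 1 B # B # \<Theta>) (weaken 1 A # A # \<Gamma>) ?e2"
    using cm_lift[OF c1 T(1)] unfolding s1 .
  have "subst (sub 0 ?e2) (weaken 2 A) = subst (sub 0 (map (weaken 1) (map (weaken 1) t))) A"
    by (simp add: subst_weaken2 del: map_map)
  also have "\<dots> = weaken 1 (subst (sub 0 (map (weaken 1) t)) A)"
    unfolding subst_subst using lt by (intro scoped_cong[OF scopedD(1)[OF A]]) auto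
  also have "\<dots> = weaken 2 B" unfolding wA weaken_weaken by (simp add: numeral_2_eq_2)
  finally have s2: "subst (sub 0 ?e2) (Idt A) = Idt B" by (simp add: sub_def)
  have c3: "cm (id_ctx \<I> B @ \<Theta>) (id_ctx \<I> A @ \<Gamma>) ?e3"
    using cm_lift[OF c2 T(2)] unfolding s2 id_ctx_append .
  note P1 = proj_pullback[OF t A, folded B_def g q]
  note P2 = proj_pullback[OF c1 T(1), unfolded s1, folded p1]
  note P3 = proj_pullback[OF c2 T(2), unfolded s2, folded st id_ctx_append]
  define e where "e = cls (B # \<Theta>) (A # \<Gamma>) ?e1"
  define e' where "e' = cls (weaken 1 B # B # \<Theta>) (weaken 1 A # A # \<Gamma>) ?e2"
  define \<pi> where "\<pi> = cls (id_ctx \<I> B @ \<Theta>) (id_ctx \<I> A @ \<Gamma>) ?e3"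
  define q' where "q' = proj \<Theta> B"
  define p1' where "p1' = proj (B # \<Theta>) (weaken 1 B)"
  define p2' where "p2' = cls (weaken 1 B # B # \<Theta>) (B # \<Theta>) (sw (length \<Theta>))"
  define st' where "st' = proj (weaken 1 B # B # \<Theta>) (Idt B)"
  define r' where "r' = cls (B # \<Theta>) (id_ctx \<I> B @ \<Theta>) (rl (length \<Theta>))"
  note P1 = P1[folded e_def q'_def] and P2 = P2[folded e_def e'_def p1'_def] and P3 = P3[folded e'_def \<pi>_def[unfolded id_ctx_append] st'_def]
  have I: "ID q' p1' p2' st' r'" unfolding ID_def q'_def p1'_def p2'_def st'_def r'_def using B by blast
  have P3: "is_pullback CC st e' \<pi> st'" using P3 unfolding \<pi>_def id_ctx_append by simp
  note [simp] = CC.pullbackD(1-4,6-8)[OF P1] CC.pullbackD(1-4,6-8)[OF P2] CC.pullbackD(1-4,6-8)[OF P3]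
  have [simp]: "Cod CC p1 = Dom CC q" "Cod CC st = Dom CC p1" "Cod CC p1' = Dom CC q'" "Cod CC st' = Dom CC p1'"
    unfolding p1 q st p1'_def q'_def st'_def using A T B TB by simp_all
  have [simp]: "p2 \<in> Arr CC" "Dom CC p2 = Dom CC p1" "Cod CC p2 = Dom CC q"
    unfolding p2 p1 q using cm_sw[OF A] A T by simp_all
  have [simp]: "p2' \<in> Arr CC" "Dom CC p2' = Dom CC p1'" "Cod CC p2' = Dom CC q'"
    unfolding p2'_def p1'_def q'_def using cm_sw[OF B] B TB by simp_all
  have 1: "is_pullback CC (Comp CC q (Comp CC p1 st)) g \<pi> (Comp CC q' (Comp CC p1' st'))"
    using CC.pullback_paste[OF CC.pullback_paste[OF P1 P2] P3] by simp
  have 2: "Comp CC p1 (Comp CC st \<pi>) = Comp CC e (Comp CC p1' st')"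
    using CC.pullbackD(9)[OF P3] CC.reassoc[OF CC.pullbackD(9)[OF P2], of st'] by simp
  have "scomp (sw (length \<Gamma>)) ?e2 = Var 0 # scomp (wk (length \<Gamma>)) (map (weaken 1) ?e1)"
    unfolding sw_def by (simp add: scomp_Cons_weaken del: map_map)
  also have "\<dots> = Var 0 # map (weaken 1) (map (weaken 1) t)"
    using lt by (simp add: scomp_wk_Cons del: map_map)
  also have "\<dots> = Var 0 # map (weaken 1) (scomp t (wk (length \<Theta>)))" unfolding tw ..
  also have "map (weaken 1) (scomp t (wk (length \<Theta>))) = scomp t (map (weaken 1) (wk (length \<Theta>)))"
    by (rule nth_equalityI, simp, simp add: subst_subst, rule scoped_cong[OF cm_scoped[OF t]]) auto
  also have "Var 0 # scomp t (map (weaken 1) (wk (length \<Theta>))) = scomp ?e1 (sw (length \<Theta>))"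
    unfolding sw_def by (simp add: scomp_Cons_weaken del: map_map)
  finally have "Comp CC p2 e' = Comp CC e p2'"
    unfolding p2 e'_def e_def p2'_def using Comp_cls[OF c2 cm_sw[OF A]] Comp_cls[OF cm_sw[OF B] c1] by (simp only:)
  then have 3: "Comp CC p2 (Comp CC st \<pi>) = Comp CC e (Comp CC p2' st')"
    using CC.pullbackD(9)[OF P3] CC.reassoc[of p2 e' "Comp CC e p2'" st'] by simp
  have "scomp (rl (length \<Gamma>)) ?e1 = Con \<r> [Var 0] # Var 0 # Var 0 # map (weaken 1) t"
    unfolding rl_def using lt by (simp add: scomp_wk_Cons del: map_map)
  moreover have "scomp ?e3 (rl (length \<Theta>)) = Con \<r> [Var 0] # Var 0 # Var 0 # scomp t (wk (length \<Theta>))"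
    unfolding rl_def by (simp add: scomp_Cons_weaken del: map_map) (simp add: sub_def)
  ultimately have 4: "Comp CC \<pi> r' = Comp CC r e"
    unfolding \<pi>_def r'_def r e_def using Comp_cls[OF cm_rl[OF B] c3] Comp_cls[OF c1 cm_rl[OF A]] tw by (simp only:)
  show ?thesis using I P1 1 2 3 4 by blast
qed

section \<open>Fibrations in canonical form, and the terminal object\<close>

interpretation IC: id_category CC ID by intro_locales

lemma display_iff: "q \<in> IC.display \<longleftrightarrow> (\<exists>\<Gamma> A. \<Gamma> \<turnstile> IsType A \<and> q = proj \<Gamma> A)"
  unfolding IC.display_def ID_def by blast

text \<open>Splits off the outermost type of \<open>\<Delta>\<close> instead of the innermost, in
  line with the generation of \<open>fib\<close>, where a new display is added at the base.\<close>

lemma pr_snoc: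
  assumes "wfc (\<Delta> @ A # \<Gamma>)"
  shows "pr (\<Delta> @ [A]) \<Gamma> = Comp CC (proj \<Gamma> A) (pr \<Delta> (A # \<Gamma>))"
proof -
  let ?k = "length \<Delta>" and ?n = "length \<Gamma>"
  have A: "\<Gamma> \<turnstile> IsType A" using wf_append[OF assms] by simp
  have e: "scomp (wk ?n) (map (weaken ?k) (ids (Suc ?n))) = map (weaken (Suc ?k)) (ids ?n)"
    by (rule nth_equalityI) (auto simp: sub_Nil simp del: upt_Suc)
  have c: "cm (\<Delta> @ A # \<Gamma>) (A # \<Gamma>) (map (weaken ?k) (ids (Suc ?n)))" using cm_pr[OF assms] by simp
  show ?thesis
    using Comp_cls[OF c cm_wk[OF A]] unfolding e pr_def proj_def by simp
qed

text \<open>The context \<open>\<Gamma>\<close> is prescribed because the rules apply only to a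
  parameter over the literal context \<open>id_ctx\<close>. At each step the display nearest to the
  base is converted to the prescribed representative.\<close>

lemma fib_canonical:
  "\<lbrakk>f \<in> IC.fib; wfc \<Gamma>; Cod CC f = ob \<Gamma>\<rbrakk> \<Longrightarrow> \<exists>\<Delta> \<phi>. wfc (\<Delta> @ \<Gamma>) \<and> is_iso CC \<phi> \<and>
     \<phi> \<in> Hom CC (Dom CC f) (ob (\<Delta> @ \<Gamma>)) \<and> f = Comp CC (pr \<Delta> \<Gamma>) \<phi>"
proof (induction arbitrary: \<Gamma> rule: IC.fib.induct)
  case (iso f)
  then have "f \<in> Arr CC" unfolding is_iso_def by blast
  then show ?case using iso pr_Nil[of \<Gamma>] by (intro exI[of _ "[]"] exI[of _ f]) auto
next
  case (step q f)
  obtain \<Gamma>0 A where A0: "\<Gamma>0 \<turnstile> IsType A" and q: "q = proj \<Gamma>0 A" using step.hyps(1) display_iff by blast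
  have w0: "wfc \<Gamma>0" using context_wf[OF A0] .
  have "ob \<Gamma>0 = ob \<Gamma>" using step.prems step.hyps A0 q by simp
  then have c: "(\<Gamma>0, \<Gamma>) \<in> cr" using ob_eq[OF w0 step.prems(1)] by blast
  have A: "\<Gamma> \<turnstile> IsType A" using ctx_conversion[OF c A0] .
  have c': "(A # \<Gamma>0, A # \<Gamma>) \<in> cr" using c A A0 type_refl[OF A0] by (simp add: cr_Cons)
  have q': "q = proj \<Gamma> A"
    unfolding q proj_def using cls_eq[OF cm_wk[OF A0] cm_wk[OF A]] c c' crD[OF c] eqs_refl[OF cm_wk[OF A0]] by simp
  have w: "wfc (A # \<Gamma>)" using A step.prems(1) by simp
  have "Cod CC f = ob (A # \<Gamma>)" using step.hyps(5) A unfolding q' by simp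
  then obtain \<Delta> \<phi> where \<phi>: "wfc (\<Delta> @ A # \<Gamma>)" "is_iso CC \<phi>" "\<phi> \<in> Hom CC (Dom CC f) (ob (\<Delta> @ A # \<Gamma>))"
    "f = Comp CC (pr \<Delta> (A # \<Gamma>)) \<phi>" using step.IH[OF w] by blast
  have "Comp CC q f = Comp CC (pr (\<Delta> @ [A]) \<Gamma>) \<phi>"
    unfolding q' pr_snoc[OF \<phi>(1)] using \<phi> A by simp
  then show ?case using \<phi>(1-3) step.hyps by (intro exI[of _ "\<Delta> @ [A]"] exI[of _ \<phi>]) auto
qed

lemma pr_fib: "wfc (\<Delta> @ \<Gamma>) \<Longrightarrow> pr \<Delta> \<Gamma> \<in> IC.fib"
proof (induction \<Delta> arbitrary: \<Gamma> rule: rev_induct)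
  case Nil
  then show ?case using pr_Nil CC.iso_ident IC.fib.iso by simp
next
  case (snoc A \<Delta>)
  then have w: "wfc (\<Delta> @ A # \<Gamma>)" by simp
  have A: "\<Gamma> \<turnstile> IsType A" using wf_append[OF w] by simp
  have "proj \<Gamma> A \<in> IC.display" using A display_iff by blast
  then show ?case unfolding pr_snoc[OF w] using snoc.IH[OF w] w A by (intro IC.fib.step) auto
qed

lemma terminal: "is_terminal CC (ob []) \<and> (\<forall>X \<in> Obj CC. Hom CC X (ob []) \<subseteq> IC.fib)"
proof -
  have H: "f = pr \<Gamma> []" if f: "f \<in> Hom CC (ob \<Gamma>) (ob [])" and \<Gamma>: "wfc \<Gamma>" for f \<Gamma>
  proof -
    obtain t where "cm \<Gamma> [] t" "f = cls \<Gamma> [] t" by (rule HomE[OF f \<Gamma> wf_Nil])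
    then show ?thesis by (simp add: pr_def)
  qed
  have P: "pr \<Gamma> [] \<in> Hom CC (ob \<Gamma>) (ob [])" if "wfc \<Gamma>" for \<Gamma> using that pr_type[of \<Gamma> "[]"] by simp
  have "\<exists>!f. f \<in> Hom CC X (ob [])" "Hom CC X (ob []) \<subseteq> IC.fib" if X: "X \<in> Obj CC" for X
  proof -
    obtain \<Gamma> where \<Gamma>: "wfc \<Gamma>" "X = ob \<Gamma>" using X Obj_iff by auto
    show "\<exists>!f. f \<in> Hom CC X (ob [])" using H[OF _ \<Gamma>(1)] P[OF \<Gamma>(1)] unfolding \<Gamma>(2) by blast
    show "Hom CC X (ob []) \<subseteq> IC.fib" using H[OF _ \<Gamma>(1)] pr_fib[of \<Gamma> "[]"] \<Gamma> by auto
  qed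
  then show ?thesis unfolding is_terminal_def using Obj_ob[OF wf_Nil] by blast
qed

text \<open>The elimination rule for a parameter that is literally a context
  \<open>\<Delta>\<close>. The type eliminated into is \<open>C\<close>, which is \<open>B\<close>
  at \<open>\<mu>\<close>; a term \<open>j\<close> of it is the same as a lift
  \<open>j # \<mu>\<close> through the projection of \<open>B\<close>.\<close>

lemma elim_can:
  assumes A: "\<Gamma> \<turnstile> IsType A" and Y: "wfc (\<Delta> @ id_ctx \<I> A @ \<Gamma>)" and B: "\<Theta> \<turnstile> IsType B"
    and \<mu>: "cm (\<Delta> @ id_ctx \<I> A @ \<Gamma>) \<Theta> \<mu>"
    and X: "X = inst_ctx (sub 0 (rl (length \<Gamma>))) \<Delta> @ A # \<Gamma>" and E: "E = lift_tms (length \<Delta>) (rl (length \<Gamma>))"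
    and d: "d \<in> Hom CC (ob X) (ob (B # \<Theta>))"
      "Comp CC (proj \<Theta> B) d = Comp CC (cls (\<Delta> @ id_ctx \<I> A @ \<Gamma>) \<Theta> \<mu>) (cls X (\<Delta> @ id_ctx \<I> A @ \<Gamma>) E)"
  shows "\<exists>j h. j \<in> Hom CC (ob (\<Delta> @ id_ctx \<I> A @ \<Gamma>)) (ob (B # \<Theta>)) \<and>
    Comp CC (proj \<Theta> B) j = cls (\<Delta> @ id_ctx \<I> A @ \<Gamma>) \<Theta> \<mu> \<and> h \<in> Hom CC (ob X) (ob (id_ctx \<I> B @ \<Theta>)) \<and>
    Comp CC (proj (B # \<Theta>) (weaken 1 B)) (Comp CC (proj (weaken 1 B # B # \<Theta>) (Idt B)) h) =
      Comp CC j (cls X (\<Delta> @ id_ctx \<I> A @ \<Gamma>) E) \<and>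
    Comp CC (cls (weaken 1 B # B # \<Theta>) (B # \<Theta>) (sw (length \<Theta>))) (Comp CC (proj (weaken 1 B # B # \<Theta>) (Idt B)) h) = d"
proof -
  let ?Y = "\<Delta> @ id_ctx \<I> A @ \<Gamma>" and ?n = "length \<Gamma>"
  have cE: "cm X ?Y E" unfolding X E by (rule cm_ext[OF Y cm_rl[OF A]])
  have wX: "wfc X" using cmD[OF cE] by blast
  note TB = id_types[OF B]
  have lr: "length (rl ?n) = ?n + 3" by (simp add: rl_def)
  \<comment> \<open>The sequence representing reflexivity and the substitution used in the rules
    differ only on variables out of scope.\<close>
  have rl_eq: "sub 0 (rl ?n) i = at_refl \<r> i" if "i < ?n + 3" for i
  proof (cases "i < 3")
    case True
    then have "i = 0 \<or> i = 1 \<or> i = 2" by auto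
    then show ?thesis by (auto simp: rl_def sub_def)
  next
    case False
    then obtain k where "i = k + 3" by (metis add.commute le_Suc_ex not_less)
    then show ?thesis using that by (simp add: rl_def sub_def nth_Cons')
  qed
  have X': "X = inst_ctx (at_refl \<r>) \<Delta> @ A # \<Gamma>"
    unfolding X using inst_ctx_cong[OF _ rl_eq] wf_scoped_tel[OF Y] by (simp add: add.commute)
  have ER: "subst (sub 0 E) e = inst (length \<Delta>) (at_refl \<r>) e" if "scoped (length ?Y) e" for e
  proof -
    have "scoped (length \<Delta> + length (rl ?n)) e" using that lr by (simp add: add.commute add.left_commute)
    then show ?thesis unfolding E using sub_ext[of "length \<Delta>" "rl ?n" e] scoped_inst_cong[of "length \<Delta>" "?n + 3" e _ "at_refl \<r>", OF _ rl_eq] lr by simp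
  qed
  obtain \<delta> \<nu> where \<nu>: "cm X \<Theta> \<nu>" "X \<turnstile> HasType \<delta> (subst (sub 0 \<nu>) B)" "d = cls X (B # \<Theta>) (\<delta> # \<nu>)"
    by (rule HomE_Cons[OF d(1) wX B])
  note c\<mu> = cm_comp[OF cE \<mu>]
  have eq: "eqs X \<Theta> \<nu> (scomp \<mu> E)"
    using d(2) proj_comp[OF \<nu>(1) B \<nu>(2)] Comp_cls[OF cE \<mu>] cls_eq1[OF \<nu>(1) c\<mu>] \<nu>(3) by simp
  define C where "C = subst (sub 0 \<mu>) B"
  have C: "?Y \<turnstile> IsType C" unfolding C_def by (rule subst_IsType[OF \<mu> B])
  have CE: "subst (sub 0 E) C = subst (sub 0 (scomp \<mu> E)) B"
    unfolding C_def using scopedD(1)[OF B] cmD[OF \<mu>] by (intro subst_scomp) simp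
  \<comment> \<open>\<open>d\<close> lies over \<open>scomp \<mu> E\<close> only up to definitional
    equality; its term is converted to the type that elimination expects.\<close>
  have \<delta>: "X \<turnstile> HasType \<delta> (subst (sub 0 E) C)"
    unfolding CE using term_conv[OF \<nu>(2) simultaneous_cong(1)[OF \<nu>(1) c\<mu> eq B]] .
  have CR: "subst (sub 0 E) C = inst (length \<Delta>) (at_refl \<r>) C" using ER[OF scopedD(1)[OF C]] .
  obtain j h where j: "?Y \<turnstile> HasType j C"
    and h: "X \<turnstile> HasType h (Con \<I> [subst (sub 0 E) C, inst (length \<Delta>) (at_refl \<r>) j, \<delta>])"
    using J_generic[OF A C, of \<delta>] \<delta> unfolding X' CR by metis
  let ?j = "subst (sub 0 E) j"
  have h: "X \<turnstile> HasType h (Con \<I> [subst (sub 0 E) C, ?j, \<delta>])" using h ER[OF scopedD(2)[OF j]] by simp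
  have jE: "X \<turnstile> HasType ?j (subst (sub 0 (scomp \<mu> E)) B)" using simultaneous_subst[OF j cE] CE by simp
  have cj: "cm ?Y (B # \<Theta>) (j # \<mu>)" using \<mu> B j C_def by simp
  have \<delta>2: "X \<turnstile> HasType \<delta> (subst (sub 0 (?j # scomp \<mu> E)) (weaken 1 B))"
    using \<delta> CE by (simp add: subst_Cons_weaken)
  have h3: "X \<turnstile> HasType h (subst (sub 0 (\<delta> # ?j # scomp \<mu> E)) (Idt B))"
    using h CE by (simp add: subst_weaken2)
  have c1: "cm X (B # \<Theta>) (?j # scomp \<mu> E)" using c\<mu> B jE by simp
  have c2: "cm X (weaken 1 B # B # \<Theta>) (\<delta> # ?j # scomp \<mu> E)" using c1 TB(1) \<delta>2 unfolding cm_Cons_iff by blast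
  have c3: "cm X (id_ctx \<I> B @ \<Theta>) (h # \<delta> # ?j # scomp \<mu> E)"
    unfolding id_ctx_append using c2 TB(2) h3 unfolding cm_Cons_iff by blast
  have 1: "Comp CC (proj (weaken 1 B # B # \<Theta>) (Idt B)) (cls X (id_ctx \<I> B @ \<Theta>) (h # \<delta> # ?j # scomp \<mu> E)) =
      cls X (weaken 1 B # B # \<Theta>) (\<delta> # ?j # scomp \<mu> E)"
    unfolding id_ctx_append by (rule proj_comp[OF c2 TB(2) h3])
  have 2: "Comp CC (proj (B # \<Theta>) (weaken 1 B)) (cls X (weaken 1 B # B # \<Theta>) (\<delta> # ?j # scomp \<mu> E)) =
      Comp CC (cls ?Y (B # \<Theta>) (j # \<mu>)) (cls X ?Y E)"
    using proj_comp[OF c1 TB(1) \<delta>2] Comp_cls[OF cE cj] by simp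
  have ls: "length (scomp \<mu> E) = length \<Theta>" using cmD[OF \<mu>] by simp
  have "scomp (sw (length \<Theta>)) (\<delta> # ?j # scomp \<mu> E) = \<delta> # scomp \<mu> E"
    unfolding sw_def using scomp_wk_Cons[OF ls] by (simp add: scomp_Cons_weaken del: map_map)
  then have "Comp CC (cls (weaken 1 B # B # \<Theta>) (B # \<Theta>) (sw (length \<Theta>))) (cls X (weaken 1 B # B # \<Theta>) (\<delta> # ?j # scomp \<mu> E)) =
      cls X (B # \<Theta>) (\<delta> # scomp \<mu> E)"
    using Comp_cls[OF c2 cm_sw[OF B]] by (simp only:)
  also have "\<dots> = d"
    using cls_eq1[of X "B # \<Theta>" "\<delta> # \<nu>" "\<delta> # scomp \<mu> E"] \<nu> B c\<mu> \<delta> CE eq term_refl[OF \<nu>(2)]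
    by (simp add: eqs_Cons)
  finally have 3: "Comp CC (cls (weaken 1 B # B # \<Theta>) (B # \<Theta>) (sw (length \<Theta>)))
      (cls X (weaken 1 B # B # \<Theta>) (\<delta> # ?j # scomp \<mu> E)) = d" .
  have 4: "Comp CC (proj \<Theta> B) (cls ?Y (B # \<Theta>) (j # \<mu>)) = cls ?Y \<Theta> \<mu>"
    by (rule proj_comp[OF \<mu> B]) (use j C_def in simp)
  show ?thesis
    using cls_Hom[OF cj] cls_Hom[OF c3] 1 2 3 4
    by (intro exI[of _ "cls ?Y (B # \<Theta>) (j # \<mu>)"] exI[of _ "cls X (id_ctx \<I> B @ \<Theta>) (h # \<delta> # ?j # scomp \<mu> E)"]) (simp only: simp_thms)
qed

text \<open>Reduction to the canonical case: \<open>y\<close> is a dependent projection after an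
  isomorphism \<open>\<phi>\<close>, and the given pullback \<open>k\<close> is compared with the
  one formed by substitution, \<open>kc\<close>, through \<open>\<psi>\<close> and
  \<open>\<psi>'\<close>. The problem is carried over along \<open>\<phi>'\<close> and
  \<open>\<psi>\<close>, the solution back along \<open>\<phi>\<close> and
  \<open>\<psi>'\<close>.\<close>

lemma ID_elim:
  assumes I: "ID q p1 p2 st r" and y: "y \<in> IC.fib" and k: "is_pullback CC y r k x" and I': "ID z p1' p2' st' r'"
    and m: "m \<in> Hom CC (Dom CC y) (Cod CC z)" and d: "d \<in> Hom CC (Dom CC k) (Dom CC z)" and e: "Comp CC z d = Comp CC m k"
  shows "\<exists>j h. j \<in> Hom CC (Dom CC y) (Dom CC z) \<and> Comp CC z j = m \<and> h \<in> Hom CC (Dom CC k) (Dom CC st') \<and>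
         Comp CC p1' (Comp CC st' h) = Comp CC j k \<and> Comp CC p2' (Comp CC st' h) = d"
proof -
  obtain \<Gamma> A where A: "\<Gamma> \<turnstile> IsType A" and r: "r = cls (A # \<Gamma>) (id_ctx \<I> A @ \<Gamma>) (rl (length \<Gamma>))"
    using I by (rule ID_E)
  obtain \<Theta> B where B: "\<Theta> \<turnstile> IsType B" and z: "z = proj \<Theta> B" and p1': "p1' = proj (B # \<Theta>) (weaken 1 B)"
    and p2': "p2' = cls (weaken 1 B # B # \<Theta>) (B # \<Theta>) (sw (length \<Theta>))" and st': "st' = proj (weaken 1 B # B # \<Theta>) (Idt B)"
    using I' by (rule ID_E)
  note TB = id_types[OF B]
  let ?G = "id_ctx \<I> A @ \<Gamma>"
  note wG = wf_id_ctx[OF A] and cr = cm_rl[OF A]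
  note [simp] = CC.pullbackD(1-4,6-8)[OF k] proj_type[OF B] proj_type[OF TB(1)] proj_type[OF TB(2)] cls_type[OF cr]
  have "Cod CC y = ob ?G" using CC.pullbackD(5)[OF k] r by simp
  then obtain \<Delta> \<phi> where \<phi>: "wfc (\<Delta> @ ?G)" "is_iso CC \<phi>" "\<phi> \<in> Hom CC (Dom CC y) (ob (\<Delta> @ ?G))" "y = Comp CC (pr \<Delta> ?G) \<phi>"
    using fib_canonical[OF y wG] by blast
  obtain \<phi>' where \<phi>': "\<phi>' \<in> Arr CC" "Dom CC \<phi>' = Cod CC \<phi>" "Cod CC \<phi>' = Dom CC \<phi>"
    "Comp CC \<phi>' \<phi> = Ident CC (Dom CC \<phi>)" "Comp CC \<phi> \<phi>' = Ident CC (Cod CC \<phi>)" using \<phi>(2) by (rule CC.isoE)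
  define X where "X = inst_ctx (sub 0 (rl (length \<Gamma>))) \<Delta> @ A # \<Gamma>"
  define E where "E = lift_tms (length \<Delta>) (rl (length \<Gamma>))"
  define kc where "kc = cls X (\<Delta> @ ?G) E"
  define xc where "xc = pr (inst_ctx (sub 0 (rl (length \<Gamma>))) \<Delta>) (A # \<Gamma>)"
  have Pc: "is_pullback CC (pr \<Delta> ?G) r kc xc"
    unfolding r kc_def xc_def X_def E_def by (rule pr_pullback[OF \<phi>(1) cr])
  have cE: "cm X (\<Delta> @ ?G) E" unfolding X_def E_def by (rule cm_ext[OF \<phi>(1) cr])
  note [simp] = \<phi>(3)[unfolded CC.in_Hom] \<phi>'(1,2,3) CC.pullbackD(1,3,4,7)[OF Pc] pr_type[OF \<phi>(1)]
  have [simp]: "Dom CC kc = ob X" "Dom CC xc = ob X" "Cod CC kc = ob (\<Delta> @ ?G)"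
    using CC.pullbackD(8)[OF Pc] cls_type[OF cE] by (simp_all add: kc_def)
  have "Comp CC y (Comp CC \<phi>' kc) = Comp CC (pr \<Delta> ?G) kc"
    using CC.reassoc[OF \<phi>'(5), of kc] unfolding \<phi>(4) by simp
  then have "Comp CC y (Comp CC \<phi>' kc) = Comp CC r xc" using CC.pullbackD(9)[OF Pc] by simp
  then obtain \<psi> where \<psi>: "\<psi> \<in> Hom CC (ob X) (Dom CC k)" "Comp CC k \<psi> = Comp CC \<phi>' kc" "Comp CC x \<psi> = xc"
    using CC.pullback_lift[OF k, of "Comp CC \<phi>' kc" "ob X" xc] by auto
  have "Comp CC (pr \<Delta> ?G) (Comp CC \<phi> k) = Comp CC y k" unfolding \<phi>(4) by simp
  then have "Comp CC (pr \<Delta> ?G) (Comp CC \<phi> k) = Comp CC r x" using CC.pullbackD(9)[OF k] by simp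
  then obtain \<psi>' where \<psi>': "\<psi>' \<in> Hom CC (Dom CC k) (ob X)" "Comp CC kc \<psi>' = Comp CC \<phi> k" "Comp CC xc \<psi>' = x"
    using CC.pullback_lift[OF Pc, of "Comp CC \<phi> k" "Dom CC k" x] by auto
  note [simp] = \<psi>(1)[unfolded CC.in_Hom] \<psi>'(1)[unfolded CC.in_Hom]
  have inv: "Comp CC \<psi> \<psi>' = Ident CC (Dom CC k)"
    using CC.reassoc[OF \<psi>(2), of \<psi>'] CC.reassoc[OF \<psi>(3), of \<psi>'] \<psi>'(2,3) CC.reassoc[OF \<phi>'(4), of k]
    by - (rule CC.pullback_eq[OF k, of _ "Dom CC k"]; simp)
  have [simp]: "m \<in> Arr CC" "Dom CC m = Dom CC y" "Cod CC m = ob \<Theta>" "d \<in> Arr CC" "Dom CC d = Dom CC k" "Cod CC d = ob (B # \<Theta>)"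
    using m d unfolding z by auto
  have w\<Theta>: "wfc \<Theta>" using context_wf[OF B] .
  have "Comp CC m \<phi>' \<in> Hom CC (ob (\<Delta> @ ?G)) (ob \<Theta>)" by simp
  then obtain \<mu> where \<mu>: "cm (\<Delta> @ ?G) \<Theta> \<mu>" "Comp CC m \<phi>' = cls (\<Delta> @ ?G) \<Theta> \<mu>"
    using HomE[OF _ \<phi>(1) w\<Theta>] by blast
  have "Comp CC (proj \<Theta> B) (Comp CC d \<psi>) = Comp CC (Comp CC m k) \<psi>"
    using CC.reassoc[OF e, of \<psi>] unfolding z by simp
  also have "\<dots> = Comp CC (cls (\<Delta> @ ?G) \<Theta> \<mu>) kc" unfolding \<mu>(2)[symmetric] using \<psi>(2) by simp
  finally have "\<exists>j h. j \<in> Hom CC (ob (\<Delta> @ ?G)) (ob (B # \<Theta>)) \<and>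
    Comp CC z j = cls (\<Delta> @ ?G) \<Theta> \<mu> \<and> h \<in> Hom CC (ob X) (ob (id_ctx \<I> B @ \<Theta>)) \<and>
    Comp CC p1' (Comp CC st' h) = Comp CC j kc \<and> Comp CC p2' (Comp CC st' h) = Comp CC d \<psi>"
    unfolding z p1' p2' st' kc_def by (intro elim_can[OF A \<phi>(1) B \<mu>(1) X_def E_def]) (auto simp: kc_def)
  then obtain j h where j: "j \<in> Hom CC (ob (\<Delta> @ ?G)) (ob (B # \<Theta>))" "Comp CC z j = Comp CC m \<phi>'"
    and h: "h \<in> Hom CC (ob X) (ob (id_ctx \<I> B @ \<Theta>))" "Comp CC p1' (Comp CC st' h) = Comp CC j kc"
      "Comp CC p2' (Comp CC st' h) = Comp CC d \<psi>"
    using \<mu>(2) by auto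
  note [simp] = j(1)[unfolded CC.in_Hom] h(1)[unfolded CC.in_Hom]
  have [simp]: "z \<in> Arr CC" "Dom CC z = ob (B # \<Theta>)" "st' \<in> Arr CC" "Dom CC st' = ob (id_ctx \<I> B @ \<Theta>)"
    "Cod CC st' = ob (weaken 1 B # B # \<Theta>)" "p1' \<in> Arr CC" "Dom CC p1' = ob (weaken 1 B # B # \<Theta>)"
    "p2' \<in> Arr CC" "Dom CC p2' = ob (weaken 1 B # B # \<Theta>)"
    unfolding z st' p1' p2' id_ctx_append
    using cls_type[OF cm_sw[OF B]] proj_type[OF B] proj_type[OF TB(1)] proj_type[OF TB(2)] by simp_all
  have "Comp CC z (Comp CC j \<phi>) = m"
    using CC.reassoc[OF j(2), of \<phi>] \<phi>'(4) by simp
  moreover have "Comp CC p1' (Comp CC st' (Comp CC h \<psi>')) = Comp CC (Comp CC j \<phi>) k"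
    using arg_cong[OF h(2), of "\<lambda>f. Comp CC f \<psi>'"] \<psi>'(2) by simp
  moreover have "Comp CC p2' (Comp CC st' (Comp CC h \<psi>')) = d"
    using arg_cong[OF h(3), of "\<lambda>f. Comp CC f \<psi>'"] inv by simp
  moreover have "Comp CC j \<phi> \<in> Hom CC (Dom CC y) (Dom CC z)" "Comp CC h \<psi>' \<in> Hom CC (Dom CC k) (Dom CC st')"
    by simp_all
  ultimately show ?thesis by blast
qed

section \<open>The classifying category as an instance of the axioms\<close>

interpretation PC: id_display_category CC ID
proof
  fix q p1 p2 st r assume I: "ID q p1 p2 st r"
  show "is_pullback CC q q p1 p2" by (rule ID_pullback_CC[OF I])
  show "r \<in> Hom CC (Dom CC q) (Dom CC st) \<and> Comp CC p1 (Comp CC st r) = Ident CC (Dom CC q) \<and> Comp CC p2 (Comp CC st r) = Ident CC (Dom CC q)"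
    by (rule ID_refl[OF I])
  obtain \<Gamma> A where A: "\<Gamma> \<turnstile> IsType A" and q: "p1 = proj (A # \<Gamma>) (weaken 1 A)" "st = proj (weaken 1 A # A # \<Gamma>) (Idt A)"
    using I by (rule ID_E)
  show "st \<in> IC.display \<and> st \<in> Arr CC \<and> Cod CC st = Dom CC p1"
    using display_iff id_types[OF A] unfolding q by auto
next
  show "\<exists>T. is_terminal CC T \<and> (\<forall>X \<in> Obj CC. Hom CC X T \<subseteq> IC.fib)"
    using terminal by blast
qed (rule ID_stable ID_elim; assumption)+

text \<open>A map isomorphic to a dependent projection \<open>p\<close> has the form
  \<open>j' p i\<close> with isomorphisms \<open>i\<close> and \<open>j'\<close>, and
  \<open>fib\<close> is closed under composition. Conversely the canonical form shows a member of
  \<open>fib\<close> to be isomorphic to a dependent projection, with the identity at the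
  target.\<close>

lemma fibrations_eq: "fibrations (\<turnstile>) = IC.fib"
proof (intro equalityI subsetI)
  have pr: "pr \<Delta> \<Gamma> = cls (\<Delta> @ \<Gamma>) \<Gamma> (map Var [length \<Delta>..<length \<Delta> + length \<Gamma>])" for \<Delta> \<Gamma>
    unfolding pr_def weaken_ids ..
  {
    fix f assume f: "f \<in> IC.fib"
    have fA: "f \<in> Arr CC" by (rule PC.fib_Arr[OF f])
    then obtain \<Delta>' \<Gamma> t where "cm \<Delta>' \<Gamma> t" "f = cls \<Delta>' \<Gamma> t" by (rule ArrE)
    then have \<Gamma>: "wfc \<Gamma>" "Cod CC f = ob \<Gamma>" using cmD by auto
    obtain \<Delta> \<phi> where \<phi>: "wfc (\<Delta> @ \<Gamma>)" "is_iso CC \<phi>" "\<phi> \<in> Hom CC (Dom CC f) (ob (\<Delta> @ \<Gamma>))" "f = Comp CC (pr \<Delta> \<Gamma>) \<phi>"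
      using fib_canonical[OF f \<Gamma>] by blast
    have "dependent_projection (\<turnstile>) (pr \<Delta> \<Gamma>)" unfolding dependent_projection_def pr using \<phi>(1) by blast
    moreover have "is_iso CC (Ident CC (ob \<Gamma>))" using \<Gamma>(1) by (simp add: CC.iso_ident)
    moreover have "\<phi> \<in> Hom CC (Dom CC f) (Dom CC (pr \<Delta> \<Gamma>))" using \<phi>(1,3) by simp
    moreover have "Ident CC (ob \<Gamma>) \<in> Hom CC (Cod CC f) (Cod CC (pr \<Delta> \<Gamma>))" using \<phi>(1) \<Gamma> by simp
    moreover have "Comp CC (pr \<Delta> \<Gamma>) \<phi> = Comp CC (Ident CC (ob \<Gamma>)) f"
      using fA \<Gamma>(2) unfolding \<phi>(4)[symmetric] by simp
    ultimately show "f \<in> fibrations (\<turnstile>)"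
      unfolding fibrations_def using fA \<phi>(2) by blast
  }
  fix f assume "f \<in> fibrations (\<turnstile>)"
  then obtain p i j where f: "f \<in> Arr CC" and p: "dependent_projection (\<turnstile>) p" and i: "is_iso CC i" and j: "is_iso CC j"
    and H: "i \<in> Hom CC (Dom CC f) (Dom CC p)" "j \<in> Hom CC (Cod CC f) (Cod CC p)" "Comp CC p i = Comp CC j f"
    unfolding fibrations_def by blast
  have p: "p \<in> IC.fib" using p pr_fib pr unfolding dependent_projection_def by metis
  note [simp] = PC.fib_Arr[OF p] H(1,2)[unfolded CC.in_Hom] f
  obtain j' where j': "j' \<in> Arr CC" "Dom CC j' = Cod CC j" "Cod CC j' = Dom CC j" "Comp CC j' j = Ident CC (Dom CC j)" "is_iso CC j'"
    using j by (rule CC.isoE)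
  have "f = Comp CC j' (Comp CC p i)" unfolding H(3) using CC.reassoc[OF j'(4), of f] j' by simp
  moreover have "Comp CC j' (Comp CC p i) \<in> IC.fib"
    using PC.fib_comp[OF IC.fib.iso[OF j'(5)] PC.fib_comp[OF p IC.fib.iso[OF i]]] j' by simp
  ultimately show "f \<in> IC.fib" by simp
qed

lemma path_category_CC: "path_category CC PC.weq (fibrations (\<turnstile>))"
  unfolding fibrations_eq by (rule PC.path_category)

end

theorem theorem6p5:
  fixes der :: "'c ctx \<Rightarrow> 'c expr judgement \<Rightarrow> bool"
    and \<I> \<r> \<J> \<H> :: 'c
  assumes "propositional_identity_types der \<I> \<r> \<J> \<H>"
  shows "\<exists>W. path_category (classifying_category der) W (fibrations der)"
  using propositional_identity_types.path_category_CC[OF assms] by blast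

end
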